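(* Let $f_1,\dots,f_m$ be rational linear forms on $\mathbb{R}^d$ such that every variable appears in at least one form and the system $f_1(x)=\cdots=f_m(x)=1$ is consistent; let $s$ be its solution space and $P:=s\cap\mathbb{R}^d_{\ge0}$. For $t=1,2,\ldots$ let $A^\circ(t)$ be the number of integer points $x\in tP$ with distinct positive entries, and $A(t)$ the number of pairs $(x,\sigma)$ consisting of a nonnegative integer point $x\in tP$ and a permutation $\sigma$ of $[d]$ compatible with $x$ and realizable in $P^\circ$. Suppose $P$ is bounded and does not lie within a coordinate hyperplane. Then $A^\circ$ and $A$ are quasipolynomials with leading term $(\operatorname{vol}P)\,t^{\dim s}$, with constant term $A(0)$ equal to the number of permutations of $[d]$ realizable in $P^\circ$, and $(-1)^{\dim s}A^\circ(-t)=A(t)$.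
   Context: $P^\circ$ is the relative interior of $P$. A quasipolynomial is a function $\sum_i c_i(t)t^i$ with periodic coefficients; values at $-t$ and $0$ refer to the quasipolynomials. $\operatorname{vol}P$ is normalized relative to the lattice $\mathbb{Z}^d\cap\operatorname{aff}P$. A point $x$ with distinct coordinates realizes the permutation $\tau$ of $[d]$ if $x_{\tau1}<\cdots<x_{\tau d}$; $\tau$ is realizable in $A$ if some $x\in A$ realizes it. $x$ and $\sigma$ are compatible if $x_{\sigma1}\le\cdots\le x_{\sigma d}$.
   Formalization: The leading-term claim assumes that P lies in no hyperplane x_i = x_j (otherwise both counts vanish), and if aff P has no integer point the leading coefficient is vol P only for those t for which ts contains an integer point, and 0 for other t. *)

theory Defs
  imports "HOL-Analysis.Analysis" "HOL-Combinatorics.Permutations"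
begin

text \<open>
  \<open>\<real>\<^sup>d\<close> is \<^typ>\<open>real ^ 'n\<close>, where the finite linear order \<^typ>\<open>'n\<close> plays the role of
  \<open>[d]\<close>: the order is what makes \<open>x\<^bsub>\<tau>1\<^esub> < \<dots> < x\<^bsub>\<tau>d\<^esub>\<close> meaningful.
\<close>

definition rational_linear_form :: "(real ^ 'n \<Rightarrow> real) \<Rightarrow> bool" where
  "rational_linear_form g \<longleftrightarrow> linear g \<and> (\<forall>j. g (axis j 1) \<in> \<rat>)"

definition appears_in :: "'n \<Rightarrow> (real ^ 'n \<Rightarrow> real) \<Rightarrow> bool" where
  "appears_in j g \<longleftrightarrow> g (axis j 1) \<noteq> 0"

definition integer_points :: "(real ^ 'n) set" where
  "integer_points = {x. \<forall>j. x $ j \<in> \<int>}"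

definition dilate :: "real \<Rightarrow> (real ^ 'n) set \<Rightarrow> (real ^ 'n) set" where
  "dilate t S = (\<lambda>x. t *\<^sub>R x) ` S"

definition realizes :: "real ^ 'n::{finite,linorder} \<Rightarrow> ('n \<Rightarrow> 'n) \<Rightarrow> bool" where
  "realizes x \<tau> \<longleftrightarrow> strict_mono (\<lambda>i. x $ \<tau> i)"

definition realizable_in :: "('n \<Rightarrow> 'n) \<Rightarrow> (real ^ 'n::{finite,linorder}) set \<Rightarrow> bool" where
  "realizable_in \<tau> S \<longleftrightarrow> (\<exists>x\<in>S. realizes x \<tau>)"

definition compatible :: "real ^ 'n::{finite,linorder} \<Rightarrow> ('n \<Rightarrow> 'n) \<Rightarrow> bool" where
  "compatible x \<sigma> \<longleftrightarrow> mono (\<lambda>i. x $ \<sigma> i)"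

definition A_open :: "(real ^ 'n) set \<Rightarrow> nat \<Rightarrow> nat" where
  "A_open P t = card {x \<in> integer_points \<inter> dilate (real t) P.
     (\<forall>j. 0 < x $ j) \<and> inj (\<lambda>j. x $ j)}"

definition A_closed :: "(real ^ 'n::{finite,linorder}) set \<Rightarrow> nat \<Rightarrow> nat" where
  "A_closed P t = card {(x, \<sigma>). x \<in> integer_points \<inter> dilate (real t) P \<and> (\<forall>j. 0 \<le> x $ j) \<and>
     \<sigma> permutes UNIV \<and> compatible x \<sigma> \<and> realizable_in \<sigma> (rel_interior P)}"

definition periodic :: "(int \<Rightarrow> real) \<Rightarrow> bool" where
  "periodic c \<longleftrightarrow> (\<exists>p>0. \<forall>t. c (t + p) = c t)"

definition quasipolynomial :: "(int \<Rightarrow> real) \<Rightarrow> bool" where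
  "quasipolynomial q \<longleftrightarrow> (\<exists>n c. (\<forall>i\<le>n. periodic (c i)) \<and>
     (\<forall>t. q t = (\<Sum>i\<le>n. c i t * of_int t ^ i)))"

text \<open>
  The leading coefficient of a quasipolynomial is itself a periodic function; \<open>L\<close> is that
  function. Coefficient functions are determined by the quasipolynomial.
\<close>

definition has_leading_term :: "(int \<Rightarrow> real) \<Rightarrow> (int \<Rightarrow> real) \<Rightarrow> nat \<Rightarrow> bool" where
  "has_leading_term q L n \<longleftrightarrow> (\<exists>c. (\<forall>i\<le>n. periodic (c i)) \<and>
     (\<forall>t. q t = (\<Sum>i\<le>n. c i t * of_int t ^ i)) \<and> c n = L)"

text \<open>
  The translation lattice of \<open>\<int>\<^sup>d \<inter> aff P\<close>, which also makes sense when
  \<open>\<int>\<^sup>d \<inter> aff P\<close> is empty (then it is the translation lattice of \<open>\<int>\<^sup>d \<inter> aff (tP)\<close>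
  for every \<open>t \<ge> 1\<close> for which that set is nonempty).
\<close>

definition direction_lattice :: "(real ^ 'n) set \<Rightarrow> (real ^ 'n) set" where
  "direction_lattice P =
     integer_points \<inter> {x - y | x y. x \<in> affine hull P \<and> y \<in> affine hull P}"

definition lattice_basis :: "(real ^ 'n) set \<Rightarrow> (real ^ 'n) set \<Rightarrow> bool" where
  "lattice_basis B \<Lambda> \<longleftrightarrow> independent B \<and>
     \<Lambda> = range (\<lambda>z :: real ^ 'n \<Rightarrow> int. \<Sum>b\<in>B. of_int (z b) *\<^sub>R b)"

text \<open>
  Volume in the affine coordinates \<open>p + (\<Sum>b\<in>B. u b *\<^sub>R b)\<close>, in which a fundamental
  domain of the lattice is a unit cube. For a rational polytope a lattice basis \<open>B\<close> exists,
  and by unimodularity and translation invariance the value depends on neither \<open>B\<close> nor \<open>p\<close>.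
  A single point has volume 1.
\<close>

definition coordinate_volume ::
    "(real ^ 'n) set \<Rightarrow> real ^ 'n \<Rightarrow> (real ^ 'n) set \<Rightarrow> real" where
  "coordinate_volume B p P = measure (Pi\<^sub>M B (\<lambda>_. lborel))
     {u \<in> B \<rightarrow>\<^sub>E UNIV. p + (\<Sum>b\<in>B. u b *\<^sub>R b) \<in> P}"

definition vol :: "(real ^ 'n) set \<Rightarrow> real" where
  "vol P = coordinate_volume (SOME B. lattice_basis B (direction_lattice P))
     (SOME p. p \<in> affine hull P) P"

end

theory Submission
  imports Defs "HOL-Computational_Algebra.Group_Closure"
begin

text \<open>
  The points counted by \<open>A_closed\<close> and \<open>A_open\<close> are split by the permutations \<open>\<sigma>\<close> that sort their
  coordinates. In the linear space \<open>W = {f\<^sub>1 = \<dots> = f\<^sub>m}\<close> with height \<open>f\<^sub>1\<close>, the points of \<open>tP\<close>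
  belonging to \<open>\<sigma>\<close> are the integer points of height \<open>t\<close> in a pointed rational cone, respectively in
  its interior, so that everything reduces to reciprocity for such cones.

  Let \<open>w\<close> be an interior point of the cone satisfying no rational linear relation beyond those
  of \<open>W\<close>. A point \<open>x\<close> lies in the closed cone iff \<open>x + \<epsilon> w\<close> lies in the cone for small \<open>\<epsilon> > 0\<close>,
  and in the open cone iff \<open>x - \<epsilon> w\<close> does. A triangulation therefore induces two partitions into
  half-open simplicial cones, one of the closed cone and one of the open cone, in which
  corresponding pieces have complementary facets removed. For a half-open simplicial cone the count
  is an explicit sum of binomial coefficients over the integer points of a half-open parallelepiped,
  and a point reflection of the parallelepiped gives the reciprocity. The leading coefficient is a
  limit of Riemann sums.
\<close>

section \<open>Quasipolynomials\<close>

lemma periodic_iff_dvd: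
  "periodic c \<longleftrightarrow> (\<exists>p>0. \<forall>t u. p dvd u - t \<longrightarrow> c u = c t)"
proof
  assume "periodic c"
  then obtain p where p: "p > 0" "\<And>t. c (t + p) = c t" unfolding periodic_def by blast
  have "c (t + p * k) = c t" for t k
  proof (induction k rule: int_induct[where k = 0])
    case (step1 i)
    then show ?case using p(2)[of "t + p * i"] by (simp add: algebra_simps)
  next
    case (step2 i)
    then show ?case using p(2)[of "t + p * (i - 1)"] by (simp add: algebra_simps)
  qed simp
  then have "c u = c t" if "p dvd u - t" for t u
    using that by (metis add.commute diff_add_cancel dvdE)
  then show "\<exists>p>0. \<forall>t u. p dvd u - t \<longrightarrow> c u = c t" using p(1) by blast
next
  assume "\<exists>p>0. \<forall>t u. p dvd u - t \<longrightarrow> c u = c t"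
  then obtain p where "p > 0" "\<And>t u. p dvd u - t \<Longrightarrow> c u = c t" by blast
  then show "periodic c" unfolding periodic_def by (intro exI[of _ p]) simp
qed

lemma ex_common_period:
  assumes "finite I" and "\<And>i. i \<in> I \<Longrightarrow> periodic (c i)"
  obtains p where "p > 0" "\<And>i t u. i \<in> I \<Longrightarrow> p dvd u - t \<Longrightarrow> c i u = c i t"
proof -
  obtain p where p: "\<And>i. i \<in> I \<Longrightarrow> p i > 0"
      "\<And>i t u. i \<in> I \<Longrightarrow> p i dvd u - t \<Longrightarrow> c i u = c i t"
    using assms(2) unfolding periodic_iff_dvd by metis
  have "c i u = c i t" if "i \<in> I" "(\<Prod>i\<in>I. p i) dvd u - t" for i t u
    using p(2)[OF that(1)] dvd_trans[OF dvd_prodI[OF assms(1) that(1)] that(2)] by blast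
  moreover have "(\<Prod>i\<in>I. p i) > 0" using p(1) by (intro prod_pos)
  ultimately show ?thesis using that by blast
qed

lemma periodic_const [simp]: "periodic (\<lambda>_. a)"
  unfolding periodic_def by (intro exI[of _ 1]) auto

lemma periodic_compose: "periodic c \<Longrightarrow> periodic (\<lambda>t. F (c t))"
  by (auto simp: periodic_def)

lemma periodic_combine:
  assumes "periodic c" "periodic d"
  shows "periodic (\<lambda>t. F (c t) (d t))"
proof -
  have "periodic (if b then c else d)" for b using assms by simp
  then obtain p where p: "p > 0"
      "\<And>b t u. p dvd u - t \<Longrightarrow> (if b then c else d) u = (if b then c else d) t"
    by (rule ex_common_period[OF finite[of UNIV], of "\<lambda>b. if b then c else d"]) simp
  have "F (c u) (d u) = F (c t) (d t)" if "p dvd u - t" for t u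
    using p(2)[OF that, of True] p(2)[OF that, of False] by simp
  then show ?thesis unfolding periodic_iff_dvd using p(1) by blast
qed

lemma periodic_reflect:
  assumes "periodic c" shows "periodic (\<lambda>t. c (- t))"
proof -
  obtain p where p: "p > 0" "\<And>t u. p dvd u - t \<Longrightarrow> c u = c t"
    using assms unfolding periodic_iff_dvd by blast
  have "c (- u) = c (- t)" if "p dvd u - t" for t u
    by (rule p(2)) (use that in \<open>simp add: dvd_diff_commute\<close>)
  then show ?thesis unfolding periodic_iff_dvd using p(1) by blast
qed

definition quasipolynomial_le :: "nat \<Rightarrow> (int \<Rightarrow> real) \<Rightarrow> bool" where
  "quasipolynomial_le n q \<longleftrightarrow> (\<exists>L. has_leading_term q L n)"

lemma quasipolynomial_iff_le: "quasipolynomial q \<longleftrightarrow> (\<exists>n. quasipolynomial_le n q)"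
  by (auto simp: quasipolynomial_def quasipolynomial_le_def has_leading_term_def)

lemma has_leading_termE:
  assumes "has_leading_term q L n"
  obtains c where "\<And>i. i \<le> n \<Longrightarrow> periodic (c i)"
    "\<And>t. q t = (\<Sum>i\<le>n. c i t * of_int t ^ i)" "c n = L"
  using assms unfolding has_leading_term_def by blast

lemma has_leading_term_periodic: "periodic c \<Longrightarrow> has_leading_term c c 0"
  unfolding has_leading_term_def by (intro exI[of _ "\<lambda>_. c"]) auto

lemma has_leading_term_zero: "has_leading_term (\<lambda>_. 0) (\<lambda>_. 0) n"
  unfolding has_leading_term_def by (intro exI[of _ "\<lambda>_ _. 0"]) auto

lemma has_leading_term_add:
  assumes "has_leading_term q L n" "has_leading_term r M n"
  shows "has_leading_term (\<lambda>t. q t + r t) (\<lambda>t. L t + M t) n"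
proof -
  obtain c where c: "\<And>i. i \<le> n \<Longrightarrow> periodic (c i)"
      "\<And>t. q t = (\<Sum>i\<le>n. c i t * of_int t ^ i)" "c n = L"
    using has_leading_termE[OF assms(1)] by blast
  obtain d where d: "\<And>i. i \<le> n \<Longrightarrow> periodic (d i)"
      "\<And>t. r t = (\<Sum>i\<le>n. d i t * of_int t ^ i)" "d n = M"
    using has_leading_termE[OF assms(2)] by blast
  show ?thesis
    unfolding has_leading_term_def using c d
    by (intro exI[of _ "\<lambda>i t. c i t + d i t"])
       (auto simp: sum.distrib ring_distribs intro!: periodic_combine[of _ _ "(+)"])
qed

lemma quasipolynomial_le_sum:
  assumes "\<And>i. i \<in> I \<Longrightarrow> quasipolynomial_le n (q i)"
  shows "quasipolynomial_le n (\<lambda>t. \<Sum>i\<in>I. q i t)"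
proof -
  obtain L where "\<And>i. i \<in> I \<Longrightarrow> has_leading_term (q i) (L i) n"
    using assms unfolding quasipolynomial_le_def by metis
  then have "has_leading_term (\<lambda>t. \<Sum>i\<in>I. q i t) (\<lambda>t. \<Sum>i\<in>I. L i t) n"
    by (induction I rule: infinite_finite_induct)
       (auto intro: has_leading_term_zero has_leading_term_add)
  then show ?thesis unfolding quasipolynomial_le_def by blast
qed

lemma has_leading_term_mult_linear:
  assumes "has_leading_term q L n"
  shows "has_leading_term (\<lambda>t. q t * (a * of_int t + b)) (\<lambda>t. a * L t) (Suc n)"
proof -
  obtain c where c: "\<And>i. i \<le> n \<Longrightarrow> periodic (c i)"
      "\<And>t. q t = (\<Sum>i\<le>n. c i t * of_int t ^ i)" "c n = L"
    using has_leading_termE[OF assms] by blast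
  define shifted where "shifted i t = (if i = 0 then 0 else a * c (i - 1) t)" for i t
  define kept where "kept i t = (if i \<le> n then b * c i t else 0)" for i t
  have "periodic (shifted i)" if "i \<le> Suc n" for i
    using that periodic_compose[OF c(1)[of "i - 1"], of "(*) a"]
    by (cases "i = 0") (auto simp: shifted_def[abs_def])
  moreover have "periodic (kept i)" for i
    using periodic_compose[OF c(1)[of i], of "(*) b"]
    by (cases "i \<le> n") (auto simp: kept_def[abs_def])
  ultimately have "periodic (\<lambda>t. shifted i t + kept i t)" if "i \<le> Suc n" for i
    using that periodic_combine[of "shifted i" "kept i" "(+)"] by blast
  moreover have "q t * (a * of_int t + b) =
      (\<Sum>i\<le>Suc n. (shifted i t + kept i t) * of_int t ^ i)" for t
  proof -
    have "(\<Sum>i\<le>Suc n. shifted i t * of_int t ^ i) = q t * (a * of_int t)"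
      by (subst sum.atMost_Suc_shift) (simp add: shifted_def c(2) sum_distrib_left mult_ac)
    moreover have "(\<Sum>i\<le>Suc n. kept i t * of_int t ^ i) = q t * b"
      by (simp add: kept_def c(2) sum_distrib_left mult_ac)
    ultimately show ?thesis by (simp add: ring_distribs sum.distrib del: sum.atMost_Suc)
  qed
  moreover have "(\<lambda>t. shifted (Suc n) t + kept (Suc n) t) = (\<lambda>t. a * L t)"
    by (simp add: shifted_def kept_def c(3))
  ultimately show ?thesis
    unfolding has_leading_term_def by (intro exI[of _ "\<lambda>i t. shifted i t + kept i t"]) blast
qed

lemma quasipolynomial_le_mult_prod_linear:
  assumes "periodic c"
  shows "quasipolynomial_le n (\<lambda>t. c t * (\<Prod>i<n. a i * of_int t + b i))"
proof (induction n)
  case 0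
  then show ?case
    using has_leading_term_periodic[OF assms] by (auto simp: quasipolynomial_le_def)
next
  case (Suc n)
  then show ?case
    using has_leading_term_mult_linear[of _ _ n "a n" "b n"]
    by (force simp: quasipolynomial_le_def mult.assoc)
qed

lemma has_leading_term_reflect:
  assumes "has_leading_term q L n"
  shows "has_leading_term (\<lambda>t. a * q (- t)) (\<lambda>t. a * (-1) ^ n * L (- t)) n"
proof -
  obtain c where c: "\<And>i. i \<le> n \<Longrightarrow> periodic (c i)"
      "\<And>t. q t = (\<Sum>i\<le>n. c i t * of_int t ^ i)" "c n = L"
    using has_leading_termE[OF assms] by blast
  have "periodic (\<lambda>t. a * (-1) ^ i * c i (- t))" if "i \<le> n" for i
    using periodic_compose[OF periodic_reflect[OF c(1)[OF that]]] .
  moreover have "a * q (- t) = (\<Sum>i\<le>n. a * (-1) ^ i * c i (- t) * of_int t ^ i)" for t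
    by (simp add: c(2) sum_distrib_left power_minus[of "of_int t"] mult_ac)
  ultimately show ?thesis
    unfolding has_leading_term_def using c(3)
    by (intro exI[of _ "\<lambda>i t. a * (-1) ^ i * c i (- t)"]) auto
qed

lemma tendsto_power_divide_power:
  fixes x :: "'a \<Rightarrow> real"
  assumes "filterlim x at_top F" "i \<le> n"
  shows "((\<lambda>k. x k ^ i / x k ^ n) \<longlongrightarrow> (if i = n then 1 else 0)) F"
proof -
  have "\<forall>\<^sub>F k in F. x k > 0" using assms(1) unfolding filterlim_at_top_dense by blast
  then have ev: "\<forall>\<^sub>F k in F. inverse (x k ^ (n - i)) = x k ^ i / x k ^ n"
    by eventually_elim (simp add: assms(2) power_diff field_simps)
  have "((\<lambda>k. inverse (x k ^ (n - i))) \<longlongrightarrow> (if i = n then 1 else 0)) F"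
  proof (cases "i = n")
    case False
    then have "filterlim (\<lambda>k. x k ^ (n - i)) at_top F"
      using assms by (intro filterlim_pow_at_top) auto
    then show ?thesis
      using False by (simp add: tendsto_inverse_0_at_top)
  qed simp
  then show ?thesis using ev by (rule Lim_transform_eventually)
qed

lemma tendsto_leading_coefficient:
  assumes "has_leading_term q L n"
  obtains p where "p > 0" "\<And>t T. filterlim T at_top sequentially \<Longrightarrow> (\<And>k. p dvd T k - t) \<Longrightarrow>
    (\<lambda>k. q (T k) / of_int (T k) ^ n) \<longlonglongrightarrow> L t"
proof -
  obtain c where c: "\<And>i. i \<le> n \<Longrightarrow> periodic (c i)"
      "\<And>t. q t = (\<Sum>i\<le>n. c i t * of_int t ^ i)" "c n = L"
    using has_leading_termE[OF assms] by blast
  obtain p where p: "p > 0" "\<And>i t u. i \<le> n \<Longrightarrow> p dvd u - t \<Longrightarrow> c i u = c i t"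
    using ex_common_period[of "{..n}" c] c(1) by auto
  have "(\<lambda>k. q (T k) / of_int (T k) ^ n) \<longlonglongrightarrow> L t"
    if T: "filterlim T at_top sequentially" and dvd: "\<And>k. p dvd T k - t" for t T
  proof -
    have "filterlim (\<lambda>k. real_of_int (T k)) at_top sequentially"
      using filterlim_compose[OF filterlim_real_of_int_at_top T] .
    then have "(\<lambda>k. \<Sum>i\<le>n. c i t * (of_int (T k) ^ i / of_int (T k) ^ n))
        \<longlonglongrightarrow> (\<Sum>i\<le>n. c i t * (if i = n then 1 else 0))"
      by (intro tendsto_sum tendsto_mult tendsto_const tendsto_power_divide_power) auto
    moreover have "(\<Sum>i\<le>n. c i t * (if i = n then 1 else 0)) = L t"
      by (simp add: c(3) if_distrib[of "\<lambda>x. _ * x"] cong: if_cong)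
    moreover have "q (T k) / of_int (T k) ^ n =
        (\<Sum>i\<le>n. c i t * (of_int (T k) ^ i / of_int (T k) ^ n))" for k
      using p(2)[OF _ dvd] by (simp add: c(2) sum_divide_distrib)
    ultimately show ?thesis by simp
  qed
  then show ?thesis using that p(1) by blast
qed

lemma has_leading_termI:
  assumes "quasipolynomial_le n q"
    and lim: "\<And>t p. p > 0 \<Longrightarrow> \<exists>T. filterlim T at_top sequentially \<and> (\<forall>k. p dvd T k - t) \<and>
      (\<lambda>k. q (T k) / of_int (T k) ^ n) \<longlonglongrightarrow> L t"
  shows "has_leading_term q L n"
proof -
  obtain L' where L': "has_leading_term q L' n"
    using assms(1) unfolding quasipolynomial_le_def by blast
  obtain p where p: "p > 0" "\<And>t T. filterlim T at_top sequentially \<Longrightarrow> (\<And>k. p dvd T k - t) \<Longrightarrow>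
      (\<lambda>k. q (T k) / of_int (T k) ^ n) \<longlonglongrightarrow> L' t"
    using tendsto_leading_coefficient[OF L'] by blast
  have "L' t = L t" for t
    using lim[OF p(1), of t] p(2) LIMSEQ_unique by metis
  then have "L' = L" by auto
  then show ?thesis using L' by simp
qed

lemma ex_nat_progression:
  fixes m t :: int
  assumes "m > 0"
  obtains T :: "nat \<Rightarrow> nat" where "filterlim T at_top sequentially" "\<And>k. T k \<ge> 1"
    "\<And>k. m dvd int (T k) - t"
proof -
  define N where "N k = int k + \<bar>t\<bar> + 1" for k
  define T where "T k = nat (t + m * N k)" for k
  have ge: "t + m * N k \<ge> int k + 1" for k
  proof -
    have "t + N k \<ge> int k + 1" "N k \<ge> 0" by (simp_all add: N_def)
    then show ?thesis using mult_right_mono[of 1 m "N k"] assms by linarith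
  qed
  have T: "int (T k) = t + m * N k" for k using ge[of k] by (simp add: T_def)
  have T_ge: "T k \<ge> Suc k" for k using ge[of k] T[of k] by linarith
  then have "filterlim T at_top sequentially"
    by (intro filterlim_at_top_mono[OF filterlim_Suc]) auto
  moreover have "T k \<ge> 1" for k using T_ge[of k] by simp
  ultimately show ?thesis using that T by simp
qed

section \<open>Rational subspaces and their generic points\<close>

definition rational_points :: "(real ^ 'n) set" where
  "rational_points = {c. \<forall>j. c $ j \<in> \<rat>}"

lemma rational_points_zero [simp]: "0 \<in> rational_points"
  by (simp add: rational_points_def)

lemma rational_points_add: "c \<in> rational_points \<Longrightarrow> d \<in> rational_points \<Longrightarrow> c + d \<in> rational_points"
  by (simp add: rational_points_def)

lemma rational_points_diff: "c \<in> rational_points \<Longrightarrow> d \<in> rational_points \<Longrightarrow> c - d \<in> rational_points"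
  by (simp add: rational_points_def)

lemma rational_points_scale: "r \<in> \<rat> \<Longrightarrow> c \<in> rational_points \<Longrightarrow> r *\<^sub>R c \<in> rational_points"
  by (simp add: rational_points_def)

lemma rational_points_axis [simp]: "axis j 1 \<in> rational_points"
  by (auto simp: rational_points_def axis_def)

lemma rational_points_inner:
  "c \<in> rational_points \<Longrightarrow> d \<in> rational_points \<Longrightarrow> c \<bullet> d \<in> \<rat>"
  for c :: "real ^ 'n"
  unfolding inner_vec_def rational_points_def by (auto intro!: Rats_sum)

lemma rational_points_inner_quotient:
  "\<lbrakk>c \<in> rational_points; d \<in> rational_points; u \<in> rational_points; v \<in> rational_points\<rbrakk>
    \<Longrightarrow> (c \<bullet> u) / (d \<bullet> v) \<in> \<rat>"
  for c :: "real ^ 'n"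
  by (intro Rats_divide rational_points_inner)

lemma countable_rational_points: "countable (rational_points :: (real ^ 'n) set)"
  unfolding rational_points_def by (rule countable_vector) (rule countable_rat)

definition rational_subspace :: "(real ^ 'n) set \<Rightarrow> bool" where
  "rational_subspace W \<longleftrightarrow> span (W \<inter> rational_points) = W"

lemma subspace_rational_subspace: "rational_subspace W \<Longrightarrow> subspace W"
  unfolding rational_subspace_def by (metis subspace_span)

lemma rational_subspace_UNIV: "rational_subspace (UNIV :: (real ^ 'n) set)"
proof -
  have "Basis \<subseteq> (rational_points :: (real ^ 'n) set)" by (auto simp: Basis_vec_def)
  then show ?thesis
    using span_mono[of Basis rational_points] by (auto simp: rational_subspace_def)
qed

lemma subspace_hyperplane_Int: "subspace W \<Longrightarrow> subspace {x \<in> W. c \<bullet> x = 0}"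
  by (auto simp: subspace_def inner_add_right)

text \<open>Projection along a rational \<open>v \<in> W\<close> with \<open>c \<bullet> v \<noteq> 0\<close> maps the rational points of \<open>W\<close> to
  rational points of the hyperplane.\<close>

lemma rational_subspace_hyperplane_Int:
  assumes W: "rational_subspace W" and c: "c \<in> rational_points"
  shows "rational_subspace {x \<in> W. c \<bullet> x = 0}"
proof (cases "\<forall>v\<in>W \<inter> rational_points. c \<bullet> v = 0")
  case True
  then have "W \<inter> rational_points \<subseteq> {x. c \<bullet> x = 0}" by blast
  then have "span (W \<inter> rational_points) \<subseteq> {x. c \<bullet> x = 0}"
    by (rule span_minimal) (rule subspace_hyperplane)
  then have "{x \<in> W. c \<bullet> x = 0} = W" using W by (auto simp: rational_subspace_def)
  then show ?thesis using W by simp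
next
  case False
  let ?H = "{x \<in> W. c \<bullet> x = 0}"
  obtain v where v: "v \<in> W" "v \<in> rational_points" "c \<bullet> v \<noteq> 0" using False by blast
  define project where "project x = x - (c \<bullet> x / (c \<bullet> v)) *\<^sub>R v" for x
  have "linear project"
    by (rule linearI) (simp_all add: project_def inner_add_right add_divide_distrib algebra_simps)
  note sW = subspace_rational_subspace[OF W]
  have "project ` (W \<inter> rational_points) \<subseteq> ?H \<inter> rational_points"
    using v c sW
    by (auto simp: project_def inner_diff_right subspace_diff subspace_scale
        intro!: rational_points_diff rational_points_scale rational_points_inner_quotient)
  then have "project ` W \<subseteq> span (?H \<inter> rational_points)"
    using W linear_span_image[OF \<open>linear project\<close>, of "W \<inter> rational_points"] span_mono
    unfolding rational_subspace_def by metis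
  moreover have "project x = x" if "x \<in> ?H" for x using that by (simp add: project_def)
  ultimately have "?H \<subseteq> span (?H \<inter> rational_points)" by (auto simp: image_subset_iff)
  moreover have "span (?H \<inter> rational_points) \<subseteq> ?H"
    using subspace_hyperplane_Int[OF sW] by (intro span_minimal) auto
  ultimately show ?thesis by (auto simp: rational_subspace_def)
qed

lemma rational_subspace_hyperplanes_Int:
  assumes "rational_subspace W" "finite C" "C \<subseteq> rational_points"
  shows "rational_subspace {x \<in> W. \<forall>c\<in>C. c \<bullet> x = 0}"
  using assms(2,3)
proof (induction C rule: finite_induct)
  case (insert c C)
  then have "rational_subspace {x \<in> {x \<in> W. \<forall>c\<in>C. c \<bullet> x = 0}. c \<bullet> x = 0}"
    by (intro rational_subspace_hyperplane_Int) auto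
  then show ?case by (rule back_subst[of rational_subspace]) auto
qed (use assms(1) in simp)

lemma rational_subspace_closure:
  assumes "rational_subspace W"
  shows "W \<subseteq> closure (W \<inter> rational_points)"
proof
  fix x assume "x \<in> W"
  then have "x \<in> span (W \<inter> rational_points)" using assms by (simp add: rational_subspace_def)
  then show "x \<in> closure (W \<inter> rational_points)"
  proof (induction rule: span_induct_alt)
    case base
    have "0 \<in> W" using subspace_0[OF subspace_rational_subspace[OF assms]] .
    then show ?case by (intro closure_subset[THEN subsetD]) simp
  next
    case (step r y z)
    obtain q where q: "\<And>n. q n \<in> \<rat>" "q \<longlonglongrightarrow> r"
      using Rats_closure_real[THEN eqset_imp_iff, of r] unfolding closure_sequential by auto
    obtain zs where zs: "\<And>n. zs n \<in> W \<inter> rational_points" "zs \<longlonglongrightarrow> z"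
      using step(2) unfolding closure_sequential by auto
    have "q n *\<^sub>R y + zs n \<in> W \<inter> rational_points" for n
      using zs(1)[of n] step(1) q(1)[of n] subspace_rational_subspace[OF assms]
      by (auto simp: subspace_add subspace_scale intro!: rational_points_add rational_points_scale)
    moreover have "(\<lambda>n. q n *\<^sub>R y + zs n) \<longlonglongrightarrow> r *\<^sub>R y + z"
      by (intro tendsto_intros q zs)
    ultimately show ?case
      unfolding closure_sequential by (intro exI[of _ "\<lambda>n. q n *\<^sub>R y + zs n"]) blast
  qed
qed

lemma rational_point_same_signs:
  fixes A :: "(real ^ 'n) set"
  assumes W: "rational_subspace W" and A: "finite A" "A \<subseteq> rational_points" and x: "x \<in> W"
  obtains u where "u \<in> W" "u \<in> rational_points" "\<And>a. a \<in> A \<Longrightarrow> a \<bullet> x > 0 \<Longrightarrow> a \<bullet> u > 0"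
    "\<And>a. a \<in> A \<Longrightarrow> a \<bullet> x = 0 \<Longrightarrow> a \<bullet> u = 0"
proof -
  let ?W = "{y \<in> W. \<forall>a\<in>{a\<in>A. a \<bullet> x = 0}. a \<bullet> y = 0}"
  let ?N = "\<Inter>a\<in>{a\<in>A. a \<bullet> x > 0}. {y. a \<bullet> y > 0}"
  have "rational_subspace ?W" using W A by (intro rational_subspace_hyperplanes_Int) auto
  then have "x \<in> closure (?W \<inter> rational_points)" using rational_subspace_closure x by blast
  moreover have "open ?N" using A(1) by (intro open_INT) (auto intro: open_halfspace_gt)
  moreover have "x \<in> ?N" by auto
  ultimately have "?N \<inter> (?W \<inter> rational_points) \<noteq> {}"
    using open_Int_closure_eq_empty by blast
  then show ?thesis using that by blast
qed

definition generic_point :: "(real ^ 'n) set \<Rightarrow> real ^ 'n \<Rightarrow> bool" where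
  "generic_point W w \<longleftrightarrow> w \<in> W \<and> (\<forall>c\<in>rational_points. c \<bullet> w = 0 \<longrightarrow> (\<forall>x\<in>W. c \<bullet> x = 0))"

lemma generic_pointD:
  "generic_point W w \<Longrightarrow> c \<in> rational_points \<Longrightarrow> c \<bullet> w = 0 \<Longrightarrow> x \<in> W \<Longrightarrow> c \<bullet> x = 0"
  by (simp add: generic_point_def)

lemma generic_point_uminus: "subspace W \<Longrightarrow> generic_point W w \<Longrightarrow> generic_point W (- w)"
  by (simp add: generic_point_def subspace_neg)

lemma generic_point_zeroD:
  assumes "generic_point W 0" shows "W \<subseteq> {0}"
proof
  fix x assume "x \<in> W"
  then have "axis j 1 \<bullet> x = 0" for j using generic_pointD[OF assms] by simp
  then show "x \<in> {0}" by (simp add: vec_eq_iff inner_axis')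
qed

lemma generic_point_project:
  assumes w: "generic_point W w" and W: "subspace W" and u: "u \<in> W" "u \<in> rational_points"
    and k: "k \<in> rational_points" "k \<bullet> u \<noteq> 0"
  shows "generic_point {x \<in> W. k \<bullet> x = 0} (w - (k \<bullet> w / (k \<bullet> u)) *\<^sub>R u)"
  unfolding generic_point_def
proof (intro conjI ballI impI)
  show "w - (k \<bullet> w / (k \<bullet> u)) *\<^sub>R u \<in> {x \<in> W. k \<bullet> x = 0}"
    using w W u k(2) by (simp add: generic_point_def subspace_diff subspace_scale inner_diff_right)
next
  fix c x assume c: "c \<in> rational_points" "c \<bullet> (w - (k \<bullet> w / (k \<bullet> u)) *\<^sub>R u) = 0"
    and x: "x \<in> {x \<in> W. k \<bullet> x = 0}"
  define d where "d = c - (c \<bullet> u / (k \<bullet> u)) *\<^sub>R k"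
  have "d \<in> rational_points"
    unfolding d_def using c(1) k u
    by (intro rational_points_diff rational_points_scale rational_points_inner_quotient)
  moreover have "d \<bullet> w = 0"
    using c(2) by (simp add: d_def inner_diff_left inner_diff_right mult.commute)
  ultimately have "d \<bullet> x = 0" using generic_pointD[OF w] x by blast
  then show "c \<bullet> x = 0" using x by (simp add: d_def inner_diff_left)
qed

lemma closure_hyperplane_complement_Int:
  fixes c :: "'a::real_inner"
  assumes W: "subspace W" and y: "y \<in> W" "c \<bullet> y \<noteq> 0"
  shows "W \<subseteq> closure {x \<in> W. c \<bullet> x \<noteq> 0}"
proof
  fix x assume x: "x \<in> W"
  show "x \<in> closure {x \<in> W. c \<bullet> x \<noteq> 0}"
  proof (cases "c \<bullet> x = 0")
    case True
    have "x + inverse (real (Suc n)) *\<^sub>R y \<in> {x \<in> W. c \<bullet> x \<noteq> 0}" for n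
      using True W x y by (simp add: subspace_add subspace_scale inner_add_right)
    moreover have "(\<lambda>n. x + inverse (real (Suc n)) *\<^sub>R y) \<longlonglongrightarrow> x + 0 *\<^sub>R y"
      by (intro tendsto_intros LIMSEQ_inverse_real_of_nat)
    ultimately show ?thesis
      unfolding closure_sequential
      by (intro exI[of _ "\<lambda>n. x + inverse (real (Suc n)) *\<^sub>R y"]) simp
  next
    case False
    then show ?thesis using x by (intro subsetD[OF closure_subset]) simp
  qed
qed

lemma generic_points_dense:
  assumes "subspace W"
  shows "W \<subseteq> closure {w. generic_point W w}"
proof -
  define nonvanishing where "nonvanishing = {c \<in> rational_points. \<exists>y\<in>W. c \<bullet> y \<noteq> 0}"
  have "W \<subseteq> closure (\<Inter>(insert W ((\<lambda>c. {x \<in> W. c \<bullet> x \<noteq> 0}) ` nonvanishing)))"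
  proof (rule Baire)
    show "closed W" using assms by (rule closed_subspace)
    show "countable (insert W ((\<lambda>c. {x \<in> W. c \<bullet> x \<noteq> 0}) ` nonvanishing))"
      using countable_subset[OF _ countable_rational_points, of nonvanishing]
      by (simp add: nonvanishing_def)
    fix T assume "T \<in> insert W ((\<lambda>c. {x \<in> W. c \<bullet> x \<noteq> 0}) ` nonvanishing)"
    then consider (whole) "T = W"
      | (open_dense) c y where "T = {x \<in> W. c \<bullet> x \<noteq> 0}" "y \<in> W" "c \<bullet> y \<noteq> 0"
      by (auto simp: nonvanishing_def)
    then show "openin (top_of_set W) T \<and> W \<subseteq> closure T"
    proof cases
      case (open_dense c y)
      have "open {x. c \<bullet> x \<noteq> 0}" by (intro open_Collect_neq continuous_intros)
      moreover have "{x \<in> W. c \<bullet> x \<noteq> 0} = W \<inter> {x. c \<bullet> x \<noteq> 0}" by blast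
      ultimately have "openin (top_of_set W) T"
        unfolding open_dense(1) by (simp add: openin_open_Int)
      then show ?thesis
        using closure_hyperplane_complement_Int[OF assms open_dense(2,3)] open_dense(1) by simp
    qed (simp add: closure_subset)
  qed
  also have "\<Inter>(insert W ((\<lambda>c. {x \<in> W. c \<bullet> x \<noteq> 0}) ` nonvanishing)) = {w. generic_point W w}"
    by (auto simp: generic_point_def nonvanishing_def)
  finally show ?thesis .
qed

lemma ex_generic_point:
  assumes W: "subspace W" and p: "p \<in> W" and A: "finite A" "\<And>a. a \<in> A \<Longrightarrow> a \<bullet> p > 0"
  obtains w where "generic_point W w" "\<And>a. a \<in> A \<Longrightarrow> a \<bullet> w > 0"
proof -
  let ?N = "\<Inter>a\<in>A. {y. a \<bullet> y > 0}"
  have "open ?N" using A(1) by (intro open_INT) (auto intro: open_halfspace_gt)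
  moreover have "p \<in> closure {w. generic_point W w}" using generic_points_dense[OF W] p by blast
  moreover have "p \<in> ?N" using A(2) by simp
  ultimately have "?N \<inter> {w. generic_point W w} \<noteq> {}"
    using open_Int_closure_eq_empty by blast
  then show ?thesis using that by blast
qed

section \<open>Half-open triangulations of rational cones\<close>

text \<open>Nonnegativity of \<open>a + \<epsilon> b\<close> for all small \<open>\<epsilon> > 0\<close>.\<close>

definition lex_nonneg :: "real \<Rightarrow> real \<Rightarrow> bool" where
  "lex_nonneg a b \<longleftrightarrow> a > 0 \<or> a = 0 \<and> b \<ge> 0"

lemma lex_nonneg_add: "lex_nonneg a b \<Longrightarrow> lex_nonneg c d \<Longrightarrow> lex_nonneg (a + c) (b + d)"
  unfolding lex_nonneg_def by auto

lemma lex_nonneg_sum: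
  "(\<And>i. i \<in> I \<Longrightarrow> lex_nonneg (f i) (g i)) \<Longrightarrow> lex_nonneg (sum f I) (sum g I)"
  by (induction I rule: infinite_finite_induct)
     (auto simp: lex_nonneg_add, auto simp: lex_nonneg_def)

lemma lex_nonneg_mult: "r \<ge> 0 \<Longrightarrow> lex_nonneg a b \<Longrightarrow> lex_nonneg (r * a) (r * b)"
  unfolding lex_nonneg_def by (cases "r = 0") auto

lemma lex_nonneg_mult_iff: "r > 0 \<Longrightarrow> lex_nonneg (r * a) (r * b) \<longleftrightarrow> lex_nonneg a b"
  by (auto simp: lex_nonneg_def zero_less_mult_iff zero_le_mult_iff)

lemma lex_nonneg_antisym:
  "lex_nonneg (a - b) (c - d) \<Longrightarrow> lex_nonneg (b - a) (d - c) \<Longrightarrow> c = d"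
  unfolding lex_nonneg_def by auto

lemma ex_lex_minimal:
  fixes f g :: "'a \<Rightarrow> real"
  assumes "finite R" "R \<noteq> {}"
  obtains k where "k \<in> R" "\<And>a. a \<in> R \<Longrightarrow> lex_nonneg (f a - f k) (g a - g k)"
proof -
  define fmin where "fmin = {a\<in>R. f a = Min (f ` R)}"
  have "Min (f ` R) \<in> f ` R" using assms by (intro Min_in) auto
  then have "finite fmin" "fmin \<noteq> {}" using assms(1) by (auto simp: fmin_def)
  then have "Min (g ` fmin) \<in> g ` fmin" by (intro Min_in) auto
  then obtain k where k: "k \<in> fmin" "g k = Min (g ` fmin)" by auto
  have "lex_nonneg (f a - f k) (g a - g k)" if "a \<in> R" for a
  proof (cases "a \<in> fmin")
    case True
    then have "f a = f k" "g a \<ge> g k" using k \<open>finite fmin\<close> by (auto simp: fmin_def)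
    then show ?thesis by (simp add: lex_nonneg_def)
  next
    case False
    have "f k \<le> f a" using k(1) that assms(1) by (simp add: fmin_def)
    then have "f k < f a" using False that k(1) by (auto simp: fmin_def)
    then show ?thesis by (simp add: lex_nonneg_def)
  qed
  then show ?thesis using that k(1) by (auto simp: fmin_def)
qed

lemma inner_representation:
  fixes U :: "'a::real_inner set"
  assumes "independent U" "finite U" "x \<in> span U"
  shows "a \<bullet> x = (\<Sum>b\<in>U. (a \<bullet> b) * representation U x b)"
proof -
  have "a \<bullet> x = a \<bullet> (\<Sum>b\<in>U. representation U x b *\<^sub>R b)"
    using real_vector.sum_representation_eq[OF assms(1,3,2)] by simp
  then show ?thesis by (simp add: inner_sum_right mult.commute)
qed

lemma representation_sum_scale:
  fixes U :: "'a::real_vector set"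
  assumes "independent U" "finite U" "b \<in> U"
  shows "representation U (\<Sum>b\<in>U. c b *\<^sub>R b) b = c b"
proof -
  have "representation U (\<Sum>b\<in>U. c b *\<^sub>R b) b = (\<Sum>d\<in>U. representation U (c d *\<^sub>R d) b)"
    using assms(1) by (simp add: real_vector.representation_sum span_base span_scale)
  also have "\<dots> = (\<Sum>d\<in>U. if d = b then c d else 0)"
    using assms(1) by (intro sum.cong)
      (auto simp: real_vector.representation_scale span_base real_vector.representation_basis)
  finally show ?thesis using assms(2,3) by simp
qed

lemma representation_add_sum_scale:
  fixes U :: "'a::real_vector set"
  assumes "independent U" "finite U" "b \<in> U" "x \<in> span U"
  shows "representation U (x + (\<Sum>b\<in>U. c b *\<^sub>R b)) b = representation U x b + c b"
proof -
  have "(\<Sum>b\<in>U. c b *\<^sub>R b) \<in> span U" by (intro span_sum span_scale span_base)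
  then show ?thesis
    by (simp add: real_vector.representation_add[OF assms(1) _ assms(4)]
        representation_sum_scale[OF assms(1-3)])
qed

lemma representation_insert:
  fixes U :: "'a::real_vector set"
  assumes U: "independent U" "finite U" and u: "u \<notin> span U" and x: "x - r *\<^sub>R u \<in> span U"
  shows "representation (insert u U) x u = r"
    and "b \<in> U \<Longrightarrow> representation (insert u U) x b = representation U (x - r *\<^sub>R u) b"
proof -
  have uU: "u \<notin> U" using u span_base by blast
  define c where "c b = (if b = u then r else representation U (x - r *\<^sub>R u) b)" for b
  have "(\<Sum>b\<in>U. c b *\<^sub>R b) = (\<Sum>b\<in>U. representation U (x - r *\<^sub>R u) b *\<^sub>R b)"
    using uU by (intro sum.cong) (auto simp: c_def)
  then have "(\<Sum>b\<in>insert u U. c b *\<^sub>R b) = x"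
    using U uU real_vector.sum_representation_eq[OF U(1) x U(2)] by (simp add: c_def)
  moreover have "independent (insert u U)" using U(1) u by (simp add: independent_insert)
  ultimately have "representation (insert u U) x b = c b" if "b \<in> insert u U" for b
    using representation_sum_scale[of "insert u U" b c] U(2) that by simp
  then show "representation (insert u U) x u = r"
      "b \<in> U \<Longrightarrow> representation (insert u U) x b = representation U (x - r *\<^sub>R u) b"
    using uU by (auto simp: c_def)
qed

text \<open>The facets removed from the simplicial cone are those that \<open>w\<close> lies beyond.\<close>

definition half_open_cone :: "'a::real_vector set \<Rightarrow> 'a \<Rightarrow> 'a set" where
  "half_open_cone U w =
    {x \<in> span U. \<forall>b\<in>U. lex_nonneg (representation U x b) (representation U w b)}"

lemma half_open_cone_lex_nonneg:
  fixes U :: "'a::real_inner set"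
  assumes "independent U" "finite U" "x \<in> half_open_cone U w" "w \<in> span U"
    and "\<And>b. b \<in> U \<Longrightarrow> a \<bullet> b \<ge> 0"
  shows "lex_nonneg (a \<bullet> x) (a \<bullet> w)"
proof -
  have "x \<in> span U" using assms(3) by (simp add: half_open_cone_def)
  then show ?thesis
    unfolding inner_representation[OF assms(1,2,4)] inner_representation[OF assms(1,2) \<open>x \<in> span U\<close>]
    by (intro lex_nonneg_sum lex_nonneg_mult) (use assms in \<open>auto simp: half_open_cone_def\<close>)
qed

lemma half_open_cone_insert:
  fixes U :: "'a::real_vector set"
  assumes U: "independent U" "finite U" and u: "u \<notin> span U"
    and x: "x - r *\<^sub>R u \<in> span U" and w: "w - s *\<^sub>R u \<in> span U"
  shows "x \<in> half_open_cone (insert u U) w \<longleftrightarrow>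
    lex_nonneg r s \<and> x - r *\<^sub>R u \<in> half_open_cone U (w - s *\<^sub>R u)"
proof -
  have "x \<in> span (insert u U)" using x by (auto simp: span_insert)
  then show ?thesis
    using x representation_insert[OF U u x] representation_insert[OF U u w]
    by (auto simp: half_open_cone_def)
qed

definition rational_cone_basis ::
    "(real ^ 'n) set \<Rightarrow> real ^ 'n \<Rightarrow> (real ^ 'n) set \<Rightarrow> (real ^ 'n) set \<Rightarrow> bool" where
  "rational_cone_basis A \<eta> W U \<longleftrightarrow> independent U \<and> U \<subseteq> rational_points \<and> span U = W \<and>
    (\<forall>b\<in>U. \<eta> \<bullet> b = 1 \<and> (\<forall>a\<in>A. a \<bullet> b \<ge> 0))"

lemma rational_cone_basisD:
  assumes "rational_cone_basis A \<eta> W U"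
  shows "independent U" "finite U" "U \<subseteq> rational_points" "span U = W"
    and "\<And>b. b \<in> U \<Longrightarrow> \<eta> \<bullet> b = 1" "\<And>a b. a \<in> A \<Longrightarrow> b \<in> U \<Longrightarrow> a \<bullet> b \<ge> 0"
  using assms independent_imp_finite[of U] by (auto simp: rational_cone_basis_def)

text \<open>One triangulation serves all generic \<open>w\<close>: only the choice of the removed facets depends
  on \<open>w\<close>.\<close>

definition half_open_triangulation ::
    "(real ^ 'n) set \<Rightarrow> real ^ 'n \<Rightarrow> (real ^ 'n) set \<Rightarrow> (real ^ 'n) set set \<Rightarrow> bool" where
  "half_open_triangulation A \<eta> W \<U> \<longleftrightarrow> finite \<U> \<and> (\<forall>U\<in>\<U>. rational_cone_basis A \<eta> W U) \<and>
    (\<forall>w. generic_point W w \<longrightarrow> (\<forall>U\<in>\<U>. \<forall>b\<in>U. representation U w b \<noteq> 0) \<and>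
      (\<forall>x\<in>W. (\<forall>a\<in>A. lex_nonneg (a \<bullet> x) (a \<bullet> w)) \<longrightarrow> (\<exists>!U. U \<in> \<U> \<and> x \<in> half_open_cone U w)))"

lemma half_open_triangulationD:
  assumes "half_open_triangulation A \<eta> W \<U>"
  shows "finite \<U>" "\<And>U. U \<in> \<U> \<Longrightarrow> rational_cone_basis A \<eta> W U"
    and "\<And>w U b. generic_point W w \<Longrightarrow> U \<in> \<U> \<Longrightarrow> b \<in> U \<Longrightarrow> representation U w b \<noteq> 0"
    and "\<And>w x. generic_point W w \<Longrightarrow> x \<in> W \<Longrightarrow> (\<And>a. a \<in> A \<Longrightarrow> lex_nonneg (a \<bullet> x) (a \<bullet> w)) \<Longrightarrow>
      \<exists>!U. U \<in> \<U> \<and> x \<in> half_open_cone U w"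
  using assms unfolding half_open_triangulation_def by blast+

text \<open>A cone is triangulated by coning off, from a ray \<open>u\<close>, triangulations of the facets that do
  not contain \<open>u\<close>. The set \<open>R\<close> contains one form for each of these facets, and the first facet
  hit by the path from \<open>y\<close> in direction \<open>-u\<close> is the one with the smallest \<open>slope k y\<close>.\<close>

locale pulled_triangulation =
  fixes A R W :: "(real ^ 'n) set" and \<eta> u :: "real ^ 'n"
    and \<V> :: "real ^ 'n \<Rightarrow> (real ^ 'n) set set"
  assumes W: "subspace W" and A: "A \<subseteq> rational_points"
    and u: "u \<in> W" "u \<in> rational_points" "\<eta> \<bullet> u = 1" "\<And>a. a \<in> A \<Longrightarrow> a \<bullet> u \<ge> 0"
    and R: "finite R" "R \<noteq> {}" "R \<subseteq> A" "\<And>k. k \<in> R \<Longrightarrow> k \<bullet> u > 0"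
    and R_reps: "\<And>a. a \<in> A \<Longrightarrow> a \<bullet> u > 0 \<Longrightarrow>
      \<exists>!k. k \<in> R \<and> (\<forall>y\<in>W. (a \<bullet> y) / (a \<bullet> u) = (k \<bullet> y) / (k \<bullet> u))"
    and \<V>: "\<And>k. k \<in> R \<Longrightarrow> half_open_triangulation A \<eta> {x \<in> W. k \<bullet> x = 0} (\<V> k)"
begin

definition slope :: "real ^ 'n \<Rightarrow> real ^ 'n \<Rightarrow> real" where
  "slope a y = (a \<bullet> y) / (a \<bullet> u)"

definition project :: "real ^ 'n \<Rightarrow> real ^ 'n \<Rightarrow> real ^ 'n" where
  "project k y = y - slope k y *\<^sub>R u"

definition first_facet :: "real ^ 'n \<Rightarrow> real ^ 'n \<Rightarrow> real ^ 'n \<Rightarrow> bool" where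
  "first_facet w y k \<longleftrightarrow> k \<in> R \<and> (\<forall>a\<in>R. lex_nonneg (slope a y - slope k y) (slope a w - slope k w))"

lemma project_in_facet: "k \<in> R \<Longrightarrow> y \<in> W \<Longrightarrow> project k y \<in> {x \<in> W. k \<bullet> x = 0}"
  using R(4)[of k] W u(1)
  by (simp add: project_def slope_def subspace_diff subspace_scale inner_diff_right)

lemma generic_project:
  "k \<in> R \<Longrightarrow> generic_point W w \<Longrightarrow> generic_point {x \<in> W. k \<bullet> x = 0} (project k w)"
  unfolding project_def slope_def using W u(1,2) A R(3) R(4)[of k]
  by (intro generic_point_project) auto

lemma inner_project: "a \<bullet> project k y = (a \<bullet> u) * (slope a y - slope k y)" if "a \<bullet> u > 0"
  using that by (simp add: project_def slope_def inner_diff_right field_simps)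

lemma facet_basis:
  assumes "k \<in> R" "U \<in> \<V> k"
  shows "rational_cone_basis A \<eta> {x \<in> W. k \<bullet> x = 0} U" "u \<notin> span U"
proof -
  show U: "rational_cone_basis A \<eta> {x \<in> W. k \<bullet> x = 0} U"
    using half_open_triangulationD(2)[OF \<V>[OF assms(1)] assms(2)] .
  show "u \<notin> span U" using rational_cone_basisD(4)[OF U] R(4)[OF assms(1)] by simp
qed

lemma facet_cone_insert:
  assumes "k \<in> R" "U \<in> \<V> k" "y \<in> W" "w \<in> W"
  shows "y \<in> half_open_cone (insert u U) w \<longleftrightarrow>
    lex_nonneg (slope k y) (slope k w) \<and> project k y \<in> half_open_cone U (project k w)"
proof -
  note U = facet_basis[OF assms(1,2)]
  have "project k y \<in> span U" "project k w \<in> span U"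
    using project_in_facet assms rational_cone_basisD(4)[OF U(1)] by blast+
  then show ?thesis
    unfolding project_def
    by (rule half_open_cone_insert[OF rational_cone_basisD(1,2)[OF U(1)] U(2)])
qed

lemma first_facet_unique:
  assumes "generic_point W w" "first_facet w y k" "first_facet w y l"
  shows "k = l"
proof -
  have kl: "k \<in> R" "l \<in> R" using assms by (auto simp: first_facet_def)
  have "slope k w = slope l w"
    using assms(2,3) lex_nonneg_antisym[of "slope k y" "slope l y" "slope k w" "slope l w"]
    by (auto simp: first_facet_def)
  then have "((l \<bullet> u) *\<^sub>R k - (k \<bullet> u) *\<^sub>R l) \<bullet> w = 0"
    using R(4)[OF kl(1)] R(4)[OF kl(2)]
    by (simp add: slope_def inner_diff_left field_simps)
  moreover have "(l \<bullet> u) *\<^sub>R k - (k \<bullet> u) *\<^sub>R l \<in> rational_points"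
    using kl R(3) A u(2)
    by (intro rational_points_diff rational_points_scale rational_points_inner) auto
  ultimately have "((l \<bullet> u) *\<^sub>R k - (k \<bullet> u) *\<^sub>R l) \<bullet> y = 0" if "y \<in> W" for y
    using generic_pointD[OF assms(1)] that by blast
  then have "(k \<bullet> y) / (k \<bullet> u) = (l \<bullet> y) / (l \<bullet> u)" if "y \<in> W" for y
    using R(4)[OF kl(1)] R(4)[OF kl(2)] that by (simp add: inner_diff_left field_simps)
  then show ?thesis using R_reps[of k] kl R(3,4) by blast
qed

lemma first_facet_lex_nonneg:
  assumes "first_facet w y k" "w \<in> W" "y \<in> W" "\<And>a. a \<in> A \<Longrightarrow> lex_nonneg (a \<bullet> y) (a \<bullet> w)"
    and a: "a \<in> A"
  shows "lex_nonneg (a \<bullet> project k y) (a \<bullet> project k w)"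
proof (cases "a \<bullet> u > 0")
  case True
  obtain l where "l \<in> R" "\<forall>y\<in>W. slope a y = slope l y"
    using R_reps[OF a True] unfolding slope_def by blast
  then have "lex_nonneg (slope a y - slope k y) (slope a w - slope k w)"
    using assms(1-3) by (simp add: first_facet_def)
  then show ?thesis using True by (simp add: inner_project lex_nonneg_mult_iff)
next
  case False
  then have "a \<bullet> u = 0" using u(4)[OF a] by simp
  then show ?thesis using assms(4)[OF a] by (simp add: project_def inner_diff_right)
qed

lemma first_facet_if_in_cone:
  assumes w: "w \<in> W" and k: "k \<in> R" and U: "U \<in> \<V> k" and y: "y \<in> W"
    and cone: "y \<in> half_open_cone (insert u U) w"
  shows "first_facet w y k"
  unfolding first_facet_def
proof (intro conjI ballI)
  fix a assume a: "a \<in> R"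
  note basis = rational_cone_basisD[OF facet_basis(1)[OF k U]]
  have "project k y \<in> half_open_cone U (project k w)"
    using facet_cone_insert[OF k U y w] cone by blast
  then have "lex_nonneg (a \<bullet> project k y) (a \<bullet> project k w)"
    using project_in_facet[OF k w] basis a R(3)
    by (intro half_open_cone_lex_nonneg[of U]) auto
  then show "lex_nonneg (slope a y - slope k y) (slope a w - slope k w)"
    using R(4)[OF a] by (simp add: inner_project lex_nonneg_mult_iff)
qed (rule k)

lemma ex1_pulled_cone:
  assumes w: "generic_point W w" and y: "y \<in> W"
    and pos: "\<And>a. a \<in> A \<Longrightarrow> lex_nonneg (a \<bullet> y) (a \<bullet> w)"
  shows "\<exists>!U. U \<in> (\<Union>k\<in>R. insert u ` \<V> k) \<and> y \<in> half_open_cone U w"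
proof -
  have wW: "w \<in> W" using w by (simp add: generic_point_def)
  obtain k where k: "first_facet w y k"
    by (rule ex_lex_minimal[OF R(1,2), of "\<lambda>a. slope a y" "\<lambda>a. slope a w"])
       (blast intro: first_facet_def[THEN iffD2])
  then have kR: "k \<in> R" by (simp add: first_facet_def)
  have slope: "lex_nonneg (slope k y) (slope k w)"
    using lex_nonneg_mult[OF _ pos, of "1 / (k \<bullet> u)" k] kR R(3) R(4)[OF kR]
    by (auto simp: slope_def)
  have "\<exists>!U. U \<in> \<V> k \<and> project k y \<in> half_open_cone U (project k w)"
    using half_open_triangulationD(4)[OF \<V>[OF kR] generic_project[OF kR w]
        project_in_facet[OF kR y]] first_facet_lex_nonneg[OF k wW y pos] by blast
  then obtain U where U: "U \<in> \<V> k" "project k y \<in> half_open_cone U (project k w)"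
    and U_unique: "\<And>U'. U' \<in> \<V> k \<Longrightarrow> project k y \<in> half_open_cone U' (project k w) \<Longrightarrow> U' = U"
    by blast
  show ?thesis
  proof (rule ex1I[of _ "insert u U"])
    show "insert u U \<in> (\<Union>k\<in>R. insert u ` \<V> k) \<and> y \<in> half_open_cone (insert u U) w"
      using facet_cone_insert[OF kR U(1) y wW] slope U kR by blast
  next
    fix V assume "V \<in> (\<Union>k\<in>R. insert u ` \<V> k) \<and> y \<in> half_open_cone V w"
    then obtain l U' where V: "l \<in> R" "U' \<in> \<V> l" "V = insert u U'" "y \<in> half_open_cone V w" by blast
    then have "l = k"
      using first_facet_unique[OF w _ k] first_facet_if_in_cone[OF wW V(1,2) y] by simp
    then show "V = insert u U"
      using V U_unique facet_cone_insert[OF kR _ y wW, of U'] by blast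
  qed
qed

lemma rational_cone_basis_insert:
  assumes "k \<in> R" "U \<in> \<V> k"
  shows "rational_cone_basis A \<eta> W (insert u U)"
proof -
  note basis = rational_cone_basisD[OF facet_basis(1)[OF assms]]
  have "U \<subseteq> W" using basis(4) span_superset by blast
  then have "span (insert u U) \<subseteq> W" using u(1) W by (intro span_minimal) auto
  moreover have "W \<subseteq> span (insert u U)"
  proof
    fix y assume "y \<in> W"
    then have "project k y \<in> span U" using project_in_facet[OF assms(1)] basis(4) by blast
    then show "y \<in> span (insert u U)" unfolding span_insert project_def by blast
  qed
  ultimately show ?thesis
    using basis facet_basis(2)[OF assms] u
    by (auto simp: rational_cone_basis_def independent_insert)
qed

lemma representation_pulled_nonzero:
  assumes w: "generic_point W w" and k: "k \<in> R" and U: "U \<in> \<V> k" and b: "b \<in> insert u U"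
  shows "representation (insert u U) w b \<noteq> 0"
proof -
  note basis = rational_cone_basisD[OF facet_basis(1)[OF k U]]
  have "w \<in> W" using w by (simp add: generic_point_def)
  then have "project k w \<in> span U" using project_in_facet[OF k] basis(4) by blast
  note rep = representation_insert[OF basis(1,2) facet_basis(2)[OF k U] this[unfolded project_def]]
  have "k \<bullet> w \<noteq> 0" using generic_pointD[OF w, of k u] u(1) k R(3) A R(4)[OF k] by auto
  then have "slope k w \<noteq> 0" using R(4)[OF k] by (simp add: slope_def)
  then show ?thesis
    using rep b half_open_triangulationD(3)[OF \<V>[OF k] generic_project[OF k w] U]
    by (auto simp: project_def)
qed

lemma half_open_triangulation_pulled: "half_open_triangulation A \<eta> W (\<Union>k\<in>R. insert u ` \<V> k)"
  unfolding half_open_triangulation_def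
  using R(1) half_open_triangulationD(1)[OF \<V>] rational_cone_basis_insert
    representation_pulled_nonzero ex1_pulled_cone
  by auto

end

lemma half_open_triangulation_zero: "half_open_triangulation A \<eta> {0} {{}}"
  by (auto simp: half_open_triangulation_def rational_cone_basis_def half_open_cone_def
      independent_empty)

lemma half_open_triangulation_trivial_cone:
  assumes "subspace W" "W \<noteq> {0}" and trivial: "\<And>x. x \<in> W \<Longrightarrow> (\<And>a. a \<in> A \<Longrightarrow> a \<bullet> x \<ge> 0) \<Longrightarrow> x = 0"
  shows "half_open_triangulation A \<eta> W {}"
proof -
  have False if w: "generic_point W w" and x: "x \<in> W"
      and lex: "\<And>a. a \<in> A \<Longrightarrow> lex_nonneg (a \<bullet> x) (a \<bullet> w)" for w x
  proof -
    have "x = 0" using lex by (intro trivial[OF x]) (auto simp: lex_nonneg_def order_le_less)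
    then have "w = 0" using lex w by (intro trivial) (auto simp: lex_nonneg_def generic_point_def)
    then have "W \<subseteq> {0}" using w generic_point_zeroD by blast
    then show False using assms(1,2) subspace_0 by blast
  qed
  then show ?thesis by (auto simp: half_open_triangulation_def)
qed

lemma ex_rational_point_in_cone:
  fixes W A :: "(real ^ 'n) set"
  assumes W: "rational_subspace W" and A: "finite A" "A \<subseteq> rational_points"
    and \<eta>: "\<eta> \<in> rational_points"
    and x: "x \<in> W" "\<And>a. a \<in> A \<Longrightarrow> a \<bullet> x \<ge> 0" "\<eta> \<bullet> x > 0"
  obtains u where "u \<in> W" "u \<in> rational_points" "\<eta> \<bullet> u = 1" "\<And>a. a \<in> A \<Longrightarrow> a \<bullet> u \<ge> 0"
proof -
  obtain v where v: "v \<in> W" "v \<in> rational_points"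
    "\<And>a. a \<in> insert \<eta> A \<Longrightarrow> a \<bullet> x > 0 \<Longrightarrow> a \<bullet> v > 0"
    "\<And>a. a \<in> insert \<eta> A \<Longrightarrow> a \<bullet> x = 0 \<Longrightarrow> a \<bullet> v = 0"
    using rational_point_same_signs[OF W, of "insert \<eta> A" x] A \<eta> x(1) by auto
  have "\<eta> \<bullet> v > 0" using v(3) x(3) by blast
  define u where "u = (1 / (\<eta> \<bullet> v)) *\<^sub>R v"
  have "a \<bullet> v \<ge> 0" if "a \<in> A" for a
    using v(3,4)[of a] x(2)[OF that] that by (auto simp: order_le_less)
  then have "a \<bullet> u \<ge> 0" if "a \<in> A" for a using that \<open>\<eta> \<bullet> v > 0\<close> by (simp add: u_def)
  moreover have "u \<in> rational_points"
    unfolding u_def using v(2) \<eta>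
    by (intro rational_points_scale Rats_divide rational_points_inner) auto
  moreover have "u \<in> W" "\<eta> \<bullet> u = 1"
    using v(1) \<open>\<eta> \<bullet> v > 0\<close> subspace_rational_subspace[OF W] by (auto simp: u_def subspace_scale)
  ultimately show ?thesis using that by blast
qed

lemma ex_fibre_representatives:
  obtains R where "R \<subseteq> S" "\<And>a. a \<in> S \<Longrightarrow> \<exists>!k. k \<in> R \<and> f a = f k"
proof -
  obtain R where "R \<subseteq> S" "inj_on f R" "f ` S = f ` R"
    using subset_image_inj[of "f ` S" f S] by auto
  moreover from this have "\<exists>!k. k \<in> R \<and> f a = f k" if "a \<in> S" for a
    using that by (auto simp: inj_on_def)
  ultimately show ?thesis using that by blast
qed

lemma ex_half_open_triangulation_pulled:
  fixes W A :: "(real ^ 'n) set"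
  assumes W: "subspace W" and A: "finite A" "A \<subseteq> rational_points"
    and u: "u \<in> W" "u \<in> rational_points" "\<eta> \<bullet> u = 1" "\<And>a. a \<in> A \<Longrightarrow> a \<bullet> u \<ge> 0"
    and facet: "\<exists>a\<in>A. a \<bullet> u > 0"
    and facets: "\<And>k. k \<in> A \<Longrightarrow> k \<bullet> u > 0 \<Longrightarrow>
      \<exists>\<V>. half_open_triangulation A \<eta> {x \<in> W. k \<bullet> x = 0} \<V>"
  shows "\<exists>\<U>. half_open_triangulation A \<eta> W \<U>"
proof -
  let ?S = "{a \<in> A. a \<bullet> u > 0}"
  define slope where "slope a = restrict (\<lambda>y. (a \<bullet> y) / (a \<bullet> u)) W" for a
  obtain R where R: "R \<subseteq> ?S" "\<And>a. a \<in> ?S \<Longrightarrow> \<exists>!k. k \<in> R \<and> slope a = slope k"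
    using ex_fibre_representatives[of ?S slope] by blast
  have "slope a = slope k \<longleftrightarrow> (\<forall>y\<in>W. (a \<bullet> y) / (a \<bullet> u) = (k \<bullet> y) / (k \<bullet> u))" for a k
    by (auto simp: slope_def restrict_def fun_eq_iff)
  then have R_reps: "\<exists>!k. k \<in> R \<and> (\<forall>y\<in>W. (a \<bullet> y) / (a \<bullet> u) = (k \<bullet> y) / (k \<bullet> u))"
    if "a \<in> A" "a \<bullet> u > 0" for a using R(2) that by simp
  have "\<exists>\<V>. half_open_triangulation A \<eta> {x \<in> W. k \<bullet> x = 0} \<V>" if "k \<in> R" for k
    using that R(1) facets by auto
  then obtain \<V> where \<V>: "\<And>k. k \<in> R \<Longrightarrow> half_open_triangulation A \<eta> {x \<in> W. k \<bullet> x = 0} (\<V> k)"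
    by metis
  have "R \<noteq> {}" "finite R" using facet R_reps finite_subset[OF R(1)] A(1) by auto
  then have "pulled_triangulation A R W \<eta> u \<V>"
    by unfold_locales (use W A u R(1) R_reps \<V> in auto)
  then show ?thesis using pulled_triangulation.half_open_triangulation_pulled by blast
qed

theorem ex_half_open_triangulation:
  fixes W A :: "(real ^ 'n) set"
  assumes "rational_subspace W" and A: "finite A" "A \<subseteq> rational_points"
    and \<eta>: "\<eta> \<in> rational_points"
    and "\<And>x. x \<in> W \<Longrightarrow> x \<noteq> 0 \<Longrightarrow> (\<And>a. a \<in> A \<Longrightarrow> a \<bullet> x \<ge> 0) \<Longrightarrow> \<eta> \<bullet> x > 0"
  shows "\<exists>\<U>. half_open_triangulation A \<eta> W \<U>"
  using assms(1,5)
proof (induction "dim W" arbitrary: W rule: less_induct)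
  case less
  note W = less.prems(1) and pointed = less.prems(2)
  note sW = subspace_rational_subspace[OF W]
  consider (zero) "W = {0}"
    | (trivial_cone) "W \<noteq> {0}" "\<And>x. x \<in> W \<Longrightarrow> (\<And>a. a \<in> A \<Longrightarrow> a \<bullet> x \<ge> 0) \<Longrightarrow> x = 0"
    | (ray) x where "x \<in> W" "\<And>a. a \<in> A \<Longrightarrow> a \<bullet> x \<ge> 0" "x \<noteq> 0" by blast
  then show ?case
  proof cases
    case zero
    then show ?thesis using half_open_triangulation_zero by blast
  next
    case trivial_cone
    then show ?thesis using half_open_triangulation_trivial_cone[OF sW] by blast
  next
    case (ray x)
    obtain u where u: "u \<in> W" "u \<in> rational_points" "\<eta> \<bullet> u = 1" "\<And>a. a \<in> A \<Longrightarrow> a \<bullet> u \<ge> 0"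
      using ex_rational_point_in_cone[OF W A \<eta> ray(1,2) pointed[OF ray(1,3,2)]] by blast
    have "\<exists>a\<in>A. a \<bullet> u > 0"
    proof (rule ccontr)
      assume "\<not> (\<exists>a\<in>A. a \<bullet> u > 0)"
      then have "\<forall>a\<in>A. a \<bullet> (- u) \<ge> 0" by force
      moreover have "u \<noteq> 0" using u(3) by auto
      ultimately have "\<eta> \<bullet> (- u) > 0" using pointed[of "- u"] u(1) sW by (simp add: subspace_neg)
      then show False using u(3) by simp
    qed
    moreover have "\<exists>\<V>. half_open_triangulation A \<eta> {x \<in> W. k \<bullet> x = 0} \<V>"
      if k: "k \<in> A" "k \<bullet> u > 0" for k
    proof (rule less.hyps)
      have "{x \<in> W. k \<bullet> x = 0} \<subset> W" using u(1) k(2) by force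
      moreover have "span {x \<in> W. k \<bullet> x = 0} = {x \<in> W. k \<bullet> x = 0}" "span W = W"
        using subspace_hyperplane_Int[OF sW] sW by (simp_all only: span_eq_iff)
      ultimately show "dim {x \<in> W. k \<bullet> x = 0} < dim W" by (intro dim_psubset) (simp only:)
      show "rational_subspace {x \<in> W. k \<bullet> x = 0}"
        using W A(2) k(1) by (intro rational_subspace_hyperplane_Int) auto
    qed (use pointed in auto)
    ultimately show ?thesis using ex_half_open_triangulation_pulled[OF sW A u] by blast
  qed
qed

section \<open>Lattice points in half-open simplicial cones\<close>

lemma integer_points_zero [simp]: "0 \<in> integer_points"
  by (simp add: integer_points_def)

lemma integer_points_add: "x \<in> integer_points \<Longrightarrow> y \<in> integer_points \<Longrightarrow> x + y \<in> integer_points"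
  by (simp add: integer_points_def)

lemma integer_points_diff: "x \<in> integer_points \<Longrightarrow> y \<in> integer_points \<Longrightarrow> x - y \<in> integer_points"
  by (simp add: integer_points_def)

lemma integer_points_scale: "r \<in> \<int> \<Longrightarrow> x \<in> integer_points \<Longrightarrow> r *\<^sub>R x \<in> integer_points"
  by (simp add: integer_points_def)

lemma integer_points_sum:
  "(\<And>i. i \<in> I \<Longrightarrow> x i \<in> integer_points) \<Longrightarrow> (\<Sum>i\<in>I. x i) \<in> integer_points"
  by (induction I rule: infinite_finite_induct) (auto intro: integer_points_add)

lemma finite_integer_points:
  fixes S :: "(real ^ 'n) set"
  assumes "bounded S"
  shows "finite (integer_points \<inter> S)"
proof -
  obtain M where M: "\<And>x. x \<in> S \<Longrightarrow> norm x \<le> M" using assms bounded_iff by blast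
  have "vec_nth x \<in> UNIV \<rightarrow>\<^sub>E {k \<in> \<int>. \<bar>k\<bar> \<le> M}" if "x \<in> integer_points \<inter> S" for x
    using that order_trans[OF component_le_norm_cart M] by (auto simp: integer_points_def)
  then have "vec_nth ` (integer_points \<inter> S) \<subseteq> UNIV \<rightarrow>\<^sub>E {k \<in> \<int>. \<bar>k\<bar> \<le> M}" by blast
  moreover have "finite (UNIV \<rightarrow>\<^sub>E {k \<in> \<int>. \<bar>k\<bar> \<le> M} :: ('n \<Rightarrow> real) set)"
    by (intro finite_PiE finite_abs_int_segment) auto
  ultimately show ?thesis
    by (rule finite_imageD[OF finite_subset]) (simp add: inj_on_def vec_nth_inject)
qed

lemma ex_common_denominator_Rats:
  fixes X :: "real set"
  assumes "finite X" "X \<subseteq> \<rat>"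
  shows "\<exists>D::nat. D > 0 \<and> (\<forall>r\<in>X. real D * r \<in> \<int>)"
  using assms
proof (induction X rule: finite_induct)
  case (insert r X)
  then obtain D :: nat where D: "D > 0" "\<forall>r\<in>X. real D * r \<in> \<int>" by auto
  have "r \<in> \<rat>" using insert.prems by simp
  then obtain m n :: nat where "n \<noteq> 0" "\<bar>r\<bar> = real m / real n" by (rule Rats_abs_nat_div_natE)
  then have "real n * r = real m \<or> real n * r = - real m"
    by (auto simp: abs_if field_simps split: if_splits)
  then have "real n * r \<in> \<int>" by auto
  then have "real (D * n) * r' \<in> \<int>" if "r' \<in> insert r X" for r'
    using that D(2) Ints_mult[OF Ints_of_nat, of "real n * r" D]
      Ints_mult[OF Ints_of_nat, of "real D * r'" n]
    by (auto simp: mult_ac)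
  then show ?case using D(1) \<open>n \<noteq> 0\<close> by (intro exI[of _ "D * n"]) auto
qed (auto intro: exI[of _ 1])

lemma ex_common_denominator:
  fixes U :: "(real ^ 'n) set"
  assumes "finite U" "U \<subseteq> rational_points"
  obtains D :: nat where "D > 0" "\<And>b. b \<in> U \<Longrightarrow> real D *\<^sub>R b \<in> integer_points"
proof -
  have "(\<lambda>(b, j). b $ j) ` (U \<times> UNIV) \<subseteq> \<rat>" using assms(2) by (auto simp: rational_points_def)
  then obtain D :: nat where "D > 0" "\<forall>r\<in>(\<lambda>(b, j). b $ j) ` (U \<times> UNIV). real D * r \<in> \<int>"
    using ex_common_denominator_Rats[of "(\<lambda>(b, j). b $ j) ` (U \<times> UNIV)"] assms(1) by auto
  then show ?thesis using that by (auto simp: integer_points_def)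
qed

lemma ex_map_eq_if_distinct:
  assumes "distinct xs" "length ys = length xs"
  shows "\<exists>f. map f xs = ys"
  using assms
  by (intro exI[of _ "\<lambda>x. the (map_of (zip xs ys) x)"])
     (auto simp: map_of_zip_nth intro!: nth_equalityI)

lemma card_weak_compositions:
  assumes "finite U" "card U = Suc k"
  shows "card {q \<in> U \<rightarrow>\<^sub>E (UNIV :: nat set). sum q U = N} = (N + k) choose k"
proof -
  obtain us where us: "set us = U" "distinct us" using finite_distinct_list[OF assms(1)] by blast
  have "bij_betw (\<lambda>q. map q us) {q \<in> U \<rightarrow>\<^sub>E UNIV. sum q U = N}
      {l. length l = card U \<and> sum_list l = N}"
    unfolding bij_betw_def
  proof
    show "inj_on (\<lambda>q. map q us) {q \<in> U \<rightarrow>\<^sub>E UNIV. sum q U = N}"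
      using us(1) by (auto simp: inj_on_def intro: PiE_ext)
    show "(\<lambda>q. map q us) ` {q \<in> U \<rightarrow>\<^sub>E UNIV. sum q U = N} = {l. length l = card U \<and> sum_list l = N}"
    proof (intro equalityI subsetI)
      fix l assume l: "l \<in> {l. length l = card U \<and> sum_list l = N}"
      have "length l = length us" using l us distinct_card by fastforce
      then obtain q0 where "map q0 us = l" using ex_map_eq_if_distinct[OF us(2)] by blast
      moreover define q where "q = restrict q0 U"
      ultimately have "map q us = l" using us(1) by auto
      moreover from this have "sum q U = N"
        using l us by (auto simp: sum_list_distinct_conv_sum_set)
      ultimately show "l \<in> (\<lambda>q. map q us) ` {q \<in> U \<rightarrow>\<^sub>E UNIV. sum q U = N}"
        by (intro image_eqI[of _ _ q]) (auto simp: q_def)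
    qed (use us distinct_card in \<open>fastforce simp: sum_list_distinct_conv_sum_set\<close>)
  qed
  then have "card {q \<in> U \<rightarrow>\<^sub>E (UNIV :: nat set). sum q U = N} = (N + k) choose N"
    using bij_betw_same_card card_length_sum_list[of "card U" N] assms(2) by fastforce
  then show ?thesis using binomial_symmetric[of k "N + k"] by simp
qed

text \<open>The number of weak compositions of \<open>y\<close> into \<open>k + 1\<close> parts, continued to a polynomial on the
  integers and by \<open>0\<close> elsewhere.\<close>

definition num_weak_compositions :: "nat \<Rightarrow> real \<Rightarrow> real" where
  "num_weak_compositions k y = (if y \<in> \<int> then (y + of_nat k) gchoose k else 0)"

lemma card_weak_compositions_eq:
  assumes "finite U" "card U = Suc k" "y > - real (Suc k)"
  shows "real (card {q \<in> U \<rightarrow>\<^sub>E (UNIV :: nat set). real (sum q U) = y}) = num_weak_compositions k y"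
proof (cases "y \<in> \<nat>")
  case True
  then obtain N where N: "y = real N" by (auto elim: Nats_cases)
  then have "{q \<in> U \<rightarrow>\<^sub>E (UNIV :: nat set). real (sum q U) = y} = {q \<in> U \<rightarrow>\<^sub>E UNIV. sum q U = N}"
    by (auto simp del: of_nat_sum)
  then show ?thesis
    using card_weak_compositions[OF assms(1,2)] N
    by (simp add: num_weak_compositions_def binomial_gbinomial)
next
  case False
  have "num_weak_compositions k y = 0"
  proof (cases "y \<in> \<int>")
    case True
    then obtain i where i: "y = of_int i" by (auto elim: Ints_cases)
    have "i < 0"
      using False of_nat_in_Nats[of "nat i", where 'a = real] by (cases "i \<ge> 0") (auto simp: i)
    moreover have "i > - int (Suc k)" using assms(3) unfolding i by linarith
    ultimately have "y + of_nat k = real (nat (i + int k))" "nat (i + int k) < k"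
      unfolding i by simp_all
    then have "(y + of_nat k) gchoose k = 0" by (metis binomial_gbinomial binomial_eq_0 of_nat_0)
    then show ?thesis by (simp add: num_weak_compositions_def)
  qed (simp add: num_weak_compositions_def)
  moreover have "{q \<in> U \<rightarrow>\<^sub>E (UNIV :: nat set). real (sum q U) = y} = {}"
    using False by (auto simp del: of_nat_sum)
  ultimately show ?thesis by (simp only: card.empty of_nat_0)
qed

lemma finite_weak_compositions:
  assumes "finite U" "card U = Suc k"
  shows "finite {q \<in> U \<rightarrow>\<^sub>E (UNIV :: nat set). real (sum q U) = y}"
proof (rule finite_subset)
  show "{q \<in> U \<rightarrow>\<^sub>E (UNIV :: nat set). real (sum q U) = y} \<subseteq> {q \<in> U \<rightarrow>\<^sub>E UNIV. sum q U = nat \<lfloor>y\<rfloor>}"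
    by (auto simp del: of_nat_sum)
  show "finite {q \<in> U \<rightarrow>\<^sub>E (UNIV :: nat set). sum q U = nat \<lfloor>y\<rfloor>}"
    using card_weak_compositions[OF assms, of "nat \<lfloor>y\<rfloor>"] by (intro card_ge_0_finite) simp
qed

lemma num_weak_compositions_reciprocity:
  "num_weak_compositions k (- y - real (Suc k)) = (-1) ^ k * num_weak_compositions k y"
proof -
  have "- y - real (Suc k) \<in> \<int> \<longleftrightarrow> y \<in> \<int>"
    by (metis Ints_diff Ints_minus Ints_of_nat add_diff_cancel diff_minus_eq_add minus_diff_eq)
  moreover have "- y - real (Suc k) + of_nat k = - y - 1" by simp
  moreover have "(- y - 1) gchoose k = (-1) ^ k * ((y + of_nat k) gchoose k)"
    using gbinomial_negated_upper[of "- y - 1" k] by (simp add: add.commute)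
  ultimately show ?thesis unfolding num_weak_compositions_def by (cases "y \<in> \<int>") simp_all
qed

lemma quasipolynomial_le_num_weak_compositions:
  assumes "D > (0::nat)"
  shows "quasipolynomial_le k (\<lambda>t. num_weak_compositions k ((of_int t - a) / real D))"
proof -
  define c where "c t = (if (of_int t - a) / real D \<in> \<int> then 1 / fact k else 0 :: real)"
    for t :: int
  have "c (t + int D) = c t" for t
  proof -
    have "(of_int (t + int D) - a) / real D = (of_int t - a) / real D + 1"
      using assms by (simp add: field_simps)
    moreover have "x + 1 \<in> \<int> \<longleftrightarrow> x \<in> \<int>" for x :: real
      by (metis Ints_1 Ints_add Ints_diff add_diff_cancel_right')
    ultimately show ?thesis by (simp add: c_def)
  qed
  then have "periodic c" unfolding periodic_def using assms by (intro exI[of _ "int D"]) auto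
  then have "quasipolynomial_le k
      (\<lambda>t. c t * (\<Prod>i<k. (1 / real D) * of_int t + (real k - real i - a / real D)))"
    by (rule quasipolynomial_le_mult_prod_linear)
  moreover have "num_weak_compositions k ((of_int t - a) / real D) =
      c t * (\<Prod>i<k. (1 / real D) * of_int t + (real k - real i - a / real D))" for t
    unfolding num_weak_compositions_def c_def gbinomial_prod_rev
    by (auto simp: atLeast0LessThan diff_divide_distrib algebra_simps intro!: prod.cong)
  ultimately show ?thesis by simp
qed

definition half_open_unit :: "real \<Rightarrow> real set" where
  "half_open_unit s = (if s > 0 then {0..<1} else {0<..1})"

lemma half_open_unit_uminus: "s \<noteq> 0 \<Longrightarrow> 1 - r \<in> half_open_unit (- s) \<longleftrightarrow> r \<in> half_open_unit s"
  by (auto simp: half_open_unit_def)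

lemma half_open_unit_translate_lex_nonneg:
  "r \<in> half_open_unit s \<Longrightarrow> q \<ge> 0 \<Longrightarrow> lex_nonneg (r + q) s"
  by (auto simp: half_open_unit_def lex_nonneg_def split: if_splits)

lemma half_open_unit_translate_unique:
  fixes p q :: nat
  assumes "l - real p \<in> half_open_unit s" "l - real q \<in> half_open_unit s"
  shows "p = q"
proof -
  have "\<bar>real p - real q\<bar> < 1" using assms by (auto simp: half_open_unit_def split: if_splits)
  then show ?thesis by linarith
qed

lemma ex_half_open_unit_translate:
  assumes "lex_nonneg l s" "s \<noteq> 0"
  obtains q :: nat where "l - real q \<in> half_open_unit s"
proof (cases "s > 0")
  case True
  then have "l \<ge> 0" using assms(1) by (auto simp: lex_nonneg_def)
  then have "l - real (nat \<lfloor>l\<rfloor>) \<in> half_open_unit s"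
    using True by (simp add: half_open_unit_def) linarith
  then show ?thesis by (rule that)
next
  case False
  then have "l > 0" using assms by (auto simp: lex_nonneg_def)
  then have "real (nat (\<lceil>l\<rceil> - 1)) = of_int \<lceil>l\<rceil> - 1" by (simp add: of_nat_nat)
  then have "l - real (nat (\<lceil>l\<rceil> - 1)) \<in> half_open_unit s"
    using False by (simp add: half_open_unit_def) linarith
  then show ?thesis by (rule that)
qed

text \<open>The translates of these points by nonnegative integer combinations of the generators
  \<open>D *\<^sub>R b\<close> tile the integer points of \<open>half_open_cone U w\<close>.\<close>

definition fundamental_points :: "(real ^ 'n) set \<Rightarrow> nat \<Rightarrow> real ^ 'n \<Rightarrow> (real ^ 'n) set" where
  "fundamental_points U D w = {x \<in> integer_points \<inter> span U.
    \<forall>b\<in>U. representation U x b / real D \<in> half_open_unit (representation U w b)}"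

definition half_open_cone_count ::
    "nat \<Rightarrow> (real ^ 'n) set \<Rightarrow> real ^ 'n \<Rightarrow> nat \<Rightarrow> real ^ 'n \<Rightarrow> real \<Rightarrow> real" where
  "half_open_cone_count k U \<eta> D w t =
    (\<Sum>x\<in>fundamental_points U D w. num_weak_compositions k ((t - \<eta> \<bullet> x) / real D))"

lemma quasipolynomial_le_half_open_cone_count:
  "D > 0 \<Longrightarrow> quasipolynomial_le k (\<lambda>t. half_open_cone_count k U \<eta> D w (of_int t))"
  unfolding half_open_cone_count_def
  by (intro quasipolynomial_le_sum quasipolynomial_le_num_weak_compositions)

locale lattice_cone =
  fixes U :: "(real ^ 'n) set" and \<eta> w :: "real ^ 'n" and D k :: nat
  assumes U: "independent U" "finite U" "card U = Suc k" and D: "D > 0"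
    and integer_generators: "\<And>b. b \<in> U \<Longrightarrow> real D *\<^sub>R b \<in> integer_points"
    and \<eta>: "\<And>b. b \<in> U \<Longrightarrow> \<eta> \<bullet> b = 1"
    and w: "w \<in> span U" "\<And>b. b \<in> U \<Longrightarrow> representation U w b \<noteq> 0"
begin

definition lattice_translation :: "(real ^ 'n \<Rightarrow> real) \<Rightarrow> real ^ 'n" where
  "lattice_translation q = (\<Sum>b\<in>U. (real D * q b) *\<^sub>R b)"

lemma lattice_translation_in_span: "lattice_translation q \<in> span U"
  unfolding lattice_translation_def by (intro span_sum span_scale span_base)

lemma lattice_translation_integer:
  assumes "\<And>b. b \<in> U \<Longrightarrow> q b \<in> \<int>"
  shows "lattice_translation q \<in> integer_points"
  unfolding lattice_translation_def
proof (rule integer_points_sum)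
  fix b assume "b \<in> U"
  then show "(real D * q b) *\<^sub>R b \<in> integer_points"
    using integer_points_scale[OF assms integer_generators] by (simp add: mult.commute)
qed

lemma inner_lattice_translation: "\<eta> \<bullet> lattice_translation q = real D * sum q U"
  using \<eta> by (simp add: lattice_translation_def inner_sum_right sum_distrib_left)

lemma representation_lattice_translation:
  "x \<in> span U \<Longrightarrow> b \<in> U \<Longrightarrow>
    representation U (x + lattice_translation q) b / real D = representation U x b / real D + q b"
  unfolding lattice_translation_def using D U
  by (simp add: representation_add_sum_scale add_divide_distrib)

lemma inner_eq_sum_representation: "x \<in> span U \<Longrightarrow> \<eta> \<bullet> x = (\<Sum>b\<in>U. representation U x b)"
  using inner_representation[OF U(1,2)] \<eta> by simp

lemma representation_fundamental_points_le:
  assumes "x \<in> fundamental_points U D w" "b \<in> U"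
  shows "\<bar>representation U x b\<bar> \<le> real D"
    and "representation U w b > 0 \<Longrightarrow> representation U x b < real D"
  using assms D
  by (force simp: fundamental_points_def half_open_unit_def field_simps split: if_splits)+

lemma height_fundamental_points_le:
  assumes "x \<in> fundamental_points U D w"
  shows "\<eta> \<bullet> x \<le> real D * real (Suc k)"
proof -
  have "(\<Sum>b\<in>U. representation U x b) \<le> (\<Sum>b\<in>U. real D)"
    using representation_fundamental_points_le(1)[OF assms] by (intro sum_mono) fastforce
  then show ?thesis
    using inner_eq_sum_representation assms U(3) by (simp add: fundamental_points_def mult.commute)
qed

lemma height_fundamental_points_less:
  assumes "x \<in> fundamental_points U D w" "\<eta> \<bullet> w > 0"
  shows "\<eta> \<bullet> x < real D * real (Suc k)"
proof -
  obtain b where "b \<in> U" "representation U w b > 0"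
    using assms(2) sum_nonpos[of U "representation U w"] inner_eq_sum_representation[OF w(1)]
    by fastforce
  then have "(\<Sum>b\<in>U. representation U x b) < (\<Sum>b\<in>U. real D)"
    using representation_fundamental_points_le[OF assms(1)] U(2)
    by (intro sum_strict_mono_ex1) fastforce+
  then show ?thesis
    using inner_eq_sum_representation assms(1) U(3)
    by (simp add: fundamental_points_def mult.commute)
qed

lemma finite_fundamental_points: "finite (fundamental_points U D w)"
proof -
  have "norm x \<le> (\<Sum>b\<in>U. real D * norm b)" if x: "x \<in> fundamental_points U D w" for x
  proof -
    have "x = (\<Sum>b\<in>U. representation U x b *\<^sub>R b)"
      using x real_vector.sum_representation_eq[OF U(1) _ U(2)]
      by (simp add: fundamental_points_def)
    then have "norm x \<le> (\<Sum>b\<in>U. norm (representation U x b *\<^sub>R b))" by (metis norm_sum)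
    also have "\<dots> \<le> (\<Sum>b\<in>U. real D * norm b)"
      using representation_fundamental_points_le(1)[OF x]
      by (intro sum_mono) (simp add: mult_right_mono)
    finally show ?thesis .
  qed
  then have "bounded (fundamental_points U D w)" unfolding bounded_iff by blast
  from finite_integer_points[OF this] show ?thesis
    by (rule finite_subset[rotated]) (auto simp: fundamental_points_def)
qed

lemma fundamental_translate_unique:
  fixes q q' :: "real ^ 'n \<Rightarrow> nat"
  assumes x: "x \<in> fundamental_points U D w" "x' \<in> fundamental_points U D w"
    and eq: "x + lattice_translation (\<lambda>b. real (q b)) = x' + lattice_translation (\<lambda>b. real (q' b))"
    and b: "b \<in> U"
  shows "q b = q' b"
proof (rule half_open_unit_translate_unique)
  define l where "l = representation U (x + lattice_translation (\<lambda>b. real (q b))) b / real D"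
  have remainders: "l - real (q b) = representation U x b / real D"
      "l - real (q' b) = representation U x' b / real D"
    using representation_lattice_translation[OF _ b] x
    by (simp add: l_def fundamental_points_def, simp add: l_def eq fundamental_points_def)
  show "l - real (q b) \<in> half_open_unit (representation U w b)"
      "l - real (q' b) \<in> half_open_unit (representation U w b)"
    unfolding remainders using x b by (simp_all add: fundamental_points_def)
qed

lemma fundamental_translate_in_half_open_cone:
  fixes q :: "real ^ 'n \<Rightarrow> nat"
  assumes x: "x \<in> fundamental_points U D w"
  shows "x + lattice_translation (\<lambda>b. real (q b)) \<in> integer_points \<inter> half_open_cone U w"
proof -
  have xs: "x \<in> span U" using x by (simp add: fundamental_points_def)
  define z where "z = x + lattice_translation (\<lambda>b. real (q b))"
  have "lex_nonneg (representation U z b) (representation U w b)" if b: "b \<in> U" for b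
  proof -
    have "lex_nonneg (representation U z b / real D) (representation U w b)"
      using half_open_unit_translate_lex_nonneg x b
      by (simp add: z_def representation_lattice_translation[OF xs b] fundamental_points_def)
    then show ?thesis using D by (auto simp: lex_nonneg_def zero_less_divide_iff)
  qed
  then show ?thesis
    using x xs lattice_translation_in_span lattice_translation_integer
    by (simp add: z_def half_open_cone_def fundamental_points_def span_add integer_points_add)
qed

lemma ex_fundamental_translate:
  assumes z: "z \<in> integer_points \<inter> half_open_cone U w"
  obtains x and q :: "real ^ 'n \<Rightarrow> nat" where "x \<in> fundamental_points U D w" "q \<in> U \<rightarrow>\<^sub>E UNIV"
    "z = x + lattice_translation (\<lambda>b. real (q b))"
proof -
  have zs: "z \<in> span U" using z by (simp add: half_open_cone_def)
  have "\<exists>q::nat. representation U z b / real D - real q \<in> half_open_unit (representation U w b)"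
    if b: "b \<in> U" for b
  proof -
    have "lex_nonneg (representation U z b / real D) (representation U w b)"
      using z b D by (auto simp: half_open_cone_def lex_nonneg_def zero_less_divide_iff)
    then show ?thesis using ex_half_open_unit_translate w(2)[OF b] by metis
  qed
  then obtain q0 :: "real ^ 'n \<Rightarrow> nat" where q0: "\<And>b. b \<in> U \<Longrightarrow>
      representation U z b / real D - real (q0 b) \<in> half_open_unit (representation U w b)"
    by metis
  define q where "q = restrict q0 U"
  define x where "x = z + lattice_translation (\<lambda>b. - real (q b))"
  have "x \<in> fundamental_points U D w"
    using q0 z zs representation_lattice_translation[OF zs] lattice_translation_in_span
      lattice_translation_integer
    by (simp add: x_def q_def fundamental_points_def span_add integer_points_add)
  moreover have "z = x + lattice_translation (\<lambda>b. real (q b))"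
    by (simp add: x_def lattice_translation_def sum_negf)
  moreover have "q \<in> U \<rightarrow>\<^sub>E UNIV" by (simp add: q_def)
  ultimately show ?thesis using that by blast
qed

lemma bij_betw_half_open_cone:
  "bij_betw (\<lambda>(x, q). x + lattice_translation (\<lambda>b. real (q b)))
    (fundamental_points U D w \<times> (U \<rightarrow>\<^sub>E (UNIV :: nat set)))
    (integer_points \<inter> half_open_cone U w)"
  (is "bij_betw ?F (?\<Pi> \<times> ?Q) ?C")
  unfolding bij_betw_def
proof
  show "inj_on ?F (?\<Pi> \<times> ?Q)"
  proof (rule inj_onI, clarify)
    fix x q x' q' assume x: "x \<in> ?\<Pi>" "x' \<in> ?\<Pi>" and q: "q \<in> ?Q" "q' \<in> ?Q"
      and eq: "x + lattice_translation (\<lambda>b. real (q b)) =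
        x' + lattice_translation (\<lambda>b. real (q' b))"
    have "q = q'" using q fundamental_translate_unique[OF x eq] by (intro PiE_ext)
    then show "x = x' \<and> q = q'" using eq by simp
  qed
  show "?F ` (?\<Pi> \<times> ?Q) = ?C"
  proof (intro equalityI subsetI)
    fix z assume "z \<in> ?C"
    then show "z \<in> ?F ` (?\<Pi> \<times> ?Q)" by (rule ex_fundamental_translate) auto
  qed (use fundamental_translate_in_half_open_cone in auto)
qed

lemma bij_betw_half_open_cone_slice:
  "bij_betw (\<lambda>(x, q). x + lattice_translation (\<lambda>b. real (q b)))
    (SIGMA x:fundamental_points U D w.
      {q \<in> U \<rightarrow>\<^sub>E (UNIV :: nat set). real (sum q U) = (t - \<eta> \<bullet> x) / real D})
    {x \<in> integer_points \<inter> half_open_cone U w. \<eta> \<bullet> x = t}"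
proof -
  have "(case p of (x, q) \<Rightarrow> \<eta> \<bullet> (x + lattice_translation (\<lambda>b. real (q b)))) = t \<longleftrightarrow>
      real (sum (snd p) U) = (t - \<eta> \<bullet> fst p) / real D" for p :: "_ \<times> (_ \<Rightarrow> nat)"
    using D by (auto simp: inner_add_right inner_lattice_translation field_simps split: prod.splits)
  from bij_betw_Collect[OF bij_betw_half_open_cone, of "\<lambda>z. \<eta> \<bullet> z = t"
      "\<lambda>p. real (sum (snd p) U) = (t - \<eta> \<bullet> fst p) / real D"] this
  show ?thesis
    by (auto simp: case_prod_unfold elim!: back_subst[of "\<lambda>S. bij_betw _ S _"])
qed

lemma finite_half_open_cone_slice:
  "finite {x \<in> integer_points \<inter> half_open_cone U w. \<eta> \<bullet> x = t}"
  using bij_betw_finite[OF bij_betw_half_open_cone_slice, of t] finite_fundamental_points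
    finite_weak_compositions[OF U(2,3)] by auto

lemma card_half_open_cone_slice:
  assumes "\<And>x. x \<in> fundamental_points U D w \<Longrightarrow> \<eta> \<bullet> x < t + real D * real (Suc k)"
  shows "real (card {x \<in> integer_points \<inter> half_open_cone U w. \<eta> \<bullet> x = t}) =
    half_open_cone_count k U \<eta> D w t"
proof -
  have "card {x \<in> integer_points \<inter> half_open_cone U w. \<eta> \<bullet> x = t} =
      (\<Sum>x\<in>fundamental_points U D w.
        card {q \<in> U \<rightarrow>\<^sub>E (UNIV :: nat set). real (sum q U) = (t - \<eta> \<bullet> x) / real D})"
    using bij_betw_same_card[OF bij_betw_half_open_cone_slice, of t] finite_fundamental_points
      finite_weak_compositions[OF U(2,3)] by (simp add: card_SigmaI)
  moreover have "(t - \<eta> \<bullet> x) / real D > - real (Suc k)" if "x \<in> fundamental_points U D w" for x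
    using assms[OF that] D by (simp add: field_simps)
  ultimately show ?thesis
    using card_weak_compositions_eq[OF U(2,3)]
    by (simp add: half_open_cone_count_def del: of_nat_Suc)
qed

lemma lattice_cone_uminus: "lattice_cone U \<eta> (- w) D k"
  using U D integer_generators \<eta> w
  by unfold_locales (auto simp: span_neg real_vector.representation_neg)

lemma fundamental_points_reflect:
  assumes x: "x \<in> fundamental_points U D w"
  shows "lattice_translation (\<lambda>_. 1) - x \<in> fundamental_points U D (- w)"
proof -
  have xs: "x \<in> span U" "- x \<in> span U"
    using x by (auto simp: fundamental_points_def span_neg)
  have "representation U (lattice_translation (\<lambda>_. 1) - x) b / real D =
      1 - representation U x b / real D"
    if "b \<in> U" for b
    using representation_lattice_translation[OF xs(2) that, of "\<lambda>_. 1"] xs(1) U(1)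
    by (simp add: real_vector.representation_neg)
  then show ?thesis
    using x xs(1) w U(1) lattice_translation_in_span lattice_translation_integer
    by (auto simp: fundamental_points_def real_vector.representation_neg half_open_unit_uminus
        intro: span_diff integer_points_diff)
qed

lemma half_open_cone_count_reciprocity:
  "half_open_cone_count k U \<eta> D (- w) t = (-1) ^ k * half_open_cone_count k U \<eta> D w (- t)"
proof -
  interpret neg: lattice_cone U \<eta> "- w" D k by (rule lattice_cone_uminus)
  let ?c = "lattice_translation (\<lambda>_. 1)"
  have "half_open_cone_count k U \<eta> D (- w) t =
      (\<Sum>x\<in>fundamental_points U D w. num_weak_compositions k ((t - \<eta> \<bullet> (?c - x)) / real D))"
    unfolding half_open_cone_count_def
    by (rule sum.reindex_bij_witness[of _ "\<lambda>x. ?c - x" "\<lambda>x. ?c - x"])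
       (use fundamental_points_reflect neg.fundamental_points_reflect in auto)
  also have "\<dots> = (\<Sum>x\<in>fundamental_points U D w.
      (-1) ^ k * num_weak_compositions k ((- t - \<eta> \<bullet> x) / real D))"
  proof (rule sum.cong)
    fix x
    have "(t - \<eta> \<bullet> (?c - x)) / real D = - ((- t - \<eta> \<bullet> x) / real D) - real (Suc k)"
      using D U(3) by (simp add: inner_diff_right inner_lattice_translation field_simps)
    then show "num_weak_compositions k ((t - \<eta> \<bullet> (?c - x)) / real D) =
        (-1) ^ k * num_weak_compositions k ((- t - \<eta> \<bullet> x) / real D)"
      using num_weak_compositions_reciprocity by simp
  qed simp
  finally show ?thesis by (simp add: half_open_cone_count_def sum_distrib_left)
qed

end

section \<open>Reciprocity for rational cones\<close>

lemma card_ex1_cover: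
  assumes "finite \<U>" "\<And>U. U \<in> \<U> \<Longrightarrow> finite (X U)" "\<And>U. U \<in> \<U> \<Longrightarrow> X U \<subseteq> S"
    and "\<And>x. x \<in> S \<Longrightarrow> \<exists>!U. U \<in> \<U> \<and> x \<in> X U"
  shows "card S = (\<Sum>U\<in>\<U>. card (X U))"
proof -
  have "S = (\<Union>U\<in>\<U>. X U)" using assms(3,4) by blast
  moreover have "card (\<Union>U\<in>\<U>. X U) = (\<Sum>U\<in>\<U>. card (X U))"
    using assms by (intro card_UN_disjoint) blast+
  ultimately show ?thesis by simp
qed

lemma card_lex_cone_slice:
  assumes tri: "half_open_triangulation A \<eta> W \<U>" and w: "generic_point W w"
    and cone: "\<And>U. U \<in> \<U> \<Longrightarrow> lattice_cone U \<eta> w D k"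
    and t: "\<And>U x. U \<in> \<U> \<Longrightarrow> x \<in> fundamental_points U D w \<Longrightarrow> \<eta> \<bullet> x < t + real D * real (Suc k)"
  shows "real (card {x \<in> integer_points \<inter> W. (\<forall>a\<in>A. lex_nonneg (a \<bullet> x) (a \<bullet> w)) \<and> \<eta> \<bullet> x = t}) =
    (\<Sum>U\<in>\<U>. half_open_cone_count k U \<eta> D w t)"
proof -
  let ?S = "{x \<in> integer_points \<inter> W. (\<forall>a\<in>A. lex_nonneg (a \<bullet> x) (a \<bullet> w)) \<and> \<eta> \<bullet> x = t}"
  let ?X = "\<lambda>U. {x \<in> integer_points \<inter> half_open_cone U w. \<eta> \<bullet> x = t}"
  have "card ?S = (\<Sum>U\<in>\<U>. card (?X U))"
  proof (rule card_ex1_cover[OF half_open_triangulationD(1)[OF tri]])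
    fix U assume U: "U \<in> \<U>"
    note basis = rational_cone_basisD[OF half_open_triangulationD(2)[OF tri U]]
    have "w \<in> span U" using w basis(4) by (simp add: generic_point_def)
    then have "lex_nonneg (a \<bullet> x) (a \<bullet> w)" if "a \<in> A" "x \<in> half_open_cone U w" for a x
      using half_open_cone_lex_nonneg[OF basis(1,2) that(2)] basis(6)[OF that(1)] by blast
    moreover have "half_open_cone U w \<subseteq> W" using basis(4) by (auto simp: half_open_cone_def)
    ultimately show "?X U \<subseteq> ?S" by blast
  next
    fix x assume "x \<in> ?S"
    then show "\<exists>!U. U \<in> \<U> \<and> x \<in> ?X U"
      using half_open_triangulationD(4)[OF tri w, of x] by simp
  qed (rule lattice_cone.finite_half_open_cone_slice[OF cone])
  also have "real \<dots> = (\<Sum>U\<in>\<U>. half_open_cone_count k U \<eta> D w t)"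
    using lattice_cone.card_half_open_cone_slice[OF cone t] by simp
  finally show ?thesis .
qed

lemma ex_lattice_triangulation:
  fixes W A :: "(real ^ 'n) set"
  assumes W: "rational_subspace W" and A: "finite A" "A \<subseteq> rational_points"
    and \<eta>: "\<eta> \<in> rational_points"
    and pointed: "\<And>x. x \<in> W \<Longrightarrow> x \<noteq> 0 \<Longrightarrow> (\<And>a. a \<in> A \<Longrightarrow> a \<bullet> x \<ge> 0) \<Longrightarrow> \<eta> \<bullet> x > 0"
    and dim: "dim W = Suc k"
  obtains \<U> D where "half_open_triangulation A \<eta> W \<U>" "D > 0"
    "\<And>w U. generic_point W w \<Longrightarrow> U \<in> \<U> \<Longrightarrow> lattice_cone U \<eta> w D k"
proof -
  obtain \<U> where tri: "half_open_triangulation A \<eta> W \<U>"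
    using ex_half_open_triangulation[OF W A \<eta> pointed] by blast
  note basis = rational_cone_basisD[OF half_open_triangulationD(2)[OF tri]]
  have "finite (\<Union>\<U>)" "\<Union>\<U> \<subseteq> rational_points"
    using half_open_triangulationD(1)[OF tri] basis(2,3) by auto
  then obtain D where D: "D > 0" "\<And>b. b \<in> \<Union>\<U> \<Longrightarrow> real D *\<^sub>R b \<in> integer_points"
    using ex_common_denominator by blast
  have "lattice_cone U \<eta> w D k" if w: "generic_point W w" and U: "U \<in> \<U>" for w U
  proof
    show "card U = Suc k"
      using dim_span_eq_card_independent[OF basis(1)[OF U]] basis(4)[OF U] dim by simp
    show "w \<in> span U" using w basis(4)[OF U] by (simp add: generic_point_def)
    show "real D *\<^sub>R b \<in> integer_points" if "b \<in> U" for b using D(2) U that by blast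
  qed (use basis[OF U] D(1) half_open_triangulationD(3)[OF tri w U] in auto)
  then show ?thesis using that tri D(1) by blast
qed

lemma card_closed_cone_slice:
  assumes tri: "half_open_triangulation A \<eta> W \<U>"
    and w: "generic_point W w" "\<And>a. a \<in> A \<Longrightarrow> a \<bullet> w > 0" "\<eta> \<bullet> w > 0"
    and cone: "\<And>U. U \<in> \<U> \<Longrightarrow> lattice_cone U \<eta> w D k" and t: "t \<ge> 0"
  shows "real (card {x \<in> integer_points \<inter> W. (\<forall>a\<in>A. a \<bullet> x \<ge> 0) \<and> \<eta> \<bullet> x = t}) =
    (\<Sum>U\<in>\<U>. half_open_cone_count k U \<eta> D w t)"
proof -
  have "\<eta> \<bullet> x < t + real D * real (Suc k)" if "U \<in> \<U>" "x \<in> fundamental_points U D w" for U x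
    using lattice_cone.height_fundamental_points_less[OF cone[OF that(1)] that(2) w(3)] t
    by linarith
  note count = card_lex_cone_slice[OF tri w(1) cone this]
  have "(\<forall>a\<in>A. lex_nonneg (a \<bullet> x) (a \<bullet> w)) \<longleftrightarrow> (\<forall>a\<in>A. a \<bullet> x \<ge> 0)" for x
    using w(2) by (force simp: lex_nonneg_def)
  then show ?thesis using count by simp
qed

lemma card_open_cone_slice:
  assumes tri: "half_open_triangulation A \<eta> W \<U>"
    and w: "generic_point W (- w)" "\<And>a. a \<in> A \<Longrightarrow> a \<bullet> w > 0"
    and cone: "\<And>U. U \<in> \<U> \<Longrightarrow> lattice_cone U \<eta> (- w) D k" and t: "t > 0"
  shows "real (card {x \<in> integer_points \<inter> W. (\<forall>a\<in>A. a \<bullet> x > 0) \<and> \<eta> \<bullet> x = t}) =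
    (\<Sum>U\<in>\<U>. half_open_cone_count k U \<eta> D (- w) t)"
proof -
  have "\<eta> \<bullet> x < t + real D * real (Suc k)" if "U \<in> \<U>" "x \<in> fundamental_points U D (- w)" for U x
    using lattice_cone.height_fundamental_points_le[OF cone[OF that(1)] that(2)] t by linarith
  note count = card_lex_cone_slice[OF tri w(1) cone this]
  have "(\<forall>a\<in>A. lex_nonneg (a \<bullet> x) (a \<bullet> (- w))) \<longleftrightarrow> (\<forall>a\<in>A. a \<bullet> x > 0)" for x
    using w(2) by (force simp: lex_nonneg_def)
  then show ?thesis using count by simp
qed

theorem rational_cone_reciprocity:
  fixes W A :: "(real ^ 'n) set"
  assumes W: "rational_subspace W" and A: "finite A" "A \<subseteq> rational_points"
    and \<eta>: "\<eta> \<in> rational_points"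
    and p: "p \<in> W" "\<And>a. a \<in> A \<Longrightarrow> a \<bullet> p > 0"
    and pointed: "\<And>x. x \<in> W \<Longrightarrow> x \<noteq> 0 \<Longrightarrow> (\<And>a. a \<in> A \<Longrightarrow> a \<bullet> x \<ge> 0) \<Longrightarrow> \<eta> \<bullet> x > 0"
    and dim: "dim W = Suc k"
  obtains Q where "quasipolynomial_le k Q"
    "\<And>t. t \<ge> 0 \<Longrightarrow>
      Q t = real (card {x \<in> integer_points \<inter> W. (\<forall>a\<in>A. a \<bullet> x \<ge> 0) \<and> \<eta> \<bullet> x = of_int t})"
    "\<And>t. t \<ge> 1 \<Longrightarrow> (-1) ^ k * Q (- t) =
      real (card {x \<in> integer_points \<inter> W. (\<forall>a\<in>A. a \<bullet> x > 0) \<and> \<eta> \<bullet> x = of_int t})"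
proof -
  note sW = subspace_rational_subspace[OF W]
  obtain w where w: "generic_point W w" "\<And>a. a \<in> A \<Longrightarrow> a \<bullet> w > 0"
    using ex_generic_point[OF sW p(1) A(1) p(2)] by blast
  have "w \<noteq> 0" using w(1) generic_point_zeroD[of W] dim dim_eq_0[of W] by auto
  then have \<eta>w: "\<eta> \<bullet> w > 0" using pointed w by (simp add: generic_point_def less_imp_le)
  obtain \<U> D where tri: "half_open_triangulation A \<eta> W \<U>" and D: "D > 0"
    and cone: "\<And>w U. generic_point W w \<Longrightarrow> U \<in> \<U> \<Longrightarrow> lattice_cone U \<eta> w D k"
    using ex_lattice_triangulation[OF W A \<eta> pointed dim] by blast
  note neg_w = generic_point_uminus[OF sW w(1)]
  define Q where "Q t = (\<Sum>U\<in>\<U>. half_open_cone_count k U \<eta> D w (of_int t))" for t :: int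
  have "quasipolynomial_le k Q"
    unfolding Q_def using D
    by (intro quasipolynomial_le_sum quasipolynomial_le_half_open_cone_count)
  moreover have "Q t = real (card {x \<in> integer_points \<inter> W. (\<forall>a\<in>A. a \<bullet> x \<ge> 0) \<and> \<eta> \<bullet> x = of_int t})"
    if "t \<ge> 0" for t
    using card_closed_cone_slice[OF tri w \<eta>w cone[OF w(1)], of "of_int t"] that by (simp add: Q_def)
  moreover have "(-1) ^ k * Q (- t) =
      real (card {x \<in> integer_points \<inter> W. (\<forall>a\<in>A. a \<bullet> x > 0) \<and> \<eta> \<bullet> x = of_int t})"
    if "t \<ge> 1" for t
    using card_open_cone_slice[OF tri neg_w w(2) cone[OF neg_w], of "of_int t"] that
      lattice_cone.half_open_cone_count_reciprocity[OF cone[OF w(1)]]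
    by (simp add: Q_def sum_distrib_left)
  ultimately show ?thesis using that by blast
qed

section \<open>Lattice bases\<close>

definition additive_subgroup :: "'a::ab_group_add set \<Rightarrow> bool" where
  "additive_subgroup \<Lambda> \<longleftrightarrow> 0 \<in> \<Lambda> \<and> (\<forall>x\<in>\<Lambda>. \<forall>y\<in>\<Lambda>. x - y \<in> \<Lambda>)"

lemma additive_subgroup_diff: "additive_subgroup \<Lambda> \<Longrightarrow> x \<in> \<Lambda> \<Longrightarrow> y \<in> \<Lambda> \<Longrightarrow> x - y \<in> \<Lambda>"
  by (simp add: additive_subgroup_def)

lemma additive_subgroup_add: "additive_subgroup \<Lambda> \<Longrightarrow> x \<in> \<Lambda> \<Longrightarrow> y \<in> \<Lambda> \<Longrightarrow> x + y \<in> \<Lambda>"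
  unfolding additive_subgroup_def by (metis diff_0 diff_minus_eq_add)

lemma additive_subgroup_scale:
  fixes \<Lambda> :: "'a::real_vector set"
  assumes "additive_subgroup \<Lambda>" "x \<in> \<Lambda>"
  shows "of_int k *\<^sub>R x \<in> \<Lambda>"
proof (induction k rule: int_induct[where k = 0])
  case (step1 i)
  then show ?case
    using additive_subgroup_add[OF assms(1) _ assms(2)] by (simp add: scaleR_add_left)
next
  case (step2 i)
  then show ?case
    using additive_subgroup_diff[OF assms(1) _ assms(2)] by (simp add: scaleR_diff_left)
qed (use assms in \<open>simp add: additive_subgroup_def\<close>)

lemma additive_subgroup_int_iff_Gcd_dvd:
  fixes H :: "int set"
  assumes "additive_subgroup H"
  shows "k \<in> H \<longleftrightarrow> Gcd H dvd k"
proof -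
  have "k \<in> H" if "k \<in> group_closure H" for k
    using that by induction (use assms in \<open>auto simp: additive_subgroup_def\<close>)
  then have "group_closure H = H" by (auto intro: group_closure.base)
  then have "H = range ((*) (Gcd H))" using group_closure_eq[of H] by simp
  then show ?thesis by (auto simp: dvd_def)
qed

lemma ex_coordinate_generator:
  fixes \<Lambda> :: "(real ^ 'n) set"
  assumes \<Lambda>: "additive_subgroup \<Lambda>" "\<Lambda> \<subseteq> integer_points"
  obtains v where "v \<in> \<Lambda>" "\<And>x. x \<in> \<Lambda> \<Longrightarrow> \<exists>q::int. (x - of_int q *\<^sub>R v) $ j = 0"
proof -
  define H where "H = {k. \<exists>x\<in>\<Lambda>. x $ j = of_int k}"
  have "k - l \<in> H" if "k \<in> H" "l \<in> H" for k l
  proof -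
    obtain x y where "x \<in> \<Lambda>" "x $ j = of_int k" "y \<in> \<Lambda>" "y $ j = of_int l"
      using \<open>k \<in> H\<close> \<open>l \<in> H\<close> by (auto simp: H_def)
    then show ?thesis
      unfolding H_def using additive_subgroup_diff[OF \<Lambda>(1)]
      by (auto intro!: bexI[of _ "x - y"])
  qed
  moreover have "0 \<in> H" using \<Lambda>(1) by (auto simp: H_def additive_subgroup_def intro!: bexI[of _ 0])
  ultimately have H: "k \<in> H \<longleftrightarrow> Gcd H dvd k" for k
    by (intro additive_subgroup_int_iff_Gcd_dvd) (simp add: additive_subgroup_def)
  have "Gcd H \<in> H" by (simp only: H dvd_refl)
  then obtain v where v: "v \<in> \<Lambda>" "v $ j = of_int (Gcd H)" by (auto simp: H_def)
  have "\<exists>q::int. (x - of_int q *\<^sub>R v) $ j = 0" if x: "x \<in> \<Lambda>" for x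
  proof -
    have "x $ j \<in> \<int>" using x \<Lambda>(2) by (auto simp: integer_points_def)
    then obtain k where k: "x $ j = of_int k" by (rule Ints_cases)
    then have "k \<in> H" using x unfolding H_def by blast
    then obtain q where "k = Gcd H * q" unfolding H by (rule dvdE)
    then show ?thesis using k v(2) by (intro exI[of _ q]) simp
  qed
  then show ?thesis using that v(1) by blast
qed

lemma lattice_basis_subset:
  fixes B :: "(real ^ 'n) set"
  assumes "lattice_basis B \<Lambda>" shows "B \<subseteq> \<Lambda>"
proof
  fix b assume b: "b \<in> B"
  have "finite B" using assms independent_imp_finite by (auto simp: lattice_basis_def)
  then have "(\<Sum>b'\<in>B. of_int (if b' = b then 1 else 0) *\<^sub>R b') = b"
    using b by (simp add: if_distrib[of "\<lambda>x. of_int x *\<^sub>R _"] cong: if_cong)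
  then have "b \<in> range (\<lambda>z :: real ^ 'n \<Rightarrow> int. \<Sum>b\<in>B. of_int (z b) *\<^sub>R b)"
    by (intro range_eqI[of _ _ "\<lambda>b'. if b' = b then 1 else 0"]) simp
  then show "b \<in> \<Lambda>" using assms by (simp add: lattice_basis_def)
qed

lemma lattice_basis_insert:
  fixes B \<Lambda> :: "(real ^ 'n) set"
  assumes \<Lambda>: "additive_subgroup \<Lambda>" and B: "lattice_basis B {x \<in> \<Lambda>. x $ j = 0}"
    and v: "v \<in> \<Lambda>" "v $ j \<noteq> 0" "\<And>x. x \<in> \<Lambda> \<Longrightarrow> \<exists>q::int. (x - of_int q *\<^sub>R v) $ j = 0"
  shows "lattice_basis (insert v B) \<Lambda>"
proof -
  have ind: "independent B"
    and range_B: "{x \<in> \<Lambda>. x $ j = 0} = range (\<lambda>z. \<Sum>b\<in>B. of_int (z b) *\<^sub>R b)"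
    using B by (auto simp: lattice_basis_def)
  have fin: "finite B" using ind by (rule independent_imp_finite)
  have "span B \<subseteq> {x. axis j 1 \<bullet> x = 0}"
    using lattice_basis_subset[OF B]
    by (intro span_minimal subspace_hyperplane) (auto simp: inner_axis')
  then have vB: "v \<notin> span B" using v(2) by (auto simp: inner_axis')
  then have "v \<notin> B" using span_base by blast
  then have sum_insert: "(\<Sum>b\<in>insert v B. of_int (z b) *\<^sub>R b) =
      of_int (z v) *\<^sub>R v + (\<Sum>b\<in>B. of_int (z b) *\<^sub>R b)"
    for z :: "real ^ 'n \<Rightarrow> int" using fin by simp
  have "\<Lambda> = range (\<lambda>z. \<Sum>b\<in>insert v B. of_int (z b) *\<^sub>R b)"
  proof (intro equalityI subsetI)
    fix x assume x: "x \<in> \<Lambda>"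
    then obtain q where "(x - of_int q *\<^sub>R v) $ j = 0" using v(3) by blast
    then have "x - of_int q *\<^sub>R v \<in> {x \<in> \<Lambda>. x $ j = 0}"
      using additive_subgroup_diff[OF \<Lambda> x additive_subgroup_scale[OF \<Lambda> v(1)]] by blast
    then obtain z where z: "x - of_int q *\<^sub>R v = (\<Sum>b\<in>B. of_int (z b) *\<^sub>R b)" using range_B by auto
    have "(\<Sum>b\<in>B. of_int ((z(v := q)) b) *\<^sub>R b) = (\<Sum>b\<in>B. of_int (z b) *\<^sub>R b)"
      using \<open>v \<notin> B\<close> by (intro sum.cong) auto
    then have "x = (\<Sum>b\<in>insert v B. of_int ((z(v := q)) b) *\<^sub>R b)"
      unfolding sum_insert using z by (simp add: algebra_simps)
    then show "x \<in> range (\<lambda>z. \<Sum>b\<in>insert v B. of_int (z b) *\<^sub>R b)" by blast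
  next
    fix x assume "x \<in> range (\<lambda>z. \<Sum>b\<in>insert v B. of_int (z b) *\<^sub>R b)"
    then obtain z :: "real ^ 'n \<Rightarrow> int"
      where x: "x = of_int (z v) *\<^sub>R v + (\<Sum>b\<in>B. of_int (z b) *\<^sub>R b)" unfolding sum_insert by blast
    have "(\<Sum>b\<in>B. of_int (z b) *\<^sub>R b) \<in> {x \<in> \<Lambda>. x $ j = 0}" unfolding range_B by blast
    then show "x \<in> \<Lambda>"
      unfolding x using \<Lambda> v(1) by (intro additive_subgroup_add additive_subgroup_scale) auto
  qed
  then show ?thesis using ind vB by (simp add: lattice_basis_def independent_insert)
qed

lemma ex_lattice_basis_supported:
  fixes \<Lambda> :: "(real ^ 'n) set"
  assumes "finite J" "additive_subgroup \<Lambda>" "\<Lambda> \<subseteq> integer_points" "\<And>x j. x \<in> \<Lambda> \<Longrightarrow> j \<notin> J \<Longrightarrow> x $ j = 0"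
  shows "\<exists>B. lattice_basis B \<Lambda>"
  using assms
proof (induction J arbitrary: \<Lambda> rule: finite_induct)
  case empty
  then have "\<Lambda> = {0}" by (auto simp: vec_eq_iff additive_subgroup_def)
  then have "lattice_basis {} \<Lambda>" by (auto simp: lattice_basis_def independent_empty)
  then show ?case by blast
next
  case (insert j J)
  obtain v where v: "v \<in> \<Lambda>" "\<And>x. x \<in> \<Lambda> \<Longrightarrow> \<exists>q::int. (x - of_int q *\<^sub>R v) $ j = 0"
    using ex_coordinate_generator[OF insert.prems(1,2)] by blast
  have "\<exists>B. lattice_basis B {x \<in> \<Lambda>. x $ j = 0}"
  proof (rule insert.IH)
    show "additive_subgroup {x \<in> \<Lambda>. x $ j = 0}"
      using insert.prems(1) by (simp add: additive_subgroup_def)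
    show "x $ i = 0" if "x \<in> {x \<in> \<Lambda>. x $ j = 0}" "i \<notin> J" for x i
      using that insert.prems(3)[of x i] by (cases "i = j") auto
  qed (use insert.prems(2) in auto)
  then obtain B where B: "lattice_basis B {x \<in> \<Lambda>. x $ j = 0}" by blast
  show ?case
  proof (cases "v $ j = 0")
    case True
    then have "{x \<in> \<Lambda>. x $ j = 0} = \<Lambda>" using v(2) by auto
    then show ?thesis using B by auto
  next
    case False
    then show ?thesis using lattice_basis_insert[OF insert.prems(1) B v(1) _ v(2)] by blast
  qed
qed

lemma ex_lattice_basis:
  fixes V :: "(real ^ 'n) set"
  assumes "subspace V"
  shows "\<exists>B. lattice_basis B (integer_points \<inter> V)"
  using assms
  by (intro ex_lattice_basis_supported[of UNIV])
     (auto simp: additive_subgroup_def subspace_0 subspace_diff intro: integer_points_diff)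

lemma span_lattice_basis:
  assumes V: "rational_subspace V" and B: "lattice_basis B (integer_points \<inter> V)"
  shows "span B = V"
proof
  show "span B \<subseteq> V"
    using lattice_basis_subset[OF B] subspace_rational_subspace[OF V] by (intro span_minimal) auto
  have "V \<inter> rational_points \<subseteq> span B"
  proof
    fix x assume x: "x \<in> V \<inter> rational_points"
    then obtain D where D: "D > 0" "real D *\<^sub>R x \<in> integer_points"
      using ex_common_denominator[of "{x}"] by auto
    then have "real D *\<^sub>R x \<in> integer_points \<inter> V"
      using x subspace_rational_subspace[OF V] by (simp add: subspace_scale)
    then obtain z where z: "real D *\<^sub>R x = (\<Sum>b\<in>B. of_int (z b) *\<^sub>R b)"
      using B unfolding lattice_basis_def by auto
    have "real D *\<^sub>R x \<in> span B" unfolding z by (intro span_sum span_scale span_base)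
    then have "(1 / real D) *\<^sub>R (real D *\<^sub>R x) \<in> span B" by (rule span_scale)
    then show "x \<in> span B" using D(1) by simp
  qed
  then show "V \<subseteq> span B"
    using V span_mono[of _ "span B"] by (auto simp: rational_subspace_def span_span)
qed

section \<open>Riemann sums\<close>

lemma null_hyperplane_PiM:
  fixes \<alpha> :: "'b \<Rightarrow> real"
  assumes B: "finite B" and b0: "b0 \<in> B" "\<alpha> b0 \<noteq> 0"
  shows "{u \<in> B \<rightarrow>\<^sub>E UNIV. c + (\<Sum>b\<in>B. u b * \<alpha> b) = 0} \<in> null_sets (Pi\<^sub>M B (\<lambda>_. lborel))"
proof -
  interpret product_sigma_finite "\<lambda>_ :: 'b. lborel :: real measure" by standard
  define B' where "B' = B - {b0}"
  have B': "B = insert b0 B'" "b0 \<notin> B'" "finite B'" using assms by (auto simp: B'_def)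
  let ?M = "Pi\<^sub>M B (\<lambda>_. lborel :: real measure)"
  let ?H = "{u \<in> B \<rightarrow>\<^sub>E UNIV. c + (\<Sum>b\<in>B. u b * \<alpha> b) = 0}"
  have "(\<lambda>u. c + (\<Sum>b\<in>B. u b * \<alpha> b)) \<in> borel_measurable ?M" by measurable
  from measurable_sets[OF this, of "{0}"] have H: "?H \<in> sets ?M"
    by (simp add: vimage_def space_PiM Int_def conj_commute)
  have "(\<integral>\<^sup>+y. indicator ?H (x(b0 := y)) \<partial>lborel) = 0" for x :: "'b \<Rightarrow> real"
  proof -
    define y0 where "y0 = - (c + (\<Sum>b\<in>B'. x b * \<alpha> b)) / \<alpha> b0"
    have "y = y0" if "x(b0 := y) \<in> ?H" for y
    proof -
      have "(\<Sum>b\<in>B'. (x(b0 := y)) b * \<alpha> b) = (\<Sum>b\<in>B'. x b * \<alpha> b)"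
        using B'(2) by (intro sum.cong) auto
      then have "c + (y * \<alpha> b0 + (\<Sum>b\<in>B'. x b * \<alpha> b)) = 0" using that B' by (simp add: B'(1))
      then show ?thesis using b0(2) by (simp add: y0_def field_simps)
    qed
    then have "(\<integral>\<^sup>+y. indicator ?H (x(b0 := y)) \<partial>lborel) \<le>
        (\<integral>\<^sup>+y. indicator {y0} y \<partial>(lborel :: real measure))"
      by (intro nn_integral_mono) (auto simp: indicator_def)
    then show ?thesis by simp
  qed
  then have "(\<integral>\<^sup>+u. indicator ?H u \<partial>?M) = 0"
    using H unfolding B'(1) by (subst product_nn_integral_insert[OF B'(3,2)]) auto
  then show ?thesis using H by (simp add: null_sets_def)
qed

definition grid_point :: "real \<Rightarrow> ('b \<Rightarrow> real) \<Rightarrow> ('b \<Rightarrow> int) \<Rightarrow> 'b \<Rightarrow> real" where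
  "grid_point h \<beta> z b = h * (of_int (z b) + \<beta> b)"

definition grid_cell :: "real \<Rightarrow> ('b \<Rightarrow> real) \<Rightarrow> 'b set \<Rightarrow> ('b \<Rightarrow> int) \<Rightarrow> ('b \<Rightarrow> real) set" where
  "grid_cell h \<beta> B z = (\<Pi>\<^sub>E b\<in>B. {grid_point h \<beta> z b..<grid_point h \<beta> z b + h})"

definition grid_index :: "real \<Rightarrow> ('b \<Rightarrow> real) \<Rightarrow> 'b set \<Rightarrow> ('b \<Rightarrow> real) \<Rightarrow> 'b \<Rightarrow> int" where
  "grid_index h \<beta> B u = restrict (\<lambda>b. \<lfloor>u b / h - \<beta> b\<rfloor>) B"

lemma grid_cell_iff_grid_index:
  assumes "h > 0" "u \<in> B \<rightarrow>\<^sub>E UNIV" "z \<in> B \<rightarrow>\<^sub>E UNIV"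
  shows "u \<in> grid_cell h \<beta> B z \<longleftrightarrow> z = grid_index h \<beta> B u"
proof -
  have "u b \<in> {grid_point h \<beta> z b..<grid_point h \<beta> z b + h} \<longleftrightarrow> z b = \<lfloor>u b / h - \<beta> b\<rfloor>" for b
  proof -
    have "u b \<in> {grid_point h \<beta> z b..<grid_point h \<beta> z b + h} \<longleftrightarrow>
        of_int (z b) \<le> u b / h - \<beta> b \<and> u b / h - \<beta> b < of_int (z b) + 1"
      using assms(1) by (auto simp: grid_point_def field_simps)
    then show ?thesis by (simp add: eq_commute[of "z b"] floor_eq_iff)
  qed
  then show ?thesis
    using assms(2,3) by (auto simp: grid_cell_def grid_index_def PiE_iff extensional_def fun_eq_iff)
qed

lemma grid_point_grid_index:
  assumes "h > 0" "b \<in> B"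
  shows "\<bar>grid_point h \<beta> (grid_index h \<beta> B u) b - u b\<bar> \<le> h"
proof -
  have "grid_point h \<beta> (grid_index h \<beta> B u) b - u b =
      h * (of_int \<lfloor>u b / h - \<beta> b\<rfloor> - (u b / h - \<beta> b))"
    using assms by (simp add: grid_point_def grid_index_def field_simps)
  also have "\<bar>\<dots>\<bar> = h * \<bar>of_int \<lfloor>u b / h - \<beta> b\<rfloor> - (u b / h - \<beta> b)\<bar>"
    using assms(1) by (simp add: abs_mult)
  also have "\<dots> \<le> h * 1" using assms(1) by (intro mult_left_mono) linarith+
  finally show ?thesis by simp
qed

lemma grid_point_grid_index_tendsto:
  assumes "\<And>k. h k > 0" "h \<longlonglongrightarrow> 0" "b \<in> B"
  shows "(\<lambda>k. grid_point (h k) (\<beta> k) (grid_index (h k) (\<beta> k) B u) b) \<longlonglongrightarrow> u b"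
proof -
  have "(\<lambda>k. grid_point (h k) (\<beta> k) (grid_index (h k) (\<beta> k) B u) b - u b) \<longlonglongrightarrow> 0"
    by (rule Lim_null_comparison[OF always_eventually assms(2)])
       (use grid_point_grid_index[OF assms(1,3)] in simp)
  then show ?thesis by (simp add: LIM_zero_iff)
qed

lemma Union_grid_cells_iff:
  assumes "h > 0" "u \<in> B \<rightarrow>\<^sub>E UNIV"
  shows "u \<in> (\<Union>z\<in>{z \<in> B \<rightarrow>\<^sub>E UNIV. P z}. grid_cell h \<beta> B z) \<longleftrightarrow> P (grid_index h \<beta> B u)"
proof -
  have "grid_index h \<beta> B u \<in> B \<rightarrow>\<^sub>E UNIV" by (simp add: grid_index_def)
  then show ?thesis using grid_cell_iff_grid_index[OF assms] by auto
qed

lemma finite_bounded_grid: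
  assumes "finite B" "h > 0"
  shows "finite {z \<in> B \<rightarrow>\<^sub>E UNIV. \<forall>b\<in>B. \<bar>grid_point h \<beta> z b\<bar> \<le> R}"
proof (rule finite_subset)
  show "{z \<in> B \<rightarrow>\<^sub>E UNIV. \<forall>b\<in>B. \<bar>grid_point h \<beta> z b\<bar> \<le> R} \<subseteq>
      (\<Pi>\<^sub>E b\<in>B. {\<lceil>- R / h - \<beta> b\<rceil>..\<lfloor>R / h - \<beta> b\<rfloor>})"
  proof
    fix z assume z: "z \<in> {z \<in> B \<rightarrow>\<^sub>E UNIV. \<forall>b\<in>B. \<bar>grid_point h \<beta> z b\<bar> \<le> R}"
    have "z b \<in> {\<lceil>- R / h - \<beta> b\<rceil>..\<lfloor>R / h - \<beta> b\<rfloor>}" if "b \<in> B" for b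
    proof -
      have "\<bar>of_int (z b) + \<beta> b\<bar> \<le> R / h"
        using z that assms(2) by (simp add: grid_point_def abs_mult pos_le_divide_eq mult.commute)
      then show ?thesis by (auto simp: ceiling_le_iff le_floor_iff)
    qed
    then show "z \<in> (\<Pi>\<^sub>E b\<in>B. {\<lceil>- R / h - \<beta> b\<rceil>..\<lfloor>R / h - \<beta> b\<rfloor>})" using z by (auto simp: PiE_def)
  qed
qed (use assms(1) in \<open>auto intro: finite_PiE\<close>)

lemma measure_grid_cells:
  fixes B :: "'b set"
  assumes B: "finite B" and h: "h > 0" and Z: "finite Z" "Z \<subseteq> B \<rightarrow>\<^sub>E UNIV"
  shows "(\<Union>z\<in>Z. grid_cell h \<beta> B z) \<in> sets (Pi\<^sub>M B (\<lambda>_. lborel))"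
    and "measure (Pi\<^sub>M B (\<lambda>_. lborel)) (\<Union>z\<in>Z. grid_cell h \<beta> B z) = real (card Z) * h ^ card B"
proof -
  interpret product_sigma_finite "\<lambda>_ :: 'b. lborel :: real measure" by standard
  have cell: "grid_cell h \<beta> B z \<in> sets (Pi\<^sub>M B (\<lambda>_. lborel))"
      "emeasure (Pi\<^sub>M B (\<lambda>_. lborel)) (grid_cell h \<beta> B z) = ennreal (h ^ card B)" for z
    unfolding grid_cell_def using B h
    by (auto intro!: sets_PiM_I_finite simp: emeasure_PiM ennreal_power)
  then show "(\<Union>z\<in>Z. grid_cell h \<beta> B z) \<in> sets (Pi\<^sub>M B (\<lambda>_. lborel))" using Z(1) by auto
  have "z = z'" if "z \<in> Z" "z' \<in> Z" "u \<in> grid_cell h \<beta> B z" "u \<in> grid_cell h \<beta> B z'" for z z' u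
  proof -
    have "u \<in> B \<rightarrow>\<^sub>E UNIV" using that(3) by (auto simp: grid_cell_def PiE_def)
    moreover have "z \<in> B \<rightarrow>\<^sub>E UNIV" "z' \<in> B \<rightarrow>\<^sub>E UNIV" using Z(2) that(1,2) by auto
    ultimately show ?thesis
      using grid_cell_iff_grid_index[OF h, of u B z \<beta>] grid_cell_iff_grid_index[OF h, of u B z' \<beta>]
        that(3,4) by blast
  qed
  then have "disjoint_family_on (grid_cell h \<beta> B) Z" unfolding disjoint_family_on_def by blast
  then have "emeasure (Pi\<^sub>M B (\<lambda>_. lborel)) (\<Union>z\<in>Z. grid_cell h \<beta> B z) =
      (\<Sum>z\<in>Z. ennreal (h ^ card B))"
    using Z(1) cell by (subst sum_emeasure[symmetric]) auto
  also have "\<dots> = ennreal (real (card Z) * h ^ card B)"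
    using h by (simp add: ennreal_mult ennreal_of_nat_eq_real_of_nat)
  finally show
    "measure (Pi\<^sub>M B (\<lambda>_. lborel)) (\<Union>z\<in>Z. grid_cell h \<beta> B z) = real (card Z) * h ^ card B"
    using h by (simp add: measure_def)
qed

lemma box_PiM:
  fixes l r :: real and B :: "'b set"
  assumes "finite B"
  shows "(\<Pi>\<^sub>E b\<in>B. {l..r}) \<in> sets (Pi\<^sub>M B (\<lambda>_. lborel))"
    and "emeasure (Pi\<^sub>M B (\<lambda>_. lborel)) (\<Pi>\<^sub>E b\<in>B. {l..r}) < \<infinity>"
proof -
  interpret product_sigma_finite "\<lambda>_ :: 'b. lborel :: real measure" by standard
  show "(\<Pi>\<^sub>E b\<in>B. {l..r}) \<in> sets (Pi\<^sub>M B (\<lambda>_. lborel))"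
    using assms by (intro sets_PiM_I_finite) auto
  show "emeasure (Pi\<^sub>M B (\<lambda>_. lborel)) (\<Pi>\<^sub>E b\<in>B. {l..r}) < \<infinity>"
    using assms by (simp add: emeasure_PiM power_less_top_ennreal emeasure_lborel_Icc_eq)
qed

lemma grid_cell_subset_box:
  assumes "\<And>b. b \<in> B \<Longrightarrow> \<bar>grid_point h \<beta> z b\<bar> \<le> R" "h \<le> H"
  shows "grid_cell h \<beta> B z \<subseteq> (\<Pi>\<^sub>E b\<in>B. {- R..R + H})"
  unfolding grid_cell_def
proof (rule PiE_mono)
  fix b assume "b \<in> B"
  then show "{grid_point h \<beta> z b..<grid_point h \<beta> z b + h} \<subseteq> {- R..R + H}"
    using assms(1)[of b] assms(2) by auto
qed

lemma grid_count_limit: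
  fixes B :: "'b set" and h :: "nat \<Rightarrow> real" and \<beta> :: "nat \<Rightarrow> 'b \<Rightarrow> real"
  assumes B: "finite B" and h: "\<And>k. h k > 0" "h \<longlonglongrightarrow> 0"
    and bounded: "\<And>u b. u \<in> X \<Longrightarrow> b \<in> B \<Longrightarrow> \<bar>u b\<bar> \<le> R"
    and Y: "Y \<in> sets (Pi\<^sub>M B (\<lambda>_. lborel))" and N: "N \<in> null_sets (Pi\<^sub>M B (\<lambda>_. lborel))"
    and conv: "\<And>u v. u \<in> (B \<rightarrow>\<^sub>E UNIV) - N \<Longrightarrow> (\<And>b. b \<in> B \<Longrightarrow> (\<lambda>k. v k b) \<longlonglongrightarrow> u b) \<Longrightarrow>
      \<forall>\<^sub>F k in sequentially. restrict (v k) B \<in> X \<longleftrightarrow> u \<in> Y"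
  shows "(\<lambda>k. real (card {z \<in> B \<rightarrow>\<^sub>E UNIV. restrict (grid_point (h k) (\<beta> k) z) B \<in> X})
    * h k ^ card B) \<longlonglongrightarrow> measure (Pi\<^sub>M B (\<lambda>_. lborel)) Y"
proof -
  let ?M = "Pi\<^sub>M B (\<lambda>_. lborel :: real measure)"
  define Z where "Z k = {z \<in> B \<rightarrow>\<^sub>E UNIV. restrict (grid_point (h k) (\<beta> k) z) B \<in> X}" for k
  define E where "E k = (\<Union>z\<in>Z k. grid_cell (h k) (\<beta> k) B z)" for k
  have Z_bounded: "\<bar>grid_point (h k) (\<beta> k) z b\<bar> \<le> R" if "z \<in> Z k" "b \<in> B" for k z b
    using that bounded[of "restrict (grid_point (h k) (\<beta> k) z) B" b] by (simp add: Z_def)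
  then have "Z k \<subseteq> {z \<in> B \<rightarrow>\<^sub>E UNIV. \<forall>b\<in>B. \<bar>grid_point (h k) (\<beta> k) z b\<bar> \<le> R}" for k
    by (auto simp: Z_def)
  then have "finite (Z k)" for k by (rule finite_subset) (rule finite_bounded_grid[OF B h(1)])
  then have E: "E k \<in> sets ?M" "measure ?M (E k) = real (card (Z k)) * h k ^ card B" for k
    unfolding E_def by (intro measure_grid_cells B h(1); auto simp: Z_def)+
  obtain H where H: "\<And>k. h k \<le> H"
    using convergent_imp_Bseq[of h] h(2) unfolding convergent_def Bseq_def
    by (auto simp: abs_le_iff)
  define box where "box = (\<Pi>\<^sub>E b\<in>B. {- R..R + H})"
  note box = box_PiM[OF B, of "- R" "R + H", folded box_def]
  have "E k \<subseteq> box" for k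
    unfolding E_def box_def using Z_bounded H by (intro UN_least grid_cell_subset_box) auto
  then have bound: "norm (indicator (E k) u :: real) \<le> indicator box u" for k u
    by (auto simp: indicator_def)
  have ae: "AE u in ?M. (\<lambda>k. indicator (E k) u :: real) \<longlonglongrightarrow> indicator Y u"
  proof (rule AE_I'[OF N], rule subsetI, rule ccontr)
    fix u assume u: "u \<in> {u \<in> space ?M. \<not> (\<lambda>k. indicator (E k) u :: real) \<longlonglongrightarrow> indicator Y u}" "u \<notin> N"
    then have uB: "u \<in> B \<rightarrow>\<^sub>E UNIV" by (simp add: space_PiM)
    have "\<forall>\<^sub>F k in sequentially.
        restrict (grid_point (h k) (\<beta> k) (grid_index (h k) (\<beta> k) B u)) B \<in> X \<longleftrightarrow> u \<in> Y"
      using uB u(2) grid_point_grid_index_tendsto[OF h] by (intro conv) auto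
    then have "\<forall>\<^sub>F k in sequentially. (indicator (E k) u :: real) = indicator Y u"
      by eventually_elim
        (simp only: indicator_def E_def Z_def Union_grid_cells_iff[OF h(1) uB])
    from tendsto_eventually[OF this] show False using u(1) by simp
  qed
  have "(\<lambda>k. integral\<^sup>L ?M (indicator (E k))) \<longlonglongrightarrow> (integral\<^sup>L ?M (indicator Y) :: real)"
    by (rule integral_dominated_convergence[where w = "indicator box"])
       (use E(1) Y box bound ae in \<open>simp_all add: integrable_indicator_iff\<close>)
  then show ?thesis
    using E sets.sets_into_space[OF Y] sets.sets_into_space[OF E(1)]
    by (simp add: Int_absorb2 Z_def)
qed

lemma ex_representation_bound:
  fixes B :: "'a::euclidean_space set"
  assumes "independent B"
  obtains K where "K \<ge> 0" "\<And>x b. x \<in> span B \<Longrightarrow> b \<in> B \<Longrightarrow> \<bar>representation B x b\<bar> \<le> K * norm x"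
proof -
  define E where "E = extend_basis B"
  have E: "independent E" "span E = UNIV" "B \<subseteq> E"
    using assms by (auto simp: E_def independent_extend_basis extend_basis_superset)
  have "\<exists>K\<ge>0. \<forall>x. \<bar>representation E x b\<bar> \<le> norm x * K" for b
    using bounded_linear.nonneg_bounded[OF bounded_linear_representation[OF E(1,2)], of b] by auto
  then obtain K where K: "\<And>b. K b \<ge> 0" "\<And>x b. \<bar>representation E x b\<bar> \<le> norm x * K b" by metis
  have "\<bar>representation B x b\<bar> \<le> (\<Sum>b\<in>B. K b) * norm x" if "x \<in> span B" "b \<in> B" for x b
  proof -
    have "\<bar>representation B x b\<bar> \<le> norm x * K b"
      using K(2) real_vector.representation_extend[OF E(1) that(1) E(3)] by metis
    also have "\<dots> \<le> norm x * (\<Sum>b\<in>B. K b)"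
      using K(1) that(2) independent_imp_finite[OF assms]
      by (intro mult_left_mono member_le_sum) auto
    finally show ?thesis by (simp add: mult.commute)
  qed
  then show ?thesis using that[of "\<Sum>b\<in>B. K b"] K(1) by (simp add: sum_nonneg)
qed

definition from_coordinates :: "'a::real_vector \<Rightarrow> 'a set \<Rightarrow> ('a \<Rightarrow> real) \<Rightarrow> 'a" where
  "from_coordinates p B u = p + (\<Sum>b\<in>B. u b *\<^sub>R b)"

lemma from_coordinates_restrict [simp]:
  "from_coordinates p B (restrict u B) = from_coordinates p B u"
  by (simp add: from_coordinates_def)

lemma from_coordinates_grid_point:
  fixes p :: "'a::real_vector"
  assumes "h \<noteq> 0"
  shows "from_coordinates p B (grid_point h \<beta> z) =
    h *\<^sub>R from_coordinates (from_coordinates ((1 / h) *\<^sub>R p) B \<beta>) B (\<lambda>b. of_int (z b))"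
  using assms by (simp add: from_coordinates_def grid_point_def scaleR_add_right scaleR_sum_right
      algebra_simps sum.distrib)

lemma bij_betw_lattice_coordinates:
  fixes B :: "(real ^ 'n) set"
  assumes B: "lattice_basis B \<Lambda>"
  shows "bij_betw (\<lambda>z. from_coordinates y B (\<lambda>b. of_int (z b))) (B \<rightarrow>\<^sub>E UNIV) ((+) y ` \<Lambda>)"
  unfolding bij_betw_def
proof
  have ind: "independent B" and range_B: "\<Lambda> = range (\<lambda>z. \<Sum>b\<in>B. of_int (z b) *\<^sub>R b)"
    using B by (auto simp: lattice_basis_def)
  note rep = representation_sum_scale[OF ind independent_imp_finite[OF ind]]
  show "inj_on (\<lambda>z. from_coordinates y B (\<lambda>b. of_int (z b))) (B \<rightarrow>\<^sub>E UNIV)"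
  proof (rule inj_onI)
    fix z z' :: "real ^ 'n \<Rightarrow> int"
    assume z: "z \<in> B \<rightarrow>\<^sub>E UNIV" "z' \<in> B \<rightarrow>\<^sub>E UNIV"
      and "from_coordinates y B (\<lambda>b. of_int (z b)) = from_coordinates y B (\<lambda>b. of_int (z' b))"
    then have "z b = z' b" if "b \<in> B" for b
      using rep[OF that, of "\<lambda>b. of_int (z b)"] rep[OF that, of "\<lambda>b. of_int (z' b)"]
      by (simp add: from_coordinates_def)
    then show "z = z'" using z by (intro PiE_ext)
  qed
  have "\<Lambda> = (\<lambda>z. \<Sum>b\<in>B. of_int (z b) *\<^sub>R b) ` (B \<rightarrow>\<^sub>E UNIV)"
    unfolding range_B
  proof (intro equalityI subsetI)
    fix x assume "x \<in> range (\<lambda>z. \<Sum>b\<in>B. of_int (z b) *\<^sub>R b)"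
    then obtain z :: "real ^ 'n \<Rightarrow> int" where "x = (\<Sum>b\<in>B. of_int (restrict z B b) *\<^sub>R b)" by auto
    then show "x \<in> (\<lambda>z. \<Sum>b\<in>B. of_int (z b) *\<^sub>R b) ` (B \<rightarrow>\<^sub>E UNIV)"
      by (intro image_eqI[of x _ "restrict z B"]) simp_all
  qed blast
  then show "(\<lambda>z. from_coordinates y B (\<lambda>b. of_int (z b))) ` (B \<rightarrow>\<^sub>E UNIV) = (+) y ` \<Lambda>"
    by (simp add: from_coordinates_def image_image)
qed

lemma from_coordinates_representation:
  assumes "independent B" "finite B" "x - p \<in> span B"
  shows "from_coordinates p B (representation B (x - p)) = x"
  using real_vector.sum_representation_eq[OF assms(1,3,2)] by (simp add: from_coordinates_def)

lemma tendsto_from_coordinates: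
  fixes p :: "'a::real_normed_vector"
  assumes "\<And>b. b \<in> B \<Longrightarrow> ((\<lambda>k. v k b) \<longlongrightarrow> u b) F"
  shows "((\<lambda>k. from_coordinates p B (v k)) \<longlongrightarrow> from_coordinates p B u) F"
  unfolding from_coordinates_def by (intro tendsto_intros assms)

lemma measurable_from_coordinates [measurable]:
  fixes p :: "'a::euclidean_space"
  shows "from_coordinates p B \<in> borel_measurable (Pi\<^sub>M B (\<lambda>_. lborel))"
  unfolding from_coordinates_def[abs_def] by measurable

lemma from_coordinates_vimage_sets:
  fixes p :: "'a::euclidean_space"
  assumes "S \<in> sets borel"
  shows "{u \<in> B \<rightarrow>\<^sub>E UNIV. from_coordinates p B u \<in> S} \<in> sets (Pi\<^sub>M B (\<lambda>_. lborel))"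
  using measurable_sets[OF measurable_from_coordinates assms, of p B]
  by (simp add: vimage_def space_PiM Int_def conj_commute)

lemma null_hyperplane_from_coordinates:
  fixes p :: "'a::euclidean_space"
  assumes "finite B" and "c \<bullet> from_coordinates p B v \<noteq> 0"
  shows "{u \<in> B \<rightarrow>\<^sub>E UNIV. c \<bullet> from_coordinates p B u = 0} \<in> null_sets (Pi\<^sub>M B (\<lambda>_. lborel))"
proof -
  have eq: "c \<bullet> from_coordinates p B u = c \<bullet> p + (\<Sum>b\<in>B. u b * (c \<bullet> b))" for u
    by (simp add: from_coordinates_def inner_add_right inner_sum_right)
  show ?thesis
  proof (cases "\<exists>b\<in>B. c \<bullet> b \<noteq> 0")
    case True
    then show ?thesis unfolding eq using null_hyperplane_PiM[OF assms(1)] by blast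
  next
    case False
    then have "{u \<in> B \<rightarrow>\<^sub>E UNIV. c \<bullet> from_coordinates p B u = 0} = {}"
      using assms(2) by (simp add: eq)
    then show ?thesis by (simp only: null_sets.empty_sets)
  qed
qed

lemma coordinates_bounded:
  fixes B :: "'a::euclidean_space set"
  assumes B: "independent B" and Y: "bounded (Y \<inter> range (from_coordinates p B))"
  obtains R where "\<And>u b. from_coordinates p B u \<in> Y \<Longrightarrow> b \<in> B \<Longrightarrow> \<bar>u b\<bar> \<le> R"
proof -
  let ?\<Phi> = "from_coordinates p B"
  obtain M where M: "\<And>u. ?\<Phi> u \<in> Y \<Longrightarrow> norm (?\<Phi> u) \<le> M" using Y unfolding bounded_iff by auto
  obtain K where K: "K \<ge> 0" "\<And>x b. x \<in> span B \<Longrightarrow> b \<in> B \<Longrightarrow> \<bar>representation B x b\<bar> \<le> K * norm x"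
    using ex_representation_bound[OF B] by blast
  have "\<bar>u b\<bar> \<le> K * (M + norm p)" if "?\<Phi> u \<in> Y" "b \<in> B" for u b
  proof -
    have "?\<Phi> u - p \<in> span B" "representation B (?\<Phi> u - p) b = u b"
      using representation_sum_scale[OF B independent_imp_finite[OF B] that(2)]
      by (auto simp: from_coordinates_def intro: span_sum span_scale span_base)
    then have "\<bar>u b\<bar> \<le> K * norm (?\<Phi> u - p)" using K(2) that(2) by metis
    also have "\<dots> \<le> K * (M + norm p)"
      using K(1) M[OF that(1)] norm_triangle_ineq4[of "?\<Phi> u" p] by (intro mult_left_mono) auto
    finally show ?thesis .
  qed
  then show ?thesis using that by blast
qed

lemma coordinate_grid_count_limit:
  fixes B :: "(real ^ 'n) set" and h :: "nat \<Rightarrow> real" and \<beta> :: "nat \<Rightarrow> real ^ 'n \<Rightarrow> real"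
  assumes B: "independent B" and h: "\<And>k. h k > 0" "h \<longlonglongrightarrow> 0"
    and X: "open X" "X \<subseteq> Y" and Y: "closed Y" "bounded (Y \<inter> range (from_coordinates p B))"
    and null: "{u \<in> B \<rightarrow>\<^sub>E UNIV. from_coordinates p B u \<in> Y - X} \<in> null_sets (Pi\<^sub>M B (\<lambda>_. lborel))"
  shows "(\<lambda>k. real (card {z \<in> B \<rightarrow>\<^sub>E UNIV. from_coordinates p B (grid_point (h k) (\<beta> k) z) \<in> X})
      * h k ^ card B) \<longlonglongrightarrow> coordinate_volume B p Y"
proof -
  let ?\<Phi> = "from_coordinates p B"
  have fin: "finite B" using B by (rule independent_imp_finite)
  obtain R where "\<And>u b. ?\<Phi> u \<in> Y \<Longrightarrow> b \<in> B \<Longrightarrow> \<bar>u b\<bar> \<le> R"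
    using coordinates_bounded[OF B Y(2)] by blast
  then have "(\<lambda>k. real (card {z \<in> B \<rightarrow>\<^sub>E UNIV.
        restrict (grid_point (h k) (\<beta> k) z) B \<in> {u. ?\<Phi> u \<in> X}})
      * h k ^ card B) \<longlonglongrightarrow> measure (Pi\<^sub>M B (\<lambda>_. lborel)) {u \<in> B \<rightarrow>\<^sub>E UNIV. ?\<Phi> u \<in> Y}"
  proof (intro grid_count_limit[OF fin h _ _ null])
    show "{u \<in> B \<rightarrow>\<^sub>E UNIV. ?\<Phi> u \<in> Y} \<in> sets (Pi\<^sub>M B (\<lambda>_. lborel))"
      using Y(1) by (intro from_coordinates_vimage_sets) auto
    fix u v assume u: "u \<in> (B \<rightarrow>\<^sub>E UNIV) - {u \<in> B \<rightarrow>\<^sub>E UNIV. ?\<Phi> u \<in> Y - X}"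
      and v: "\<And>b. b \<in> B \<Longrightarrow> (\<lambda>k. v k b) \<longlonglongrightarrow> u b"
    have lim: "(\<lambda>k. ?\<Phi> (v k)) \<longlonglongrightarrow> ?\<Phi> u" using v by (rule tendsto_from_coordinates)
    consider (inside) "?\<Phi> u \<in> X" | (outside) "?\<Phi> u \<in> - Y" using u by blast
    then show "\<forall>\<^sub>F k in sequentially. restrict (v k) B \<in> {u. ?\<Phi> u \<in> X} \<longleftrightarrow>
        u \<in> {u \<in> B \<rightarrow>\<^sub>E UNIV. ?\<Phi> u \<in> Y}"
    proof cases
      case inside
      show ?thesis
        using topological_tendstoD[OF lim X(1) inside]
        by eventually_elim (use inside u X(2) in auto)
    next
      case outside
      show ?thesis
        using topological_tendstoD[OF lim open_Compl[OF Y(1)] outside]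
        by eventually_elim (use outside X(2) in auto)
    qed
  qed (use X(2) in auto)
  then show ?thesis by (simp add: coordinate_volume_def from_coordinates_def)
qed

section \<open>Chambers of the braid arrangement\<close>

lemma strict_mono_iff_sorted_wrt:
  fixes h :: "'n::{finite,linorder} \<Rightarrow> 'b::linorder"
  shows "strict_mono h \<longleftrightarrow> sorted_wrt (<) (map h (sorted_list_of_set UNIV))"
proof
  assume "strict_mono h"
  then show "sorted_wrt (<) (map h (sorted_list_of_set UNIV))"
    unfolding sorted_wrt_map
    by (intro sorted_wrt_mono_rel[OF _ strict_sorted_list_of_set]) (simp add: strict_mono_def)
next
  assume sorted: "sorted_wrt (<) (map h (sorted_list_of_set UNIV))"
  show "strict_mono h"
  proof (rule strict_monoI)
    fix i j :: 'n assume "i < j"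
    let ?js = "sorted_list_of_set (UNIV :: 'n set)"
    obtain a where a: "a < length ?js" "?js ! a = i" using in_set_conv_nth[of i ?js] by auto
    obtain b where b: "b < length ?js" "?js ! b = j" using in_set_conv_nth[of j ?js] by auto
    have "\<not> b \<le> a"
      using sorted_nth_mono[OF sorted_sorted_list_of_set, of b a "UNIV :: 'n set"] a b \<open>i < j\<close>
      by auto
    then show "h i < h j"
      using sorted sorted_wrt_nth_less[of "(<)" "map h ?js" a b] a b by simp
  qed
qed

lemma ex1_sorting_permutation:
  fixes g :: "'n::{finite,linorder} \<Rightarrow> 'b::linorder"
  assumes "inj g"
  shows "\<exists>!\<sigma>. \<sigma> permutes UNIV \<and> strict_mono (\<lambda>i. g (\<sigma> i))"
proof -
  define js where "js = sorted_list_of_set (UNIV :: 'n set)"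
  have "distinct js" "length (map (inv g) (sorted_list_of_set (range g))) = length js"
    using assms by (simp_all add: js_def card_image)
  then obtain \<sigma> where \<sigma>: "map \<sigma> js = map (inv g) (sorted_list_of_set (range g))"
    using ex_map_eq_if_distinct by blast
  have "map (\<lambda>i. g (\<sigma> i)) js = map g (map \<sigma> js)" by simp
  also have "\<dots> = sorted_list_of_set (range g)"
    unfolding \<sigma> map_map by (intro map_idI) (simp add: f_inv_into_f)
  finally have g\<sigma>: "map (\<lambda>i. g (\<sigma> i)) js = sorted_list_of_set (range g)" .
  then have "set (map (\<lambda>i. g (\<sigma> i)) js) = range g"
    by (simp only: set_sorted_list_of_set finite finite_imageI)
  then have "g ` range \<sigma> = g ` UNIV" by (simp add: js_def image_image)
  then have "surj \<sigma>" using assms by (simp only: inj_image_eq_iff)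
  then have "\<sigma> permutes UNIV" by (intro bij_imp_permutes) (auto simp: bij_def finite_UNIV_surj_inj)
  moreover have "strict_mono (\<lambda>i. g (\<sigma> i))"
    using g\<sigma> by (simp add: strict_mono_iff_sorted_wrt js_def)
  moreover have "\<tau> = \<sigma>" if \<tau>: "\<tau> permutes UNIV" "strict_mono (\<lambda>i. g (\<tau> i))" for \<tau>
  proof
    fix i
    have "set (map (\<lambda>i. g (\<tau> i)) js) = range g"
      using permutes_surj[OF \<tau>(1)] by (simp add: js_def) (metis image_image)
    then have "map (\<lambda>i. g (\<tau> i)) js = map (\<lambda>i. g (\<sigma> i)) js"
      using \<tau>(2) unfolding g\<sigma> strict_mono_iff_sorted_wrt js_def[symmetric]
      by (intro strict_sorted_equal) auto
    then have "g (\<tau> i) = g (\<sigma> i)" by (simp add: js_def)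
    then show "\<tau> i = \<sigma> i" using assms by (simp add: inj_eq)
  qed
  ultimately show ?thesis by blast
qed

lemma realizes_imp_inj:
  assumes "\<sigma> permutes UNIV" "realizes x \<sigma>"
  shows "inj (\<lambda>j. x $ j)"
proof -
  have "inj (\<lambda>i. x $ \<sigma> i)" using assms(2) unfolding realizes_def by (rule strict_mono_imp_inj_on)
  then show ?thesis
    using inj_compose[OF _ permutes_inj[OF permutes_inv[OF assms(1)]], of "\<lambda>i. x $ \<sigma> i"]
    by (simp add: comp_def permutes_inverses(1)[OF assms(1)])
qed

lemma realizes_scale: "r > 0 \<Longrightarrow> realizes (r *\<^sub>R x) \<sigma> \<longleftrightarrow> realizes x \<sigma>"
  by (simp add: realizes_def strict_mono_def)

definition chamber_forms :: "('n \<Rightarrow> 'n) \<Rightarrow> (real ^ 'n::{finite,linorder}) set" where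
  "chamber_forms \<sigma> =
    range (\<lambda>j. axis j 1) \<union> (\<lambda>(i, j). axis (\<sigma> j) 1 - axis (\<sigma> i) 1) ` {(i, j). i < j}"

lemma finite_chamber_forms: "finite (chamber_forms \<sigma>)"
  by (simp add: chamber_forms_def)

lemma chamber_forms_rational: "chamber_forms \<sigma> \<subseteq> rational_points"
  by (auto simp: chamber_forms_def intro!: rational_points_diff)

lemma chamber_forms_nonneg_iff:
  "(\<forall>a\<in>chamber_forms \<sigma>. a \<bullet> x \<ge> 0) \<longleftrightarrow> (\<forall>j. 0 \<le> x $ j) \<and> compatible x \<sigma>"
proof -
  have "compatible x \<sigma> \<longleftrightarrow> (\<forall>i j. i < j \<longrightarrow> x $ \<sigma> i \<le> x $ \<sigma> j)"
    unfolding compatible_def mono_def by (metis order_le_less order.refl)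
  then show ?thesis by (auto simp: chamber_forms_def ball_Un inner_axis' inner_diff_left)
qed

lemma chamber_forms_pos_iff:
  "(\<forall>a\<in>chamber_forms \<sigma>. a \<bullet> x > 0) \<longleftrightarrow> (\<forall>j. 0 < x $ j) \<and> realizes x \<sigma>"
  unfolding realizes_def strict_mono_def
  by (auto simp: chamber_forms_def ball_Un inner_axis' inner_diff_left)

definition nonneg_orthant :: "(real ^ 'n) set" where
  "nonneg_orthant = {x. \<forall>j. 0 \<le> x $ j}"

definition distinct_positive :: "(real ^ 'n) set" where
  "distinct_positive = {x. (\<forall>j. 0 < x $ j) \<and> inj (\<lambda>j. x $ j)}"

lemma nonneg_orthant_Inter: "nonneg_orthant = (\<Inter>j. {x. x $ j \<ge> 0})"
  by (auto simp: nonneg_orthant_def)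

lemma closed_nonneg_orthant: "closed nonneg_orthant"
  unfolding nonneg_orthant_Inter by (intro closed_INT ballI closed_Collect_le continuous_intros)

lemma convex_nonneg_orthant: "convex nonneg_orthant"
  by (auto simp: convex_def nonneg_orthant_def)

lemma open_pos_orthant: "open {x :: real ^ 'n. \<forall>j. 0 < x $ j}"
proof -
  have "{x :: real ^ 'n. \<forall>j. 0 < x $ j} = (\<Inter>j. {x. 0 < x $ j})" by auto
  then show ?thesis by (auto intro!: open_INT open_Collect_less continuous_intros)
qed

lemma interior_nonneg_orthant: "interior nonneg_orthant = {x :: real ^ 'n. \<forall>j. 0 < x $ j}"
proof
  show "interior nonneg_orthant \<subseteq> {x :: real ^ 'n. \<forall>j. 0 < x $ j}"
    using interior_mono[of nonneg_orthant "{x. x $ j \<ge> 0}" for j]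
    unfolding nonneg_orthant_Inter interior_halfspace_component_ge by blast
  show "{x :: real ^ 'n. \<forall>j. 0 < x $ j} \<subseteq> interior nonneg_orthant"
    by (rule interior_maximal[OF _ open_pos_orthant]) (auto simp: nonneg_orthant_def less_imp_le)
qed

lemma open_distinct_positive: "open (distinct_positive :: (real ^ 'n) set)"
proof -
  have eq: "(distinct_positive :: (real ^ 'n) set) =
      {x. \<forall>j. 0 < x $ j} \<inter> (\<Inter>i. \<Inter>j\<in>- {i}. {x. x $ i \<noteq> x $ j})"
    by (auto simp: distinct_positive_def inj_def)
  show ?thesis
    unfolding eq
    by (intro open_Int open_pos_orthant open_INT ballI open_Collect_neq continuous_intros finite)
qed

lemma distinct_positive_scale: "r > 0 \<Longrightarrow> r *\<^sub>R x \<in> distinct_positive \<longleftrightarrow> x \<in> distinct_positive"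
  by (simp add: distinct_positive_def inj_def zero_less_mult_iff)

lemma rational_linear_formE:
  assumes "rational_linear_form g"
  obtains c where "c \<in> rational_points" "\<And>x. g x = c \<bullet> x"
proof -
  define c where "c = (\<chi> j. g (axis j 1))"
  have "linear g" using assms by (simp add: rational_linear_form_def)
  have "g x = g (\<Sum>j\<in>UNIV. x $ j *\<^sub>R axis j 1)" for x
    using basis_expansion[of x] by (simp add: scalar_mult_eq_scaleR)
  also have "\<dots> x = c \<bullet> x" for x
    by (simp add: linear_sum[OF \<open>linear g\<close>] linear_scale[OF \<open>linear g\<close>] c_def inner_vec_def
        mult.commute)
  finally have "g x = c \<bullet> x" for x .
  moreover have "c \<in> rational_points"
    using assms by (simp add: c_def rational_points_def rational_linear_form_def)
  ultimately show ?thesis using that by blast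
qed

lemma rational_linear_form_diff:
  "rational_linear_form g \<Longrightarrow> rational_linear_form h \<Longrightarrow> rational_linear_form (\<lambda>x. g x - h x)"
  by (auto simp: rational_linear_form_def linear_compose_sub)

lemma rational_subspace_kernel:
  assumes "finite I" "\<And>i. i \<in> I \<Longrightarrow> rational_linear_form (g i)"
  shows "rational_subspace {x. \<forall>i\<in>I. g i x = 0}"
proof -
  have "\<forall>i\<in>I. \<exists>c. c \<in> rational_points \<and> (\<forall>x. g i x = c \<bullet> x)"
    using rational_linear_formE[OF assms(2)] by blast
  then obtain c where c: "\<And>i. i \<in> I \<Longrightarrow> c i \<in> rational_points" "\<And>i x. i \<in> I \<Longrightarrow> g i x = c i \<bullet> x"
    by (auto dest!: bchoice)
  then have "rational_subspace {x \<in> UNIV. \<forall>c\<in>c ` I. c \<bullet> x = 0}"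
    using assms(1) by (intro rational_subspace_hyperplanes_Int rational_subspace_UNIV) auto
  then show ?thesis using c(2) by simp
qed

section \<open>Counting lattice points of the polytope\<close>

locale rational_polytope =
  fixes f :: "nat \<Rightarrow> real ^ 'n::{finite,linorder} \<Rightarrow> real" and m :: nat
    and s P :: "(real ^ 'n::{finite,linorder}) set"
  assumes forms: "\<And>i. i \<in> {1..m} \<Longrightarrow> rational_linear_form (f i)"
    and m: "m \<ge> 1"
    and s: "s = {x. \<forall>i\<in>{1..m}. f i x = 1}"
    and P: "P = s \<inter> {x. \<forall>j. 0 \<le> x $ j}"
    and bounded: "bounded P"
    and not_coord: "\<And>j. \<not> P \<subseteq> {x. x $ j = 0}"
begin

abbreviation polytope_dim :: nat where
  "polytope_dim \<equiv> nat (aff_dim s)"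

definition level :: "real \<Rightarrow> (real, 'n) vec set" where
  "level t = {x. \<forall>i\<in>{1..m}. f i x = t}"

definition cone_space :: "(real, 'n) vec set" where
  "cone_space = {x. \<forall>i\<in>{1..m}. f i x = f 1 x}"

lemma linear_forms: "i \<in> {1..m} \<Longrightarrow> linear (f i)"
  using forms by (simp add: rational_linear_form_def)

lemma level_add: "x \<in> level t \<Longrightarrow> y \<in> level u \<Longrightarrow> x + y \<in> level (t + u)"
  using linear_forms by (simp add: level_def linear_add)

lemma level_diff: "x \<in> level t \<Longrightarrow> y \<in> level u \<Longrightarrow> x - y \<in> level (t - u)"
  using linear_forms by (simp add: level_def linear_diff)

lemma level_scale: "x \<in> level t \<Longrightarrow> r *\<^sub>R x \<in> level (r * t)"
  using linear_forms by (simp add: level_def linear_scale)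

lemma s_eq_level: "s = level 1"
  by (simp add: s level_def)

lemma P_eq_level: "P = nonneg_orthant \<inter> level 1"
  by (auto simp: P s_eq_level nonneg_orthant_def)

lemma level_eq_cone_space_slice: "level t = {x \<in> cone_space. f 1 x = t}"
  using m by (auto simp: level_def cone_space_def)

lemma cone_space_in_level: "x \<in> cone_space \<Longrightarrow> x \<in> level (f 1 x)"
  by (simp add: level_eq_cone_space_slice)

lemma level_subset_cone_space: "level t \<subseteq> cone_space"
  by (auto simp: level_eq_cone_space_slice)

lemma rational_cone_space: "rational_subspace cone_space"
proof -
  have "rational_subspace {x. \<forall>i\<in>{1..m}. f i x - f 1 x = 0}"
    using forms m by (intro rational_subspace_kernel rational_linear_form_diff) auto
  then show ?thesis by (simp add: cone_space_def)
qed

lemma rational_level_0: "rational_subspace (level 0)"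
  unfolding level_def using forms by (intro rational_subspace_kernel) auto

lemmas subspace_cone_space = subspace_rational_subspace[OF rational_cone_space]
  and subspace_level_0 = subspace_rational_subspace[OF rational_level_0]

lemma zero_in_level_0: "0 \<in> level 0"
  using subspace_level_0 by (rule subspace_0)

lemma ex_height_vector: "\<exists>\<eta>\<in>rational_points. \<forall>x. f 1 x = \<eta> \<bullet> x"
  using rational_linear_formE[OF forms, of 1] m by auto

lemma level_translate: "y \<in> level t \<Longrightarrow> level t = (+) y ` level 0"
proof (intro equalityI subsetI)
  fix x assume "y \<in> level t" "x \<in> level t"
  then show "x \<in> (+) y ` level 0"
    using level_diff[of x t y t] by (intro image_eqI[of _ _ "x - y"]) auto
qed (use level_add[of y t _ 0] in auto)

lemma dilate_level: "t \<noteq> 0 \<Longrightarrow> dilate t (level 1) = level t"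
proof (intro equalityI subsetI)
  fix x assume "t \<noteq> 0" "x \<in> level t"
  then show "x \<in> dilate t (level 1)"
    using level_scale[of x t "1 / t"]
    by (auto simp: dilate_def intro!: image_eqI[of _ _ "(1 / t) *\<^sub>R x"])
qed (use level_scale in \<open>fastforce simp: dilate_def\<close>)

lemma dilate_P:
  assumes "t > 0"
  shows "dilate t P = nonneg_orthant \<inter> level t"
proof -
  have "t *\<^sub>R x \<in> nonneg_orthant \<longleftrightarrow> x \<in> nonneg_orthant" for x :: "(real, 'n) vec"
    using assms by (simp add: nonneg_orthant_def zero_le_mult_iff)
  then have "dilate t P = nonneg_orthant \<inter> dilate t (level 1)"
    by (auto simp: dilate_def P_eq_level)
  then show ?thesis using dilate_level assms by simp
qed

lemma affine_level: "affine (level 1)"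
  unfolding affine_def
proof (intro ballI allI impI)
  fix x y :: "(real, 'n) vec" and a b :: real
  assume "x \<in> level 1" "y \<in> level 1" and "a + b = 1"
  then show "a *\<^sub>R x + b *\<^sub>R y \<in> level 1"
    using level_add[OF level_scale level_scale, of x 1 y 1 a b] by simp
qed

lemma ex_positive_point: "\<exists>p\<in>level 1. \<forall>j. 0 < p $ j"
proof -
  have "\<exists>q\<in>P. q $ j > 0" for j using not_coord[of j] by (force simp: P order_le_less)
  then obtain q where q: "\<And>j. q j \<in> P" "\<And>j. q j $ j > 0" by metis
  define p where "p = (\<Sum>i\<in>UNIV. (1 / real CARD('n)) *\<^sub>R q i)"
  have "convex P" unfolding P_eq_level
    using convex_nonneg_orthant affine_level affine_imp_convex by (blast intro: convex_Int)
  then have "p \<in> P" unfolding p_def using q(1) by (intro convex_sum) auto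
  moreover have "p $ j > 0" for j
  proof -
    have "q i $ j \<ge> 0" for i using q(1)[of i] by (simp add: P)
    then have "(\<Sum>i\<in>UNIV. (1 / real CARD('n)) * q i $ j) > 0"
      using q(2)[of j] by (intro sum_pos2[of _ j]) auto
    then show ?thesis by (simp add: p_def)
  qed
  ultimately show ?thesis by (auto simp: P_eq_level)
qed

lemma rel_interior_P: "rel_interior P = {x \<in> level 1. \<forall>j. 0 < x $ j}"
proof -
  have "rel_interior P = interior nonneg_orthant \<inter> level 1"
    unfolding P_eq_level using ex_positive_point
    by (intro rel_interior_convex_Int_affine convex_nonneg_orthant affine_level)
       (auto simp: interior_nonneg_orthant)
  then show ?thesis by (auto simp: interior_nonneg_orthant)
qed

lemma affine_hull_P: "affine hull P = level 1"
proof -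
  have "affine hull (level 1 \<inter> nonneg_orthant) = affine hull level 1"
    using ex_positive_point
    by (intro affine_hull_affine_Int_nonempty_interior affine_level)
       (auto simp: interior_nonneg_orthant)
  then show ?thesis using affine_level by (simp add: P_eq_level Int_commute affine_hull_eq)
qed

lemma nonneg_level_0_eq_0:
  assumes y: "y \<in> level 0" "\<And>j. 0 \<le> y $ j"
  shows "y = 0"
proof (rule ccontr)
  assume "y \<noteq> 0"
  obtain p where p: "p \<in> level 1" "\<And>j. 0 < p $ j" using ex_positive_point by blast
  obtain M where M: "\<And>x. x \<in> P \<Longrightarrow> norm (x - p) \<le> M"
    using bounded unfolding bounded_any_center[of _ p] by (auto simp: dist_norm norm_minus_commute)
  have "p + r *\<^sub>R y \<in> P" if "r \<ge> 0" for r
    using level_add[OF p(1) level_scale[OF y(1)], of r] p(2) y(2) that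
    by (simp add: P_eq_level nonneg_orthant_def add_nonneg_nonneg less_imp_le)
  then have r: "r * norm y \<le> M" if "r \<ge> 0" for r using M[of "p + r *\<^sub>R y"] that by simp
  have "M \<ge> 0" using r[of 0] by simp
  then show False using r[of "(M + 1) / norm y"] \<open>y \<noteq> 0\<close> by simp
qed

lemma pointed:
  assumes x: "x \<in> cone_space" "x \<noteq> 0" "\<And>j. 0 \<le> x $ j"
  shows "f 1 x > 0"
proof (rule ccontr)
  assume "\<not> f 1 x > 0"
  moreover have "f 1 x \<noteq> 0" using nonneg_level_0_eq_0 x cone_space_in_level by metis
  ultimately have neg: "f 1 x < 0" by simp
  obtain p where p: "p \<in> level 1" "\<And>j. 0 < p $ j" using ex_positive_point by blast
  define y where "y = p + (1 / (- f 1 x)) *\<^sub>R x"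
  have "y \<in> level (1 + 1 / (- f 1 x) * f 1 x)"
    unfolding y_def using p(1) cone_space_in_level[OF x(1)] by (intro level_add level_scale)
  then have "y \<in> level 0" using neg by simp
  moreover have "0 < y $ j" for j
    using p(2)[of j] x(3)[of j] neg divide_nonneg_pos[of "x $ j" "- f 1 x"] by (simp add: y_def)
  ultimately show False
    using nonneg_level_0_eq_0[of y] less_imp_le by (metis less_irrefl zero_index)
qed

lemma dim_level_0: "dim (level 0) = polytope_dim"
proof -
  obtain p where "p \<in> level 1" using ex_positive_point by blast
  then have "aff_dim s = aff_dim (level 0)"
    unfolding s_eq_level
    using level_translate[of p 1] aff_dim_translation_eq[of p "level 0"] by simp
  then show ?thesis using aff_dim_subspace[OF subspace_level_0] by simp
qed

lemma dim_cone_space: "dim cone_space = Suc polytope_dim"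
proof -
  obtain p where p: "p \<in> level 1" using ex_positive_point by blast
  have "x \<in> span (insert p (level 0))" if "x \<in> cone_space" for x
  proof -
    have "x - f 1 x *\<^sub>R p \<in> level 0"
      using level_diff[OF cone_space_in_level[OF that] level_scale[OF p, of "f 1 x"]] by simp
    then show ?thesis unfolding span_insert using span_base by blast
  qed
  moreover have "span (insert p (level 0)) \<subseteq> cone_space"
    using p level_subset_cone_space subspace_cone_space by (intro span_minimal) auto
  ultimately have "cone_space = span (insert p (level 0))" by blast
  moreover have "p \<notin> span (level 0)"
    unfolding span_eq_iff[THEN iffD2, OF subspace_level_0] using p m by (auto simp: level_def)
  ultimately show ?thesis by (simp add: dim_insert dim_level_0)
qed

lemma direction_lattice_P: "direction_lattice P = integer_points \<inter> level 0"
proof -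
  obtain p where p: "p \<in> level 1" using ex_positive_point by blast
  have "{x - y | x y. x \<in> level 1 \<and> y \<in> level 1} = level 0"
  proof (intro equalityI subsetI)
    fix z assume "z \<in> level 0"
    then have "p + z \<in> level 1" using level_translate[OF p] by blast
    then show "z \<in> {x - y | x y. x \<in> level 1 \<and> y \<in> level 1}" using p by force
  qed (use level_diff[of _ 1 _ 1] in auto)
  then show ?thesis by (simp add: direction_lattice_def affine_hull_P)
qed

definition realizable :: "('n \<Rightarrow> 'n) set" where
  "realizable = {\<tau>. \<tau> permutes UNIV \<and> realizable_in \<tau> (rel_interior P)}"

definition closed_chamber :: "('n \<Rightarrow> 'n) \<Rightarrow> real \<Rightarrow> (real, 'n) vec set" where
  "closed_chamber \<sigma> t = {x \<in> integer_points \<inter> level t. (\<forall>j. 0 \<le> x $ j) \<and> compatible x \<sigma>}"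

definition open_chamber :: "('n \<Rightarrow> 'n) \<Rightarrow> real \<Rightarrow> (real, 'n) vec set" where
  "open_chamber \<sigma> t = {x \<in> integer_points \<inter> level t. (\<forall>j. 0 < x $ j) \<and> realizes x \<sigma>}"

lemma finite_realizable: "finite realizable"
  unfolding realizable_def by (rule finite_subset[OF _ finite_permutations[of UNIV]]) auto

lemma chamber_reciprocity:
  assumes "\<sigma> \<in> realizable"
  shows "\<exists>Q. quasipolynomial_le polytope_dim Q \<and>
    (\<forall>t\<ge>0. Q t = real (card (closed_chamber \<sigma> (of_int t)))) \<and>
    (\<forall>t\<ge>1. (-1) ^ polytope_dim * Q (- t) = real (card (open_chamber \<sigma> (of_int t))))"
proof -
  obtain p where "p \<in> rel_interior P" "realizes p \<sigma>"
    using assms by (auto simp: realizable_def realizable_in_def)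
  then have p: "p \<in> cone_space" "\<And>a. a \<in> chamber_forms \<sigma> \<Longrightarrow> a \<bullet> p > 0"
    using rel_interior_P level_subset_cone_space chamber_forms_pos_iff[of \<sigma> p] by auto
  obtain \<eta> where \<eta>: "\<eta> \<in> rational_points" "\<And>x. f 1 x = \<eta> \<bullet> x" using ex_height_vector by blast
  have "\<eta> \<bullet> x > 0" if "x \<in> cone_space" "x \<noteq> 0" "\<And>a. a \<in> chamber_forms \<sigma> \<Longrightarrow> a \<bullet> x \<ge> 0" for x
    using pointed[of x] that chamber_forms_nonneg_iff[of \<sigma> x] \<eta>(2) by simp
  from rational_cone_reciprocity[OF rational_cone_space finite_chamber_forms
      chamber_forms_rational \<eta>(1) p this dim_cone_space]
  obtain Q where "quasipolynomial_le polytope_dim Q"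
    "\<And>t. t \<ge> 0 \<Longrightarrow> Q t = real (card {x \<in> integer_points \<inter> cone_space.
      (\<forall>a\<in>chamber_forms \<sigma>. a \<bullet> x \<ge> 0) \<and> \<eta> \<bullet> x = of_int t})"
    "\<And>t. t \<ge> 1 \<Longrightarrow> (-1) ^ polytope_dim * Q (- t) = real (card {x \<in> integer_points \<inter> cone_space.
      (\<forall>a\<in>chamber_forms \<sigma>. a \<bullet> x > 0) \<and> \<eta> \<bullet> x = of_int t})" by blast
  moreover have "closed_chamber \<sigma> t = {x \<in> integer_points \<inter> cone_space.
      (\<forall>a\<in>chamber_forms \<sigma>. a \<bullet> x \<ge> 0) \<and> \<eta> \<bullet> x = t}" for t
    by (auto simp: closed_chamber_def chamber_forms_nonneg_iff level_eq_cone_space_slice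
        simp flip: \<eta>(2))
  moreover have "open_chamber \<sigma> t = {x \<in> integer_points \<inter> cone_space.
      (\<forall>a\<in>chamber_forms \<sigma>. a \<bullet> x > 0) \<and> \<eta> \<bullet> x = t}" for t
    by (auto simp: open_chamber_def chamber_forms_pos_iff level_eq_cone_space_slice simp flip: \<eta>(2))
  ultimately show ?thesis by auto
qed

lemma finite_integer_points_dilate: "finite (integer_points \<inter> dilate t P)"
  using bounded by (intro finite_integer_points) (auto simp: dilate_def intro: bounded_scaling)

lemma A_closed_eq_sum:
  assumes "t \<ge> 1"
  shows "A_closed P t = (\<Sum>\<sigma>\<in>realizable. card (closed_chamber \<sigma> (real t)))"
proof -
  have dilate: "dilate (real t) P = nonneg_orthant \<inter> level (real t)"
    using assms by (simp add: dilate_P)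
  then have "finite (closed_chamber \<sigma> (real t))" for \<sigma>
    by (intro finite_subset[OF _ finite_integer_points_dilate[of "real t"]])
       (auto simp: closed_chamber_def nonneg_orthant_def)
  moreover have "{(x, \<sigma>). x \<in> integer_points \<inter> dilate (real t) P \<and> (\<forall>j. 0 \<le> x $ j) \<and>
     \<sigma> permutes UNIV \<and> compatible x \<sigma> \<and> realizable_in \<sigma> (rel_interior P)} =
     prod.swap ` (SIGMA \<sigma>:realizable. closed_chamber \<sigma> (real t))"
    by (auto simp: dilate closed_chamber_def realizable_def nonneg_orthant_def image_iff)
  ultimately show ?thesis
    using finite_realizable by (simp add: A_closed_def card_image card_SigmaI)
qed

lemma A_open_eq:
  "t \<ge> 1 \<Longrightarrow> A_open P t = card {x \<in> integer_points \<inter> level (real t). x \<in> distinct_positive}"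
  unfolding A_open_def
  by (intro arg_cong[of _ _ card])
     (auto simp: dilate_P distinct_positive_def nonneg_orthant_def less_imp_le)

lemma open_chamber_iff_sorting:
  assumes t: "t > 0" and x: "x \<in> integer_points \<inter> level t" "\<And>j. 0 < x $ j"
  shows "\<sigma> \<in> realizable \<and> x \<in> open_chamber \<sigma> t \<longleftrightarrow> \<sigma> permutes UNIV \<and> realizes x \<sigma>"
proof
  assume \<sigma>: "\<sigma> permutes UNIV \<and> realizes x \<sigma>"
  have "(1 / t) *\<^sub>R x \<in> rel_interior P"
    using level_scale[of x t "1 / t"] x t by (simp add: rel_interior_P)
  moreover have "realizes ((1 / t) *\<^sub>R x) \<sigma>" using \<sigma> t by (simp add: realizes_scale)
  ultimately show "\<sigma> \<in> realizable \<and> x \<in> open_chamber \<sigma> t"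
    using \<sigma> x by (auto simp: realizable_def realizable_in_def open_chamber_def)
qed (simp add: realizable_def open_chamber_def)

lemma A_open_eq_sum:
  assumes "t \<ge> 1"
  shows "A_open P t = (\<Sum>\<sigma>\<in>realizable. card (open_chamber \<sigma> (real t)))"
  unfolding A_open_eq[OF assms]
proof (rule card_ex1_cover[OF finite_realizable])
  fix \<sigma> assume \<sigma>: "\<sigma> \<in> realizable"
  show "open_chamber \<sigma> (real t) \<subseteq> {x \<in> integer_points \<inter> level (real t). x \<in> distinct_positive}"
    using \<sigma> realizes_imp_inj by (auto simp: open_chamber_def realizable_def distinct_positive_def)
  show "finite (open_chamber \<sigma> (real t))"
    using assms by (intro finite_subset[OF _ finite_integer_points_dilate[of "real t"]])
      (auto simp: open_chamber_def dilate_P nonneg_orthant_def less_imp_le)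
next
  fix x assume x: "x \<in> {x \<in> integer_points \<inter> level (real t). x \<in> distinct_positive}"
  then show "\<exists>!\<sigma>. \<sigma> \<in> realizable \<and> x \<in> open_chamber \<sigma> (real t)"
    using assms open_chamber_iff_sorting[of "real t" x] ex1_sorting_permutation[of "\<lambda>j. x $ j"]
    by (simp add: distinct_positive_def realizes_def)
qed

lemma closed_chamber_0: "closed_chamber \<sigma> 0 = {0}"
  using nonneg_level_0_eq_0 zero_in_level_0
  by (auto simp: closed_chamber_def compatible_def mono_def)

theorem ex_counting_quasipolynomial:
  obtains Q where "quasipolynomial_le polytope_dim Q"
    "\<And>t. t \<ge> 1 \<Longrightarrow> Q (int t) = real (A_closed P t)"
    "\<And>t. t \<ge> 1 \<Longrightarrow> (-1) ^ polytope_dim * Q (- int t) = real (A_open P t)"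
    "Q 0 = real (card realizable)"
proof -
  obtain q where q: "\<And>\<sigma>. \<sigma> \<in> realizable \<Longrightarrow> quasipolynomial_le polytope_dim (q \<sigma>)"
    "\<And>\<sigma> t. \<sigma> \<in> realizable \<Longrightarrow> t \<ge> 0 \<Longrightarrow> q \<sigma> t = real (card (closed_chamber \<sigma> (of_int t)))"
    "\<And>\<sigma> t. \<sigma> \<in> realizable \<Longrightarrow> t \<ge> 1 \<Longrightarrow>
      (-1) ^ polytope_dim * q \<sigma> (- t) = real (card (open_chamber \<sigma> (of_int t)))"
    using chamber_reciprocity by metis
  define Q where "Q t = (\<Sum>\<sigma>\<in>realizable. q \<sigma> t)" for t
  have "quasipolynomial_le polytope_dim Q"
    unfolding Q_def using q(1) by (rule quasipolynomial_le_sum)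
  moreover have "Q (int t) = real (A_closed P t)" if "t \<ge> 1" for t
    using that q(2)[of _ "int t"] by (simp add: Q_def A_closed_eq_sum)
  moreover have "(-1) ^ polytope_dim * Q (- int t) = real (A_open P t)" if "t \<ge> 1" for t
    using that q(3)[of _ "int t"] by (simp add: Q_def A_open_eq_sum sum_distrib_left)
  moreover have "Q 0 = real (card realizable)"
    using q(2)[of _ 0] by (simp add: Q_def closed_chamber_0)
  ultimately show ?thesis using that by blast
qed

lemma ex_rational_point_level_1: "\<exists>u\<in>level 1. u \<in> rational_points"
proof -
  obtain \<eta> where \<eta>: "\<eta> \<in> rational_points" "\<And>x. f 1 x = \<eta> \<bullet> x" using ex_height_vector by blast
  obtain p where "p \<in> cone_space" "\<eta> \<bullet> p > 0"
    using ex_positive_point by (auto simp: level_eq_cone_space_slice simp flip: \<eta>(2))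
  then obtain u where "u \<in> cone_space" "u \<in> rational_points" "\<eta> \<bullet> u = 1"
    using ex_rational_point_in_cone[OF rational_cone_space, of "{}" \<eta> p] \<eta>(1) by auto
  then show ?thesis by (auto simp: level_eq_cone_space_slice simp flip: \<eta>(2))
qed

lemma ex_lattice_period:
  obtains M where "M > 0" "\<And>t. integer_points \<inter> level (of_int t) \<noteq> {} \<longleftrightarrow> M dvd t"
proof -
  define H where "H = {t :: int. integer_points \<inter> level (of_int t) \<noteq> {}}"
  have "additive_subgroup H"
    unfolding additive_subgroup_def
  proof (intro conjI ballI)
    show "0 \<in> H" using integer_points_zero zero_in_level_0 by (force simp: H_def)
    fix t u assume "t \<in> H" "u \<in> H"
    then obtain x y where "x \<in> integer_points" "x \<in> level (of_int t)"
        "y \<in> integer_points" "y \<in> level (of_int u)"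
      by (auto simp: H_def)
    then have "x - y \<in> integer_points \<inter> level (of_int (t - u))"
      using level_diff by (simp add: integer_points_diff)
    then show "t - u \<in> H" unfolding H_def by blast
  qed
  then have H: "t \<in> H \<longleftrightarrow> Gcd H dvd t" for t by (rule additive_subgroup_int_iff_Gcd_dvd)
  obtain u where u: "u \<in> level 1" "u \<in> rational_points" using ex_rational_point_level_1 by blast
  then obtain D where D: "D > 0" "real D *\<^sub>R u \<in> integer_points"
    using ex_common_denominator[of "{u}"] by auto
  then have "int D \<in> H" using level_scale[OF u(1), of "real D"] by (auto simp: H_def)
  then have "Gcd H \<noteq> 0" using H D(1) by fastforce
  then have "Gcd H > 0" by (simp add: order_less_le)
  moreover have "integer_points \<inter> level (of_int t) \<noteq> {} \<longleftrightarrow> Gcd H dvd t" for t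
    unfolding H[symmetric] by (simp add: H_def)
  ultimately show ?thesis using that by blast
qed

lemma integer_points_dilate_s_iff:
  "integer_points \<inter> dilate t s \<noteq> {} \<longleftrightarrow> integer_points \<inter> level t \<noteq> {}"
proof (cases "t = 0")
  case True
  have "0 \<in> dilate 0 s" using ex_positive_point by (auto simp: dilate_def s_eq_level)
  then show ?thesis using True integer_points_zero zero_in_level_0 by blast
qed (simp add: s_eq_level dilate_level)

context
  fixes B :: "(real, 'n) vec set" and p :: "(real, 'n) vec"
  assumes B: "lattice_basis B (integer_points \<inter> level 0)" and p: "p \<in> level 1"
begin

lemma independent_B: "independent B"
  using B by (simp add: lattice_basis_def)

lemma finite_B: "finite B"
  using independent_B by (rule independent_imp_finite)

lemma span_B: "span B = level 0"
  using rational_level_0 B by (rule span_lattice_basis)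

lemma card_B: "card B = polytope_dim"
  using dim_span_eq_card_independent[OF independent_B] by (simp add: span_B dim_level_0)

lemma range_from_coordinates:
  assumes "y \<in> level t"
  shows "range (from_coordinates y B) = level t"
proof (intro equalityI subsetI)
  fix x assume "x \<in> range (from_coordinates y B)"
  then obtain u where x: "x = y + (\<Sum>b\<in>B. u b *\<^sub>R b)" by (auto simp: from_coordinates_def)
  have "(\<Sum>b\<in>B. u b *\<^sub>R b) \<in> level 0"
    unfolding span_B[symmetric] by (intro span_sum span_scale span_base)
  then show "x \<in> level t" using level_add[OF assms] by (force simp: x)
next
  fix x assume "x \<in> level t"
  then have "x - y \<in> span B" using level_diff[OF _ assms, of x t] by (simp add: span_B)
  from from_coordinates_representation[OF independent_B finite_B this]
  show "x \<in> range (from_coordinates y B)" by (metis rangeI)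
qed

lemma null_nongeneric:
  assumes "\<forall>i j. i \<noteq> j \<longrightarrow> \<not> P \<subseteq> {x. x $ i = x $ j}"
  shows "{u \<in> B \<rightarrow>\<^sub>E UNIV. from_coordinates p B u \<in> nonneg_orthant - distinct_positive}
    \<in> null_sets (Pi\<^sub>M B (\<lambda>_. lborel))"
proof -
  define wall_forms :: "(real, 'n) vec set" where
    "wall_forms = range (\<lambda>j. axis j 1) \<union> (\<lambda>(i, j). axis i 1 - axis j 1) ` {(i, j). i \<noteq> j}"
  define wall where "wall c = {u \<in> B \<rightarrow>\<^sub>E UNIV. c \<bullet> from_coordinates p B u = 0}" for c
  have "wall c \<in> null_sets (Pi\<^sub>M B (\<lambda>_. lborel))" if "c \<in> wall_forms" for c
  proof -
    have "\<exists>q\<in>P. c \<bullet> q \<noteq> 0"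
      using that not_coord assms
      by (auto simp: wall_forms_def inner_axis' inner_diff_left subset_iff Bex_def)
    then have "\<exists>q\<in>range (from_coordinates p B). c \<bullet> q \<noteq> 0"
      unfolding range_from_coordinates[OF p] by (auto simp: P_eq_level)
    then obtain v where "c \<bullet> from_coordinates p B v \<noteq> 0" by blast
    then show ?thesis unfolding wall_def by (rule null_hyperplane_from_coordinates[OF finite_B])
  qed
  moreover have "finite wall_forms" by (simp add: wall_forms_def)
  ultimately have walls: "(\<Union>c\<in>wall_forms. wall c) \<in> null_sets (Pi\<^sub>M B (\<lambda>_. lborel))"
    by (intro null_sets_UN') (auto intro: countable_finite)
  have "\<exists>c\<in>wall_forms. c \<bullet> x = 0" if x: "x \<in> nonneg_orthant - distinct_positive" for x
  proof -
    consider (zero) j where "x $ j = 0" | (equal) i j where "i \<noteq> j" "x $ i = x $ j"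
      using x by (auto simp: nonneg_orthant_def distinct_positive_def inj_def order_le_less)
    then show ?thesis
    proof cases
      case (zero j)
      then show ?thesis by (intro bexI[of _ "axis j 1"]) (auto simp: wall_forms_def inner_axis')
    next
      case (equal i j)
      then show ?thesis
        by (intro bexI[of _ "axis i 1 - axis j 1"])
           (auto simp: wall_forms_def inner_axis' inner_diff_left)
    qed
  qed
  then have "{u \<in> B \<rightarrow>\<^sub>E UNIV. from_coordinates p B u \<in> nonneg_orthant - distinct_positive}
      \<subseteq> (\<Union>c\<in>wall_forms. wall c)" unfolding wall_def by blast
  then show ?thesis
    by (intro null_sets_subset[OF walls] from_coordinates_vimage_sets sets.Diff borel_closed
        borel_open closed_nonneg_orthant open_distinct_positive)
qed

lemma A_open_eq_card_grid:
  assumes t: "t \<ge> 1" and y: "y \<in> integer_points \<inter> level (real t)"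
  defines "\<beta> \<equiv> representation B (y - real t *\<^sub>R p)"
  shows "A_open P t = card {z \<in> B \<rightarrow>\<^sub>E UNIV.
    from_coordinates p B (grid_point (1 / real t) \<beta> z) \<in> distinct_positive}"
proof -
  have "y - real t *\<^sub>R p \<in> span B"
    using level_diff[OF _ level_scale[OF p], of y "real t" "real t"] y by (simp add: span_B)
  then have "from_coordinates (real t *\<^sub>R p) B \<beta> = y"
    unfolding \<beta>_def by (rule from_coordinates_representation[OF independent_B finite_B])
  then have grid: "from_coordinates p B (grid_point (1 / real t) \<beta> z) \<in> distinct_positive \<longleftrightarrow>
      from_coordinates y B (\<lambda>b. of_int (z b)) \<in> distinct_positive" for z
    using t by (subst from_coordinates_grid_point) (simp_all add: distinct_positive_scale)
  have "(+) y ` (integer_points \<inter> level 0) = integer_points \<inter> level (real t)"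
  proof (intro equalityI subsetI)
    fix x assume x: "x \<in> integer_points \<inter> level (real t)"
    then have "x - y \<in> integer_points \<inter> level 0"
      using y level_diff[of x "real t" y "real t"] by (auto simp: integer_points_diff)
    then show "x \<in> (+) y ` (integer_points \<inter> level 0)" by (intro image_eqI[of _ _ "x - y"]) auto
  qed (use y level_add[of y "real t" _ 0] in \<open>auto simp: integer_points_add\<close>)
  then have "bij_betw (\<lambda>z. from_coordinates y B (\<lambda>b. of_int (z b)))
      (B \<rightarrow>\<^sub>E UNIV) (integer_points \<inter> level (real t))"
    using bij_betw_lattice_coordinates[OF B, of y] by simp
  then have "bij_betw (\<lambda>z. from_coordinates y B (\<lambda>b. of_int (z b)))
      {z \<in> B \<rightarrow>\<^sub>E UNIV. from_coordinates y B (\<lambda>b. of_int (z b)) \<in> distinct_positive}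
      {x \<in> integer_points \<inter> level (real t). x \<in> distinct_positive}"
    by (rule bij_betw_Collect) simp
  then show ?thesis unfolding A_open_eq[OF t] grid by (rule bij_betw_same_card[symmetric])
qed

lemma tendsto_A_open:
  fixes T :: "nat \<Rightarrow> nat"
  assumes generic: "\<forall>i j. i \<noteq> j \<longrightarrow> \<not> P \<subseteq> {x. x $ i = x $ j}"
    and T: "\<And>k. T k \<ge> 1" "\<And>k. integer_points \<inter> level (real (T k)) \<noteq> {}"
      "filterlim T at_top sequentially"
  shows "(\<lambda>k. real (A_open P (T k)) / real (T k) ^ polytope_dim) \<longlonglongrightarrow> coordinate_volume B p P"
proof -
  have "\<forall>k. \<exists>y. y \<in> integer_points \<inter> level (real (T k))" using T(2) by blast
  then obtain y where y: "\<And>k. y k \<in> integer_points \<inter> level (real (T k))" by metis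
  have range: "nonneg_orthant \<inter> range (from_coordinates p B) = P"
    by (simp add: P_eq_level range_from_coordinates[OF p])
  then have volume: "coordinate_volume B p nonneg_orthant = coordinate_volume B p P"
    unfolding coordinate_volume_def
    by (intro arg_cong[of _ _ "measure _"]) (auto simp: from_coordinates_def)
  have "distinct_positive \<subseteq> (nonneg_orthant :: (real, 'n) vec set)"
    by (auto simp: distinct_positive_def nonneg_orthant_def less_imp_le)
  moreover have "(\<lambda>k. 1 / real (T k)) \<longlonglongrightarrow> 0"
    using filterlim_compose[OF lim_1_over_n T(3)] .
  moreover have "1 / real (T k) > 0" for k using T(1)[of k] by simp
  moreover define \<beta> where "\<beta> k = representation B (y k - real (T k) *\<^sub>R p)" for k
  ultimately have "(\<lambda>k. real (card {z \<in> B \<rightarrow>\<^sub>E UNIV.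
      from_coordinates p B (grid_point (1 / real (T k)) (\<beta> k) z) \<in> distinct_positive})
      * (1 / real (T k)) ^ card B) \<longlonglongrightarrow> coordinate_volume B p nonneg_orthant"
    using bounded range
    by (intro coordinate_grid_count_limit independent_B open_distinct_positive closed_nonneg_orthant
        null_nongeneric generic) simp_all
  then show ?thesis
    by (simp add: \<beta>_def A_open_eq_card_grid[OF T(1) y, symmetric] volume card_B power_one_over
        field_simps)
qed

end

definition leading_coefficient :: "int \<Rightarrow> real" where
  "leading_coefficient t = (if integer_points \<inter> dilate (of_int t) s \<noteq> {} then vol P else 0)"

lemma leading_coefficient_level:
  "leading_coefficient t = (if integer_points \<inter> level (of_int t) \<noteq> {} then vol P else 0)"
  by (simp add: leading_coefficient_def integer_points_dilate_s_iff)

lemma leading_coefficient_uminus: "leading_coefficient (- t) = leading_coefficient t"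
proof -
  obtain M where "\<And>t. integer_points \<inter> level (of_int t) \<noteq> {} \<longleftrightarrow> M dvd t"
    by (rule ex_lattice_period) blast
  then show ?thesis unfolding leading_coefficient_level by (simp only: dvd_minus_iff)
qed

lemma vol_eq_coordinate_volume:
  obtains B p where "lattice_basis B (integer_points \<inter> level 0)" "p \<in> level 1"
    "vol P = coordinate_volume B p P"
proof -
  define B where "B = (SOME B. lattice_basis B (direction_lattice P))"
  define p where "p = (SOME p. p \<in> affine hull P)"
  have "\<exists>B. lattice_basis B (direction_lattice P)"
    unfolding direction_lattice_P by (rule ex_lattice_basis[OF subspace_level_0])
  then have "lattice_basis B (integer_points \<inter> level 0)"
    unfolding B_def direction_lattice_P[symmetric] by (rule someI_ex)
  moreover have "\<exists>p. p \<in> affine hull P" using ex_positive_point affine_hull_P by blast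
  then have "p \<in> level 1" unfolding p_def affine_hull_P[symmetric] by (rule someI_ex)
  moreover have "vol P = coordinate_volume B p P" by (simp add: vol_def B_def p_def)
  ultimately show ?thesis using that by blast
qed

lemma has_leading_term_A_open:
  assumes generic: "\<forall>i j. i \<noteq> j \<longrightarrow> \<not> P \<subseteq> {x. x $ i = x $ j}"
    and Q: "quasipolynomial_le polytope_dim Q" "\<And>t. t \<ge> 1 \<Longrightarrow> Q (int t) = real (A_open P t)"
  shows "has_leading_term Q leading_coefficient polytope_dim"
proof (rule has_leading_termI[OF Q(1)])
  fix t r :: int assume r: "r > 0"
  obtain M where M: "M > 0" "\<And>t. integer_points \<inter> level (of_int t) \<noteq> {} \<longleftrightarrow> M dvd t"
    by (rule ex_lattice_period) blast
  obtain T where T: "filterlim T at_top sequentially" "\<And>k. T k \<ge> 1" "\<And>k. M * r dvd int (T k) - t"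
    using ex_nat_progression[of "M * r" t] M(1) r by auto
  have "M dvd int (T k) \<longleftrightarrow> M dvd t" for k
    using dvd_mult_left[OF T(3)[of k]] dvd_add_right_iff[of M "int (T k) - t" t] by simp
  then have level: "integer_points \<inter> level (real (T k)) \<noteq> {} \<longleftrightarrow> M dvd t" for k
    using M(2)[of "int (T k)"] by simp
  have "(\<lambda>k. real (A_open P (T k)) / real (T k) ^ polytope_dim) \<longlonglongrightarrow> leading_coefficient t"
  proof (cases "M dvd t")
    case True
    obtain B p where "lattice_basis B (integer_points \<inter> level 0)" "p \<in> level 1"
        "vol P = coordinate_volume B p P"
      by (rule vol_eq_coordinate_volume)
    then show ?thesis
      using tendsto_A_open[OF _ _ generic T(2) _ T(1)] level M(2)[of t] True
      by (simp add: leading_coefficient_level)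
  next
    case False
    then have "integer_points \<inter> level (real (T k)) = {}" for k using level[of k] by blast
    then have "A_open P (T k) = 0" for k
      by (simp only: A_open_eq[OF T(2)]) simp
    then show ?thesis using M(2)[of t] False by (simp add: leading_coefficient_level)
  qed
  moreover have "Q (int (T k)) = real (A_open P (T k))" for k using Q(2) T(2) by blast
  moreover have "r dvd int (T k) - t" for k using dvd_mult_right[OF T(3)] .
  moreover have "filterlim (\<lambda>k. int (T k)) at_top sequentially"
    using filterlim_compose[OF filterlim_int_sequentially T(1)] .
  ultimately show "\<exists>T. filterlim T at_top sequentially \<and> (\<forall>k. r dvd T k - t) \<and>
      (\<lambda>k. Q (T k) / of_int (T k) ^ polytope_dim) \<longlonglongrightarrow> leading_coefficient t"
    by (intro exI[of _ "\<lambda>k. int (T k)"]) simp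
qed

theorem ex_reciprocal_counting_quasipolynomials:
  obtains Qo Q where "quasipolynomial Qo" "quasipolynomial Q"
    "\<And>t. t \<ge> 1 \<Longrightarrow> Qo (int t) = real (A_open P t)" "\<And>t. t \<ge> 1 \<Longrightarrow> Q (int t) = real (A_closed P t)"
    "Q 0 = real (card realizable)" "\<And>t. (-1) ^ polytope_dim * Qo (- t) = Q t"
    "\<forall>i j. i \<noteq> j \<longrightarrow> \<not> P \<subseteq> {x. x $ i = x $ j} \<Longrightarrow>
      has_leading_term Qo leading_coefficient polytope_dim \<and>
      has_leading_term Q leading_coefficient polytope_dim"
proof -
  obtain Q where Q: "quasipolynomial_le polytope_dim Q"
    "\<And>t. t \<ge> 1 \<Longrightarrow> Q (int t) = real (A_closed P t)"
    "\<And>t. t \<ge> 1 \<Longrightarrow> (-1) ^ polytope_dim * Q (- int t) = real (A_open P t)"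
    "Q 0 = real (card realizable)"
    by (rule ex_counting_quasipolynomial) blast
  define Qo where "Qo t = (-1) ^ polytope_dim * Q (- t)" for t
  have Qo: "quasipolynomial_le polytope_dim Qo"
    using Q(1) has_leading_term_reflect unfolding quasipolynomial_le_def Qo_def by blast
  have "(-1) ^ polytope_dim * ((-1) ^ polytope_dim * x) = x" for x :: real
    by (simp flip: mult.assoc power_mult_distrib)
  then have reciprocity: "(-1) ^ polytope_dim * Qo (- t) = Q t" for t by (simp add: Qo_def)
  have "has_leading_term Qo leading_coefficient polytope_dim \<and>
      has_leading_term Q leading_coefficient polytope_dim"
    if "\<forall>i j. i \<noteq> j \<longrightarrow> \<not> P \<subseteq> {x. x $ i = x $ j}"
  proof -
    have Qo_leading: "has_leading_term Qo leading_coefficient polytope_dim"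
      using that Qo Q(3) by (intro has_leading_term_A_open) (auto simp: Qo_def)
    from has_leading_term_reflect[OF this, of "(-1) ^ polytope_dim"]
    have "has_leading_term Q leading_coefficient polytope_dim"
      by (simp add: reciprocity leading_coefficient_uminus flip: power_mult_distrib)
    then show ?thesis using Qo_leading by blast
  qed
  then show ?thesis
    using that[of Qo Q] Q Qo reciprocity quasipolynomial_iff_le by (auto simp: Qo_def)
qed

end

theorem theorem3p14:
  fixes f :: "nat \<Rightarrow> real ^ 'n::{finite,linorder} \<Rightarrow> real" and m :: nat
    and s P :: "(real ^ 'n::{finite,linorder}) set"
  assumes forms: "\<And>i. i \<in> {1..m} \<Longrightarrow> rational_linear_form (f i)"
    and appear: "\<And>j. \<exists>i\<in>{1..m}. appears_in j (f i)"
    and s: "s = {x. \<forall>i\<in>{1..m}. f i x = 1}"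
    and consistent: "s \<noteq> {}"
    and P: "P = s \<inter> {x. \<forall>j. 0 \<le> x $ j}"
    and bounded: "bounded P"
    and not_coord: "\<And>j. \<not> P \<subseteq> {x. x $ j = 0}"
  shows "\<exists>Qo Q :: int \<Rightarrow> real.
    quasipolynomial Qo \<and> (\<forall>t\<ge>1. Qo (int t) = real (A_open P t)) \<and>
    quasipolynomial Q \<and> (\<forall>t\<ge>1. Q (int t) = real (A_closed P t)) \<and>
    ((\<forall>i j. i \<noteq> j \<longrightarrow> \<not> P \<subseteq> {x. x $ i = x $ j}) \<longrightarrow>
      (let L = (\<lambda>t. if integer_points \<inter> dilate (of_int t) s \<noteq> {} then vol P else 0) in
        has_leading_term Qo L (nat (aff_dim s)) \<and> has_leading_term Q L (nat (aff_dim s)))) \<and>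
    Q 0 = real (card {\<tau>. \<tau> permutes UNIV \<and> realizable_in \<tau> (rel_interior P)}) \<and>
    (\<forall>t. (-1) ^ nat (aff_dim s) * Qo (- t) = Q t)"
proof -
  have "m \<ge> 1" using appear[of undefined] by auto
  interpret rational_polytope f m s P
    by standard (fact forms \<open>m \<ge> 1\<close> s P bounded not_coord)+
  show ?thesis
    by (rule ex_reciprocal_counting_quasipolynomials)
      (unfold Let_def realizable_def leading_coefficient_def[abs_def], blast)
qed

end
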